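(* If $\mathcal{L} \subset \mathbb{P}^{2}_{\mathbb{C}}$ is a free arrangement of $d\geq 2$ lines, then $$\tau(\mathcal{L}) \geq \frac{3(d-1)^2}{4}.$$
   Context: We work over $\mathbb{C}$. An arrangement of $d$ lines $\mathcal{L}\subset\mathbb{P}^2$ is a set of $d$ distinct lines, identified with the reduced curve $\{f=0\}$ that is their union. The Tjurina number of a plane curve $C$ at a point $p$, where $p$ is moved to the origin in affine coordinates and $g\in\mathbb{C}\{x,y\}$ is a local equation of $C$, is $\tau_p(C)=\dim_{\mathbb{C}}\mathbb{C}\{x,y\}/\langle g,g_x,g_y\rangle$. The total Tjurina number is $\tau(C)=\sum_{p\in \mathrm{Sing}(C)}\tau_p(C)$. Let $S=\mathbb{C}[x,y,z]$ and $AR(f)=\{(a,b,c)\in S^3: af_x+bf_y+cf_z=0\}$, a graded $S$-module. The arrangement $\mathcal{L}$ is free if $AR(f)$ is a free graded $S$-module of rank $2$. *)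

theory Defs
  imports
    "HOL-Algebra.QuotRing"
    "HOL-Algebra.Embedded_Algebras"
    "HOL-Analysis.Analysis"
begin

section \<open>The polynomial ring in three variables\<close>

text \<open>
  \<open>S = \<complex>[x,y,z]\<close> is represented as the iterated polynomial ring \<open>\<complex>[x][y][z]\<close>: the innermost
  variable is \<open>x\<close>, the outermost is \<open>z\<close>.
\<close>

type_synonym poly3 = "complex poly poly poly"

definition coeff3 :: "poly3 \<Rightarrow> nat \<Rightarrow> nat \<Rightarrow> nat \<Rightarrow> complex" where
  "coeff3 f i j k = coeff (coeff (coeff f k) j) i"

definition homogeneous3 :: "nat \<Rightarrow> poly3 \<Rightarrow> bool" where
  "homogeneous3 e f \<longleftrightarrow> (\<forall>i j k. coeff3 f i j k \<noteq> 0 \<longrightarrow> i + j + k = e)"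

definition dx :: "poly3 \<Rightarrow> poly3" where "dx = map_poly (map_poly pderiv)"
definition dy :: "poly3 \<Rightarrow> poly3" where "dy = map_poly pderiv"
definition dz :: "poly3 \<Rightarrow> poly3" where "dz = pderiv"

text \<open>
  \<open>eval3 h f a b c\<close> is \<open>f(a,b,c)\<close> in a commutative \<open>\<complex>\<close>-algebra with structure map \<open>h\<close>.
\<close>

definition eval3 :: "(complex \<Rightarrow> 'a::comm_ring_1) \<Rightarrow> poly3 \<Rightarrow> 'a \<Rightarrow> 'a \<Rightarrow> 'a \<Rightarrow> 'a" where
  "eval3 h f a b c =
     poly (map_poly (\<lambda>q. poly (map_poly (\<lambda>r. poly (map_poly h r) a) q) b) f) c"

definition vanishes_at :: "poly3 \<Rightarrow> complex^3 \<Rightarrow> bool" where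
  "vanishes_at f v \<longleftrightarrow> eval3 id f (v$1) (v$2) (v$3) = 0"

section \<open>Line arrangements in the complex projective plane\<close>

text \<open>Points of the plane are the one-dimensional complex subspaces of \<open>\<complex>\<^sup>3\<close>.\<close>

type_synonym proj_point = "(complex^3) set"

definition proj_plane :: "proj_point set" where
  "proj_plane = {vec.span {v} | v. v \<noteq> 0}"

definition proj_line :: "complex^3 \<Rightarrow> proj_point set" where
  "proj_line a = {p \<in> proj_plane. \<forall>v\<in>p. a$1 * v$1 + a$2 * v$2 + a$3 * v$3 = 0}"

definition lin_form :: "complex^3 \<Rightarrow> poly3" where
  "lin_form a = [: [: [:0, a$1:], [:a$2:] :], [: [:a$3:] :] :]"

definition line_arrangement :: "proj_point set set \<Rightarrow> bool" where
  "line_arrangement L \<longleftrightarrow> finite L \<and> (\<forall>l\<in>L. \<exists>a. a \<noteq> 0 \<and> l = proj_line a)"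

text \<open>
  An equation \<open>f\<close> of the reduced union of the lines. It is unique up to a nonzero constant, which
  for nonempty \<open>L\<close> is accounted for by the choice of the coefficient vectors.
\<close>

definition arrangement_equation :: "proj_point set set \<Rightarrow> poly3 \<Rightarrow> bool" where
  "arrangement_equation L f \<longleftrightarrow>
     (\<exists>a. (\<forall>l\<in>L. a l \<noteq> 0 \<and> l = proj_line (a l)) \<and> f = (\<Prod>l\<in>L. lin_form (a l)))"

section \<open>Tjurina numbers\<close>

text \<open>
  Power series in \<open>x,y\<close> are elements of \<open>\<complex>[[x]][[y]]\<close>: the coefficient of \<open>x\<^sup>i y\<^sup>j\<close> in \<open>F\<close> is
  \<open>fps_nth (fps_nth F j) i\<close>. The ring \<open>\<complex>{x,y}\<close> consists of those which converge absolutely in a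
  neighbourhood of the origin.
\<close>

definition fps2_convergent :: "complex fps fps \<Rightarrow> bool" where
  "fps2_convergent F \<longleftrightarrow>
     (\<exists>r>0. (\<lambda>(i,j). norm (fps_nth (fps_nth F j) i) * r ^ (i + j)) summable_on UNIV)"

definition conv_ring :: "complex fps fps ring" where
  "conv_ring = \<lparr>carrier = Collect fps2_convergent, monoid.mult = (*), one = 1, zero = 0, add = (+)\<rparr>"

definition fps2_const :: "complex \<Rightarrow> complex fps fps" where
  "fps2_const c = fps_const (fps_const c)"

definition fps2_x :: "complex fps fps" where "fps2_x = fps_const fps_X"
definition fps2_y :: "complex fps fps" where "fps2_y = fps_X"

definition fps2_dx :: "complex fps fps \<Rightarrow> complex fps fps" where
  "fps2_dx F = Abs_fps (\<lambda>j. fps_deriv (fps_nth F j))"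

definition fps2_dy :: "complex fps fps \<Rightarrow> complex fps fps" where
  "fps2_dy F = fps_deriv F"

definition tjurina_ideal :: "complex fps fps \<Rightarrow> complex fps fps set" where
  "tjurina_ideal g = genideal conv_ring {g, fps2_dx g, fps2_dy g}"

definition tjurina_algebra :: "complex fps fps \<Rightarrow> complex fps fps set ring" where
  "tjurina_algebra g = conv_ring Quot tjurina_ideal g"

text \<open>
  The dimension is taken over the image of \<open>\<complex>\<close> in the quotient ring. The value of
  \<^const>\<open>ring.dim\<close> is unspecified in the infinite-dimensional case, which does not occur for
  germs of reduced curves.
\<close>

definition tjurina_germ :: "complex fps fps \<Rightarrow> nat" where
  "tjurina_germ g =
     ring.dim (tjurina_algebra g)
       (range (\<lambda>c. tjurina_ideal g +>\<^bsub>conv_ring\<^esub> fps2_const c))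
       (carrier (tjurina_algebra g))"

text \<open>
  The germ at the origin of the equation of \<open>f = 0\<close> in the first of the standard affine charts
  \<open>z = 1\<close>, \<open>y = 1\<close>, \<open>x = 1\<close> containing the point with homogeneous coordinates \<open>v\<close>, after this
  point has been moved to the origin.
\<close>

definition local_equation :: "poly3 \<Rightarrow> complex^3 \<Rightarrow> complex fps fps" where
  "local_equation f v =
     (if v$3 \<noteq> 0 then
        eval3 fps2_const f (fps2_const (v$1 / v$3) + fps2_x) (fps2_const (v$2 / v$3) + fps2_y) 1
      else if v$2 \<noteq> 0 then
        eval3 fps2_const f (fps2_const (v$1 / v$2) + fps2_x) 1 (fps2_const (v$3 / v$2) + fps2_y)
      else
        eval3 fps2_const f 1 (fps2_const (v$2 / v$1) + fps2_x) (fps2_const (v$3 / v$1) + fps2_y))"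

text \<open>\<^const>\<open>local_equation\<close> is unchanged when \<open>v\<close> is rescaled, so the choice is immaterial.\<close>

definition tjurina_at :: "poly3 \<Rightarrow> proj_point \<Rightarrow> nat" where
  "tjurina_at f p = tjurina_germ (local_equation f (SOME v. v \<in> p \<and> v \<noteq> 0))"

definition sing_points :: "poly3 \<Rightarrow> proj_point set" where
  "sing_points f = {p \<in> proj_plane. \<forall>v\<in>p.
     vanishes_at f v \<and> vanishes_at (dx f) v \<and> vanishes_at (dy f) v \<and> vanishes_at (dz f) v}"

definition total_tjurina :: "poly3 \<Rightarrow> nat" where
  "total_tjurina f = (\<Sum>p\<in>sing_points f. tjurina_at f p)"

section \<open>Free arrangements\<close>

definition AR :: "poly3 \<Rightarrow> (poly3^3) set" where
  "AR f = {r. r$1 * dx f + r$2 * dy f + r$3 * dz f = 0}"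

lemma module_poly3_vec: "Modules.module ((*s) :: poly3 \<Rightarrow> poly3^3 \<Rightarrow> poly3^3)"
  by unfold_locales (simp_all add: vec_eq_iff algebra_simps)

text \<open>
  A graded module is free of rank 2 as a graded module if it has a basis of two homogeneous
  elements; \<open>S\<^sup>3\<close> carries the grading in which \<open>(a,b,c)\<close> has degree \<open>e\<close> if \<open>a,b,c\<close> are all
  homogeneous of degree \<open>e\<close>.
\<close>

definition AR_free_rank2 :: "poly3 \<Rightarrow> bool" where
  "AR_free_rank2 f \<longleftrightarrow>
     (\<exists>B. B \<subseteq> AR f \<and> card B = 2 \<and> (\<forall>b\<in>B. \<exists>e. \<forall>i. homogeneous3 e (b$i)) \<and>
          \<not> Modules.module.dependent (*s) B \<and> Modules.module.span (*s) B = AR f)"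

end

theory Submission
  imports Defs
begin

text \<open>Write \<open>m\<^sub>p\<close> for the number of lines of the arrangement through the point \<open>p\<close>, and let the
  homogeneous basis of the syzygies have degrees \<open>e\<^sub>1\<close> and \<open>e\<^sub>2\<close>. The bound comes from
  \<open>e\<^sub>1 + e\<^sub>2 = d - 1\<close> and \<open>\<tau> \<ge> (d - 1)\<^sup>2 - e\<^sub>1 e\<^sub>2\<close>, because a product of two numbers with sum
  \<open>d - 1\<close> is at most \<open>(d - 1)\<^sup>2 / 4\<close>. Two estimates, one global and one local, lead there.

  Globally, consider the vector fields \<open>\<theta>\<close> with homogeneous coefficients of degree \<open>k\<close> such that
  \<open>\<theta>\<close> is tangent to every line, that is, each linear form \<open>l\<close> divides \<open>\<theta> l\<close>. Tangency to one more
  line \<open>H\<close> is the vanishing of the restriction of \<open>\<theta> l\<^sub>H\<close> to \<open>H\<close>, a binary form of degree \<open>k\<close>; so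
  each line costs at most \<open>k + 1\<close> dimensions. Conversely, explicit fields tangent to the old lines,
  products of all but one of their linear forms times a constant vector, show that the cost is at
  least \<open>k + 1\<close> minus the sum of \<open>m\<^sub>p - 1\<close> over the points of \<open>H\<close> on old lines, where \<open>m\<^sub>p\<close> counts
  the old lines (\<open>restriction_rank\<close>). Adding the lines one at a time gives for large \<open>k\<close>, with
  \<open>S\<^sub>k\<close> the forms of degree \<open>k\<close>,
  \<open>3 dim S\<^sub>k - d (k + 1) \<le> dim \<le> 3 dim S\<^sub>k - d (k + 1) + (\<Sum>p. (m\<^sub>p - 1) choose 2)\<close>
  (\<open>logder_dim_bounds\<close>). On the other hand, subtracting multiples of the Euler field turns a
  tangent field into a syzygy of the partial derivatives, so for a free arrangement the dimension
  is \<open>dim S\<^sub>k\<^sub>-\<^sub>1 + dim S\<^sub>k\<^sub>-\<^sub>e\<^sub>1 + dim S\<^sub>k\<^sub>-\<^sub>e\<^sub>2\<close>. Comparing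
  these functions of \<open>k\<close>, the linear terms give \<open>e\<^sub>1 + e\<^sub>2 = d - 1\<close>, and the constant terms give
  \<open>((d - 1) choose 2) - e\<^sub>1 e\<^sub>2 \<le> (\<Sum>p. (m\<^sub>p - 1) choose 2)\<close> (\<open>free_defect_bound\<close>).

  Locally, the arrangement at \<open>p\<close> is \<open>u h = 0\<close> with a unit \<open>u\<close> and a product \<open>h\<close> of \<open>m\<^sub>p\<close> distinct
  linear forms, and \<open>h\<close> lies in the ideal of its derivatives by Euler's identity. Hence the Tjurina
  ideal is generated by two series of order \<open>m\<^sub>p - 1\<close>, and counting coefficients of degree less than
  \<open>2 m\<^sub>p - 2\<close> shows \<open>\<tau>\<^sub>p \<ge> (m\<^sub>p - 1)\<^sup>2\<close> (\<open>tjurina_germ_lines\<close>). Now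
  \<open>(m - 1)\<^sup>2 = (m choose 2) + ((m - 1) choose 2)\<close>, and the sum of \<open>m\<^sub>p choose 2\<close> is at least
  \<open>d choose 2\<close> since any two lines meet, so \<open>\<tau> \<ge> (d choose 2) + ((d - 1) choose 2) - e\<^sub>1 e\<^sub>2\<close>, which
  is \<open>(d - 1)\<^sup>2 - e\<^sub>1 e\<^sub>2\<close>.
\<close>

section \<open>Dimension counts in vector spaces\<close>

text \<open>The polynomial rings are infinite-dimensional vector spaces, in which the dimension of a subspace
  behaves well only if the subspace lies in the span of a finite set.\<close>

definition (in vector_space) fin_dim :: "'b set \<Rightarrow> bool" where
  "fin_dim V \<longleftrightarrow> (\<exists>B. finite B \<and> V \<subseteq> span B)"

context vector_space
begin

lemma fin_dimI: "finite B \<Longrightarrow> V \<subseteq> span B \<Longrightarrow> fin_dim V"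
  unfolding fin_dim_def by blast

lemma fin_dim_subset: "fin_dim W \<Longrightarrow> V \<subseteq> W \<Longrightarrow> fin_dim V"
  unfolding fin_dim_def by blast

lemma fin_dim_independent_finite:
  assumes "fin_dim V" "independent B" "B \<subseteq> V"
  shows "finite B"
  using assms independent_span_bound unfolding fin_dim_def by blast

lemma fin_dim_basis:
  assumes "fin_dim V" "subspace V"
  obtains B where "finite B" "independent B" "B \<subseteq> V" "span B = V" "card B = dim V"
proof -
  obtain B where B: "B \<subseteq> V" "independent B" "V \<subseteq> span B" "card B = dim V"
    using basis_exists[of V] by blast
  have "span B = V"
    using B span_minimal[OF B(1) assms(2)] by blast
  then show ?thesis
    using that[of B] B fin_dim_independent_finite[OF assms(1) B(2,1)] by blast
qed

lemma independent_card_le_dim_fin: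
  assumes "fin_dim V" "subspace V" "independent B" "B \<subseteq> V"
  shows "card B \<le> dim V"
proof -
  obtain C where C: "finite C" "span C = V" "card C = dim V"
    using fin_dim_basis[OF assms(1,2)] by metis
  then show ?thesis
    using independent_span_bound[of C B] assms by simp
qed

lemma dim_subset_fin:
  assumes "fin_dim W" "subspace W" "subspace V" "V \<subseteq> W"
  shows "dim V \<le> dim W"
proof -
  obtain B where "independent B" "B \<subseteq> V" "card B = dim V"
    using fin_dim_basis[OF fin_dim_subset[OF assms(1,4)] assms(3)] by metis
  then show ?thesis
    using independent_card_le_dim_fin[OF assms(1,2), of B] assms(4) by auto
qed

lemma subspace_eq_if_dim_eq:
  assumes "fin_dim W" "subspace W" "subspace V" "V \<subseteq> W" "dim W \<le> dim V"
  shows "V = W"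
proof (rule ccontr)
  assume "V \<noteq> W"
  then obtain x where x: "x \<in> W" "x \<notin> V"
    using assms(4) by blast
  obtain B where B: "finite B" "independent B" "B \<subseteq> V" "span B = V" "card B = dim V"
    using fin_dim_basis[OF fin_dim_subset[OF assms(1,4)] assms(3)] by metis
  have "independent (insert x B)" "x \<notin> B"
    using B x independent_insertI[of x B] by auto
  then show False
    using independent_card_le_dim_fin[OF assms(1,2), of "insert x B"] B x assms(4,5) by auto
qed

end

context vector_space_pair
begin

lemma fin_dim_image:
  assumes f: "Vector_Spaces.linear s1 s2 f" and "vs1.fin_dim V"
  shows "vs2.fin_dim (f ` V)"
proof -
  obtain B where "finite B" "V \<subseteq> vs1.span B"
    using assms(2) unfolding vs1.fin_dim_def by blast
  then show ?thesis
    using linear_span_image[OF f, of B] by (intro vs2.fin_dimI[of "f ` B"]) auto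
qed

text \<open>Extend a basis of the kernel to a basis of the subspace; the linear map sends the added vectors
  to a basis of the image.\<close>

lemma rank_nullity:
  assumes f: "Vector_Spaces.linear s1 s2 f" and V: "vs1.fin_dim V" "vs1.subspace V"
  shows "vs1.dim V = vs1.dim {v \<in> V. f v = 0} + vs2.dim (f ` V)"
proof -
  interpret f: Vector_Spaces.linear s1 s2 f by fact
  let ?K = "{v \<in> V. f v = 0}"
  have K: "vs1.subspace ?K"
    using V(2) by (auto simp: vs1.subspace_def f.add f.scale)
  obtain B where B: "finite B" "vs1.independent B" "B \<subseteq> ?K" "vs1.span B = ?K" "card B = vs1.dim ?K"
    using vs1.fin_dim_basis[OF vs1.fin_dim_subset[OF V(1)] K] by blast
  then obtain C where C: "B \<subseteq> C" "C \<subseteq> V" "vs1.independent C" "V \<subseteq> vs1.span C"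
    using vs1.maximal_independent_subset_extend[of B V] by blast
  have finC: "finite C"
    using vs1.fin_dim_independent_finite[OF V(1) C(3,2)] .
  have VC: "V = vs1.span C"
    using C V(2) vs1.span_minimal by blast
  have dimV: "vs1.dim V = card C"
    using vs1.dim_eq_card_independent[OF C(3)] VC vs1.dim_span by metis
  let ?R = "C - B"
  have spanR: "vs1.span ?R \<subseteq> V"
    unfolding VC by (rule vs1.span_mono) auto
  \<comment> \<open>The coordinates of a vector in \<open>span ?R \<inter> span B\<close> with respect to \<open>C\<close> all vanish.\<close>
  have disj: "x = 0" if x: "x \<in> vs1.span ?R" "f x = 0" for x
  proof -
    have xB: "x \<in> vs1.span B"
      using B(4) x spanR by auto
    have "vs1.representation C x = vs1.representation B x" "vs1.representation C x = vs1.representation ?R x"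
      using vs1.representation_extend[OF C(3) xB C(1)] vs1.representation_extend[OF C(3) x(1)] by auto
    then have "vs1.representation C x b = 0" for b
      using vs1.representation_ne_zero[of B x b] vs1.representation_ne_zero[of ?R x b] by auto
    moreover have "x \<in> vs1.span C"
      using x(1) spanR VC by blast
    ultimately show ?thesis
      using vs1.sum_nonzero_representation_eq[OF C(3)] by fastforce
  qed
  have inj: "inj_on f (vs1.span ?R)"
    using linear_inj_on_iff_eq_0[OF f vs1.subspace_span] disj by blast
  have indR: "vs1.independent ?R"
    using vs1.independent_mono[OF C(3)] by blast
  have indf: "vs2.independent (f ` ?R)"
    using linear_independent_injective_image[OF f indR inj] .
  have "f ` V = vs2.span (f ` C)"
    unfolding VC using linear_span_image[OF f] by metis
  also have "\<dots> = vs2.span (f ` ?R)"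
  proof (rule antisym)
    have "f ` C \<subseteq> vs2.span (f ` ?R)"
    proof
      fix y assume "y \<in> f ` C"
      then obtain c where c: "c \<in> C" "y = f c" by blast
      show "y \<in> vs2.span (f ` ?R)"
      proof (cases "c \<in> B")
        case True
        then have "y = 0" using B(3) c by blast
        then show ?thesis using vs2.span_zero by simp
      next
        case False
        then show ?thesis using c by (intro vs2.span_base) simp
      qed
    qed
    then show "vs2.span (f ` C) \<subseteq> vs2.span (f ` ?R)"
      by (rule vs2.span_minimal) (rule vs2.subspace_span)
    show "vs2.span (f ` ?R) \<subseteq> vs2.span (f ` C)"
      by (rule vs2.span_mono) auto
  qed
  finally have "vs2.dim (f ` V) = card (f ` ?R)"
    using vs2.dim_span_eq_card_independent[OF indf] by simp
  also have "\<dots> = card ?R"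
    by (rule card_image) (rule inj_on_subset[OF inj vs1.span_superset])
  also have "\<dots> = card C - card B"
    using B(1) C(1) by (simp add: card_Diff_subset)
  finally show ?thesis
    using dimV B(5) card_mono[OF finC C(1)] by simp
qed

corollary dim_injective_image:
  assumes f: "Vector_Spaces.linear s1 s2 f" and V: "vs1.fin_dim V" "vs1.subspace V"
    and inj: "\<And>v. v \<in> V \<Longrightarrow> f v = 0 \<Longrightarrow> v = 0"
  shows "vs2.dim (f ` V) = vs1.dim V"
proof -
  have "{v \<in> V. f v = 0} = vs1.span {}"
    using inj V(2) vs1.subspace_0 linear_0[OF f] by auto
  then have "vs1.dim {v \<in> V. f v = 0} = 0"
    using vs1.dim_span_eq_card_independent[OF vs1.independent_empty] by simp
  then show ?thesis
    using rank_nullity[OF f V] by simp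
qed

end

context vector_space
begin

lemma fin_dim_sums:
  assumes "fin_dim U" "fin_dim W"
  shows "fin_dim {u + w | u w. u \<in> U \<and> w \<in> W}"
proof -
  obtain B C where BC: "finite B" "U \<subseteq> span B" "finite C" "W \<subseteq> span C"
    using assms unfolding fin_dim_def by blast
  have "{u + w | u w. u \<in> U \<and> w \<in> W} \<subseteq> span (B \<union> C)"
    unfolding span_Un using BC by blast
  then show ?thesis
    using BC by (intro fin_dimI[of "B \<union> C"]) auto
qed

lemma dim_direct_sum:
  assumes U: "fin_dim U" "subspace U" and W: "fin_dim W" "subspace W" and UW: "U \<inter> W \<subseteq> {0}"
  shows "dim {u + w | u w. u \<in> U \<and> w \<in> W} = dim U + dim W"
proof -
  obtain B where B: "finite B" "independent B" "B \<subseteq> U" "span B = U" "card B = dim U"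
    using fin_dim_basis[OF U] .
  obtain C where C: "finite C" "independent C" "C \<subseteq> W" "span C = W" "card C = dim W"
    using fin_dim_basis[OF W] .
  have disj: "B \<inter> C = {}"
    using B C UW dependent_zero by blast
  have "independent (B \<union> C)"
  proof (rule independent_if_scalars_zero)
    fix g x assume s: "(\<Sum>x\<in>B \<union> C. scale (g x) x) = 0" and x: "x \<in> B \<union> C"
    let ?b = "\<Sum>x\<in>B. scale (g x) x" and ?c = "\<Sum>x\<in>C. scale (g x) x"
    have bc: "?b + ?c = 0"
      using s B(1) C(1) disj by (simp add: sum.union_disjoint)
    have "?b \<in> U" "?c \<in> W"
      using B C U(2) W(2) by (auto intro!: subspace_sum subspace_scale)
    moreover have "?b = - ?c" using bc by (simp add: eq_neg_iff_add_eq_0)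
    ultimately have "?b \<in> U \<inter> W" using W(2) subspace_neg by auto
    then have "?b = 0" "?c = 0" using UW bc by auto
    then show "g x = 0"
      using x independentD[OF B(2) B(1) subset_refl] independentD[OF C(2) C(1) subset_refl] by blast
  qed (use B C in auto)
  moreover have "span (B \<union> C) = {u + w | u w. u \<in> U \<and> w \<in> W}"
    unfolding span_Un using B(4) C(4) by simp
  ultimately show ?thesis
    using dim_span_eq_card_independent[of "B \<union> C"] card_Un_disjoint[OF B(1) C(1) disj] B(5) C(5) by simp
qed

end

section \<open>Polynomials in three variables\<close>

subsection \<open>Evaluation homomorphisms\<close>

text \<open>Ring homomorphisms as plain functions between type-class rings. All evaluations below are of
  this kind: at points, along parametrised lines, and into power series.\<close>

definition hom_ring :: "('a::comm_ring_1 \<Rightarrow> 'b::comm_ring_1) \<Rightarrow> bool" where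
  "hom_ring h \<longleftrightarrow> h 0 = 0 \<and> h 1 = 1 \<and> (\<forall>x y. h (x + y) = h x + h y) \<and> (\<forall>x y. h (x * y) = h x * h y)"

lemma hom_ringD:
  assumes "hom_ring h"
  shows "h 0 = 0" "h 1 = 1" "h (x + y) = h x + h y" "h (x * y) = h x * h y"
  using assms unfolding hom_ring_def by auto

lemma hom_ring_sum: "hom_ring h \<Longrightarrow> h (sum f A) = (\<Sum>x\<in>A. h (f x))"
  by (induction A rule: infinite_finite_induct) (auto simp: hom_ringD)

lemma hom_ring_prod: "hom_ring h \<Longrightarrow> h (prod f A) = (\<Prod>x\<in>A. h (f x))"
  by (induction A rule: infinite_finite_induct) (auto simp: hom_ringD)

lemma hom_ring_power: "hom_ring h \<Longrightarrow> h (x ^ n) = h x ^ n"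
  by (induction n) (auto simp: hom_ringD)

lemma hom_ring_uminus: "hom_ring h \<Longrightarrow> h (- x) = - h x"
  using hom_ringD(1)[of h] hom_ringD(3)[of h x "- x"] by (simp add: eq_neg_iff_add_eq_0 add.commute)

text \<open>\<open>eval3\<close> is a threefold iteration of this construction.\<close>

lemma hom_ring_poly_map:
  assumes h: "hom_ring h"
  shows "hom_ring (\<lambda>p. poly (map_poly h p) a)"
proof -
  note [simp] = hom_ringD[OF h]
  have "map_poly h (p + q) = map_poly h p + map_poly h q" for p q
    by (rule poly_eqI) (simp add: coeff_map_poly)
  moreover have "map_poly h (p * q) = map_poly h p * map_poly h q" for p q
    by (rule poly_eqI) (simp add: coeff_map_poly coeff_mult hom_ring_sum[OF h])
  ultimately show ?thesis
    unfolding hom_ring_def by simp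
qed

lemma hom_ring_eval3: "hom_ring h \<Longrightarrow> hom_ring (\<lambda>f. eval3 h f a b c)"
  unfolding eval3_def by (intro hom_ring_poly_map)

definition const3 :: "complex \<Rightarrow> poly3" where
  "const3 c = [:[:[:c:]:]:]"

definition mono3 :: "nat \<Rightarrow> nat \<Rightarrow> nat \<Rightarrow> poly3" where
  "mono3 i j k = monom (monom (monom 1 i) j) k"

lemma hom_ring_const3: "hom_ring const3"
  by (simp add: hom_ring_def const3_def one_pCons)

lemmas const3_simps = hom_ringD[OF hom_ring_const3]

lemma map_poly_pCons0: "h 0 = 0 \<Longrightarrow> map_poly h (pCons a p) = pCons (h a) (map_poly h p)"
  by (cases "a = 0 \<and> p = 0") (auto simp: map_poly_pCons)

lemma eval3_const3: "hom_ring h \<Longrightarrow> eval3 h (const3 e) a b c = h e"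
  by (simp add: eval3_def const3_def map_poly_pCons0 hom_ringD)

lemma eval3_lin_form: "hom_ring h \<Longrightarrow> eval3 h (lin_form v) a b c = h (v$1) * a + h (v$2) * b + h (v$3) * c"
  by (simp add: eval3_def lin_form_def map_poly_pCons0 hom_ringD algebra_simps)

lemma eval3_mono3: "hom_ring h \<Longrightarrow> eval3 h (mono3 i j k) a b c = a ^ i * b ^ j * c ^ k"
  by (simp add: eval3_def mono3_def map_poly_monom poly_monom hom_ringD algebra_simps)

subsection \<open>Coefficients and homogeneous components\<close>

lemma poly3_eqI: "(\<And>i j k. coeff3 p i j k = coeff3 q i j k) \<Longrightarrow> p = q"
  unfolding coeff3_def by (intro poly_eqI) auto

lemma coeff3_simps [simp]:
  "coeff3 0 i j k = 0"
  "coeff3 (p + q) i j k = coeff3 p i j k + coeff3 q i j k"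
  "coeff3 (p - q) i j k = coeff3 p i j k - coeff3 q i j k"
  "coeff3 (- p) i j k = - coeff3 p i j k"
  by (simp_all add: coeff3_def)

lemma coeff3_sum [simp]: "coeff3 (sum f A) i j k = (\<Sum>x\<in>A. coeff3 (f x) i j k)"
  by (induction A rule: infinite_finite_induct) auto

lemma coeff3_const3_mult [simp]: "coeff3 (const3 c * p) i j k = c * coeff3 p i j k"
  by (simp add: coeff3_def const3_def)

lemma coeff3_mono3: "coeff3 (mono3 i' j' k') i j k = (if i = i' \<and> j = j' \<and> k = k' then 1 else 0)"
  by (auto simp: coeff3_def mono3_def)

lemma coeff3_mult:
  "coeff3 (p * q) i j k = (\<Sum>k'\<le>k. \<Sum>j'\<le>j. \<Sum>i'\<le>i. coeff3 p i' j' k' * coeff3 q (i - i') (j - j') (k - k'))"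
  by (simp add: coeff3_def coeff_mult coeff_sum)

definition hpoly :: "nat \<Rightarrow> poly3 set" where
  "hpoly n = {p. homogeneous3 n p}"

lemma hpolyD: "p \<in> hpoly n \<Longrightarrow> coeff3 p i j k \<noteq> 0 \<Longrightarrow> i + j + k = n"
  by (auto simp: hpoly_def homogeneous3_def)

lemma hpolyI: "(\<And>i j k. coeff3 p i j k \<noteq> 0 \<Longrightarrow> i + j + k = n) \<Longrightarrow> p \<in> hpoly n"
  by (auto simp: hpoly_def homogeneous3_def)

lemma hpoly_iff: "p \<in> hpoly n \<longleftrightarrow> (\<forall>i j k. i + j + k \<noteq> n \<longrightarrow> coeff3 p i j k = 0)"
  by (auto simp: hpoly_def homogeneous3_def)

lemma hpoly_zero: "0 \<in> hpoly n"
  and hpoly_add: "p \<in> hpoly n \<Longrightarrow> q \<in> hpoly n \<Longrightarrow> p + q \<in> hpoly n"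
  and hpoly_diff: "p \<in> hpoly n \<Longrightarrow> q \<in> hpoly n \<Longrightarrow> p - q \<in> hpoly n"
  by (simp_all add: hpoly_iff)

lemma hpoly_mult:
  assumes "p \<in> hpoly m" "q \<in> hpoly n"
  shows "p * q \<in> hpoly (m + n)"
proof (rule hpolyI)
  fix i j k assume "coeff3 (p * q) i j k \<noteq> 0"
  then obtain i' j' k' where *: "i' \<le> i" "j' \<le> j" "k' \<le> k"
    "coeff3 p i' j' k' * coeff3 q (i - i') (j - j') (k - k') \<noteq> 0"
    unfolding coeff3_mult by (metis (no_types, lifting) sum.neutral atMost_iff)
  then have "i' + j' + k' = m" "(i - i') + (j - j') + (k - k') = n"
    using assms by (auto dest!: hpolyD)
  then show "i + j + k = m + n"
    using * by linarith
qed

lemma hpoly_const3: "const3 c \<in> hpoly 0"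
  by (rule hpolyI) (auto simp: coeff3_def const3_def coeff_pCons split: nat.splits)

lemma hpoly_scale: "p \<in> hpoly n \<Longrightarrow> const3 c * p \<in> hpoly n"
  using hpoly_mult[OF hpoly_const3] by fastforce

lemma hpoly_one: "1 \<in> hpoly 0"
  using hpoly_const3[of 1] by (simp add: const3_simps)

lemma hpoly_mono3: "i + j + k = n \<Longrightarrow> mono3 i j k \<in> hpoly n"
  by (rule hpolyI) (auto simp: coeff3_mono3 split: if_splits)

lemma lin_form_mono3:
  "lin_form a = const3 (a$1) * mono3 1 0 0 + const3 (a$2) * mono3 0 1 0 + const3 (a$3) * mono3 0 0 1"
  by (simp add: lin_form_def const3_def mono3_def monom_altdef)

lemma hpoly_lin_form: "lin_form a \<in> hpoly 1"
  unfolding lin_form_mono3 by (intro hpoly_add hpoly_scale hpoly_mono3) auto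

lemma hpoly_prod:
  assumes "\<And>x. x \<in> A \<Longrightarrow> f x \<in> hpoly 1"
  shows "prod f A \<in> hpoly (card A)"
  using assms
proof (induction A rule: infinite_finite_induct)
  case (insert x A)
  then show ?case
    using hpoly_mult[of "f x" 1 "prod f A" "card A"] by simp
qed (auto simp: hpoly_one)

lemma hpoly_power: "p \<in> hpoly 1 \<Longrightarrow> p ^ n \<in> hpoly n"
  using hpoly_prod[of "{..<n}" "\<lambda>_. p"] by simp

definition exps :: "nat \<Rightarrow> (nat \<times> nat \<times> nat) set" where
  "exps n = {(i, j, k). i + j + k = n}"

lemma exps_eq: "exps n = (\<lambda>(i, k). (i, n - i - k, k)) ` (SIGMA i:{..n}. {..n - i})"
  by (force simp: exps_def image_iff)

lemma finite_exps: "finite (exps n)"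
  unfolding exps_eq by simp

lemma sum_atMost_diff: "(\<Sum>i\<le>n. Suc (n - i)) * 2 = (n + 1) * (n + 2)" for n :: nat
proof -
  have "(\<Sum>i\<le>n. Suc (n - i)) = (\<Sum>i\<le>n. Suc i)"
    by (rule sum.reindex_bij_witness[of _ "\<lambda>i. n - i" "\<lambda>i. n - i"]) auto
  moreover have "(\<Sum>i\<le>n. Suc i) * 2 = (n + 1) * (n + 2)"
    by (induction n) auto
  ultimately show ?thesis by simp
qed

lemma card_exps: "card (exps n) * 2 = (n + 1) * (n + 2)"
proof -
  have "inj_on (\<lambda>(i, k). (i, n - i - k, k)) (SIGMA i:{..n}. {..n - i})"
    by (auto simp: inj_on_def)
  then have "card (exps n) = (\<Sum>i\<le>n. Suc (n - i))"
    unfolding exps_eq by (simp add: card_image)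
  then show ?thesis
    using sum_atMost_diff[of n] by simp
qed

definition homogeneous_component :: "nat \<Rightarrow> poly3 \<Rightarrow> poly3" where
  "homogeneous_component n p = (\<Sum>(i, j, k)\<in>exps n. const3 (coeff3 p i j k) * mono3 i j k)"

lemma coeff3_homogeneous_component: "coeff3 (homogeneous_component n p) i j k = (if i + j + k = n then coeff3 p i j k else 0)"
proof -
  have "coeff3 (homogeneous_component n p) i j k =
      (\<Sum>e\<in>exps n. if e = (i, j, k) then coeff3 p i j k else 0)"
    unfolding homogeneous_component_def coeff3_sum by (rule sum.cong) (auto simp: coeff3_mono3 split: if_splits)
  then show ?thesis
    using finite_exps[of n] by (simp add: exps_def)
qed

lemma homogeneous_component_hpoly: "homogeneous_component n p \<in> hpoly n"
  by (rule hpolyI) (auto simp: coeff3_homogeneous_component split: if_splits)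

lemma homogeneous_component_of_hpoly: "p \<in> hpoly m \<Longrightarrow> homogeneous_component n p = (if n = m then p else 0)"
  by (rule poly3_eqI) (auto simp: coeff3_homogeneous_component dest: hpolyD)

lemma homogeneous_component_add: "homogeneous_component n (p + q) = homogeneous_component n p + homogeneous_component n q"
  by (rule poly3_eqI) (simp add: coeff3_homogeneous_component)

lemma homogeneous_component_sum: "homogeneous_component n (sum f A) = (\<Sum>x\<in>A. homogeneous_component n (f x))"
  by (rule poly3_eqI) (simp add: coeff3_homogeneous_component)

lemma coeff3_finite: "\<exists>N. \<forall>i j k. coeff3 p i j k \<noteq> 0 \<longrightarrow> i + j + k \<le> N"
proof -
  define J where "J = Max ((\<lambda>k. degree (coeff p k)) ` {..degree p})"
  define I where "I = Max ((\<lambda>(k, j). degree (coeff (coeff p k) j)) ` ({..degree p} \<times> {..J}))"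
  have "i + j + k \<le> I + J + degree p" if "coeff3 p i j k \<noteq> 0" for i j k
  proof -
    have "coeff (coeff p k) j \<noteq> 0" "coeff p k \<noteq> 0" and i: "i \<le> degree (coeff (coeff p k) j)"
      using that le_degree by (auto simp: coeff3_def)
    then have k: "k \<le> degree p" and j: "j \<le> degree (coeff p k)"
      using le_degree by auto
    have "degree (coeff p k) \<le> J"
      unfolding J_def using k by (intro Max_ge) auto
    with j have j: "j \<le> J" by simp
    have "degree (coeff (coeff p k) j) \<le> I"
      unfolding I_def using k j by (intro Max_ge) force+
    then show ?thesis using i j k by simp
  qed
  then show ?thesis by blast
qed

lemma poly3_sum_homogeneous_component: "\<exists>N. p = (\<Sum>n\<le>N. homogeneous_component n p)"
proof -
  obtain N where N: "\<And>i j k. coeff3 p i j k \<noteq> 0 \<Longrightarrow> i + j + k \<le> N"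
    using coeff3_finite by blast
  have "p = (\<Sum>n\<le>N. homogeneous_component n p)"
    by (rule poly3_eqI) (auto simp: coeff3_homogeneous_component dest: N)
  then show ?thesis by blast
qed

text \<open>Both sides are additive in \<open>p\<close>, and for homogeneous \<open>p\<close> the product is homogeneous.\<close>

lemma homogeneous_component_mult:
  assumes "b \<in> hpoly e"
  shows "homogeneous_component n (p * b) = (if e \<le> n then homogeneous_component (n - e) p * b else 0)"
proof -
  obtain N where N: "p = (\<Sum>m\<le>N. homogeneous_component m p)"
    using poly3_sum_homogeneous_component by blast
  have "homogeneous_component n (p * b) = (\<Sum>m\<le>N. homogeneous_component n (homogeneous_component m p * b))"
    by (subst N) (simp add: sum_distrib_right homogeneous_component_sum)
  also have "\<dots> = (\<Sum>m\<le>N. if n = m + e then homogeneous_component m p * b else 0)"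
    using hpoly_mult[OF homogeneous_component_hpoly assms] by (intro sum.cong) (auto simp: homogeneous_component_of_hpoly)
  also have "\<dots> = (if e \<le> n then (\<Sum>m\<le>N. if m = n - e then homogeneous_component m p * b else 0) else 0)"
  proof (cases "e \<le> n")
    case True
    then have "n = m + e \<longleftrightarrow> m = n - e" for m by auto
    with True show ?thesis by simp
  next
    case False
    then show ?thesis by (auto intro: sum.neutral)
  qed
  also have "\<dots> = (if e \<le> n then homogeneous_component (n - e) p * b else 0)"
  proof -
    have "homogeneous_component (n - e) p = 0" if "\<not> n - e \<le> N"
    proof -
      have "homogeneous_component (n - e) p = (\<Sum>m\<le>N. homogeneous_component (n - e) (homogeneous_component m p))"
        by (subst N) (simp add: homogeneous_component_sum)
      also have "\<dots> = 0"
        using that by (intro sum.neutral) (auto simp: homogeneous_component_of_hpoly[OF homogeneous_component_hpoly])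
      finally show ?thesis .
    qed
    then show ?thesis by auto
  qed
  finally show ?thesis .
qed

subsection \<open>Homogeneous polynomials as vector spaces\<close>

text \<open>All spaces are complex vector spaces, with the scalars acting as constants: polynomials in three
  variables, vectors of three of them, and univariate polynomials.\<close>

interpretation P: vector_space "\<lambda>c p. const3 c * p"
  by unfold_locales (simp_all add: const3_simps algebra_simps)

interpretation V: vector_space "\<lambda>c (v :: poly3^3). const3 c *s v"
  by unfold_locales (simp_all add: const3_simps algebra_simps vec_eq_iff)

interpretation U: vector_space "smult :: complex \<Rightarrow> complex poly \<Rightarrow> complex poly"
  by unfold_locales (simp_all add: smult_add_right smult_add_left)

interpretation PU: vector_space_pair "\<lambda>c p. const3 c * p" "smult :: complex \<Rightarrow> complex poly \<Rightarrow> complex poly" ..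
interpretation VU: vector_space_pair "\<lambda>c (v :: poly3^3). const3 c *s v" "smult :: complex \<Rightarrow> complex poly \<Rightarrow> complex poly" ..
interpretation PP: vector_space_pair "\<lambda>c p. const3 c * p" "\<lambda>c p. const3 c * p" ..
interpretation PV: vector_space_pair "\<lambda>c p. const3 c * p" "\<lambda>c (v :: poly3^3). const3 c *s v" ..
interpretation UU: vector_space_pair "smult :: complex \<Rightarrow> complex poly \<Rightarrow> complex poly" "smult :: complex \<Rightarrow> complex poly \<Rightarrow> complex poly" ..

lemma hpoly_subspace: "P.subspace (hpoly n)"
  by (auto simp: P.subspace_def hpoly_zero hpoly_add hpoly_scale)

lemma hpoly_basis:
  fixes n :: nat
  defines "B \<equiv> (\<lambda>(i, j, k). mono3 i j k) ` exps n"
  shows "P.independent B" "P.span B = hpoly n" "card B = card (exps n)" "finite B"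
proof -
  have inj: "inj_on (\<lambda>(i, j, k). mono3 i j k) (exps n)"
  proof (rule inj_onI)
    fix e e' assume "(case e of (i, j, k) \<Rightarrow> mono3 i j k) = (case e' of (i, j, k) \<Rightarrow> mono3 i j k)"
    then show "e = e'"
      by (cases e; cases e'; simp) (metis coeff3_mono3 zero_neq_one)
  qed
  then show "card B = card (exps n)"
    unfolding B_def by (rule card_image)
  show fin: "finite B"
    unfolding B_def using finite_exps by simp
  show "P.independent B"
  proof (rule P.independent_if_scalars_zero[OF fin])
    fix g x assume s: "(\<Sum>x\<in>B. const3 (g x) * x) = 0" and "x \<in> B"
    then obtain i j k where x: "x = mono3 i j k" and e: "(i, j, k) \<in> exps n"
      unfolding B_def by auto
    have "0 = coeff3 (\<Sum>x\<in>B. const3 (g x) * x) i j k"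
      using s by simp
    also have "\<dots> = (\<Sum>e\<in>exps n. g (case e of (i, j, k) \<Rightarrow> mono3 i j k) *
        coeff3 (case e of (i, j, k) \<Rightarrow> mono3 i j k) i j k)"
      unfolding B_def by (subst sum.reindex[OF inj]) simp
    also have "\<dots> = (\<Sum>e\<in>exps n. if e = (i, j, k) then g x else 0)"
      by (rule sum.cong) (auto simp: coeff3_mono3 x split: if_splits)
    also have "\<dots> = g x"
      using finite_exps[of n] e by simp
    finally show "g x = 0" by simp
  qed
  show "P.span B = hpoly n"
  proof
    show "P.span B \<subseteq> hpoly n"
      by (rule P.span_minimal[OF _ hpoly_subspace]) (auto simp: B_def exps_def intro: hpoly_mono3)
    show "hpoly n \<subseteq> P.span B"
    proof
      fix p assume "p \<in> hpoly n"
      then have "p = homogeneous_component n p"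
        by (simp add: homogeneous_component_of_hpoly)
      also have "\<dots> \<in> P.span B"
        unfolding homogeneous_component_def
        by (intro P.span_sum) (auto simp: B_def intro!: P.span_scale[OF P.span_base] rev_image_eqI)
      finally show "p \<in> P.span B" .
    qed
  qed
qed

definition sdim :: "nat \<Rightarrow> nat" where
  "sdim n = card (exps n)"

lemma hpoly_fin_dim: "P.fin_dim (hpoly n)"
  using hpoly_basis(2,4)[of n] by (intro P.fin_dimI) auto

lemma hpoly_dim: "P.dim (hpoly n) = sdim n"
  using hpoly_basis[of n] P.dim_span_eq_card_independent unfolding sdim_def by metis

lemma sdim_double: "sdim n * 2 = (n + 1) * (n + 2)"
  unfolding sdim_def by (rule card_exps)

section \<open>Products of all but one linear form\<close>

text \<open>Lagrange interpolation for binary forms: if \<open>r\<close> linear forms in \<open>X\<close> and \<open>Y\<close> are pairwise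
  independent, then the products of \<open>r - 1\<close> of them span all forms of degree \<open>r - 1\<close>. To see this
  for a monomial \<open>N n\<close> with a variable \<open>n\<close>, write \<open>n\<close> as a combination of two of the given forms
  \<open>l\<^sub>0\<close> and \<open>l\<^sub>1\<close>; by induction \<open>N\<close> lies in the span for the forms other than \<open>l\<^sub>0\<close>, so \<open>N l\<^sub>0\<close> lies in
  the span for all of them, and likewise for \<open>l\<^sub>1\<close>. The lemma is used twice: with \<open>X = 1\<close> for univariate
  polynomials on a line, and for the two coordinates in the ring of power series.\<close>

lemma power_product_in_span_of_coproducts:
  fixes X Y :: "'a::comm_ring_1" and p q :: "'b \<Rightarrow> complex"
  assumes h: "hom_ring h"
    and R: "finite R" "\<And>b c. b \<in> R \<Longrightarrow> c \<in> R \<Longrightarrow> b \<noteq> c \<Longrightarrow> p b * q c \<noteq> p c * q b"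
    and ij: "card R = Suc (i + j)"
  shows "\<exists>z. X ^ i * Y ^ j = (\<Sum>b\<in>R. h (z b) * (\<Prod>c\<in>R - {b}. h (p c) * X + h (q c) * Y))"
  using R ij
proof (induction "i + j" arbitrary: R i j)
  case 0
  then obtain b where "R = {b}"
    by (metis card_1_singletonE One_nat_def)
  then show ?case
    using 0(1) by (intro exI[of _ "\<lambda>_. 1"]) (simp add: hom_ringD[OF h])
next
  case (Suc n)
  note hs = hom_ringD[OF h]
  let ?l = "\<lambda>c. h (p c) * X + h (q c) * Y"
  obtain b0 where b0: "b0 \<in> R"
    using Suc.prems(3) by fastforce
  have "card (R - {b0}) = Suc n"
    using b0 Suc.prems Suc.hyps(2) by simp
  then obtain b1 where b1: "b1 \<in> R" "b1 \<noteq> b0"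
    by (metis DiffE card.empty empty_iff insert_iff nat.distinct(1) subsetI subset_empty)
  \<comment> \<open>Split off one factor, which is a combination of the forms of \<open>b0\<close> and \<open>b1\<close>.\<close>
  define \<Delta> where "\<Delta> = p b0 * q b1 - p b1 * q b0"
  have \<Delta>: "\<Delta> \<noteq> 0"
    using Suc.prems(2)[OF b0 b1(1)] b1(2) by (auto simp: \<Delta>_def)
  have split: "\<exists>i' j' \<alpha> \<beta>. i' + j' = n \<and> X ^ i * Y ^ j = X ^ i' * Y ^ j' * (h \<alpha> * ?l b0 + h \<beta> * ?l b1)"
  proof (cases i)
    case (Suc i')
    have "h (q b1 / \<Delta>) * ?l b0 + h (- q b0 / \<Delta>) * ?l b1 =
        h (q b1 / \<Delta> * p b0 + (- q b0 / \<Delta>) * p b1) * X + h (q b1 / \<Delta> * q b0 + (- q b0 / \<Delta>) * q b1) * Y"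
      by (simp only: hs) (simp add: algebra_simps)
    also have "q b1 / \<Delta> * p b0 + (- q b0 / \<Delta>) * p b1 = (p b0 * q b1 - p b1 * q b0) / \<Delta>"
      by (simp add: diff_divide_distrib mult.commute)
    also have "q b1 / \<Delta> * q b0 + (- q b0 / \<Delta>) * q b1 = 0"
      by simp
    finally have "h (q b1 / \<Delta>) * ?l b0 + h (- q b0 / \<Delta>) * ?l b1 = X"
      using \<Delta> by (simp add: hs \<Delta>_def[symmetric])
    then show ?thesis
      using Suc \<open>Suc n = i + j\<close>
      by (intro exI[of _ i'] exI[of _ j] exI[of _ "q b1 / \<Delta>"] exI[of _ "- q b0 / \<Delta>"]) (simp add: mult_ac)
  next
    case 0
    then obtain j' where j: "j = Suc j'" "i = 0"
      using \<open>Suc n = i + j\<close> by (cases j) auto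
    have "h (- p b1 / \<Delta>) * ?l b0 + h (p b0 / \<Delta>) * ?l b1 =
        h (- p b1 / \<Delta> * p b0 + p b0 / \<Delta> * p b1) * X + h (- p b1 / \<Delta> * q b0 + p b0 / \<Delta> * q b1) * Y"
      by (simp only: hs) (simp add: algebra_simps)
    also have "- p b1 / \<Delta> * q b0 + p b0 / \<Delta> * q b1 = (p b0 * q b1 - p b1 * q b0) / \<Delta>"
      by (simp add: diff_divide_distrib mult.commute)
    also have "- p b1 / \<Delta> * p b0 + p b0 / \<Delta> * p b1 = 0"
      by simp
    finally have "h (- p b1 / \<Delta>) * ?l b0 + h (p b0 / \<Delta>) * ?l b1 = Y"
      using \<Delta> by (simp add: hs \<Delta>_def[symmetric])
    then show ?thesis
      using j \<open>Suc n = i + j\<close>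
      by (intro exI[of _ 0] exI[of _ j'] exI[of _ "- p b1 / \<Delta>"] exI[of _ "p b0 / \<Delta>"]) (simp add: mult_ac)
  qed
  then obtain i' j' \<alpha> \<beta> where n: "i' + j' = n"
    and XY: "X ^ i * Y ^ j = X ^ i' * Y ^ j' * (h \<alpha> * ?l b0 + h \<beta> * ?l b1)"
    by blast
  have times: "\<exists>z. X ^ i' * Y ^ j' * ?l b = (\<Sum>c\<in>R. h (z c) * (\<Prod>d\<in>R - {c}. ?l d))" if b: "b \<in> R" for b
  proof -
    have "\<exists>z. X ^ i' * Y ^ j' = (\<Sum>c\<in>R - {b}. h (z c) * (\<Prod>d\<in>R - {b} - {c}. ?l d))"
      using Suc.prems b n Suc.hyps(2) by (intro Suc.hyps(1)) auto
    then obtain z where z: "X ^ i' * Y ^ j' = (\<Sum>c\<in>R - {b}. h (z c) * (\<Prod>d\<in>R - {b} - {c}. ?l d))"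
      by blast
    have "X ^ i' * Y ^ j' * ?l b = (\<Sum>c\<in>R - {b}. h (z c) * (?l b * (\<Prod>d\<in>R - {b} - {c}. ?l d)))"
      unfolding z sum_distrib_right by (intro sum.cong) (auto simp: mult_ac)
    also have "\<dots> = (\<Sum>c\<in>R - {b}. h ((z(b := 0)) c) * (\<Prod>d\<in>R - {c}. ?l d))"
    proof (intro sum.cong refl)
      fix c assume c: "c \<in> R - {b}"
      have "(\<Prod>d\<in>R - {c}. ?l d) = ?l b * (\<Prod>d\<in>R - {c} - {b}. ?l d)"
        using c b Suc.prems(1) by (intro prod.remove) auto
      moreover have "R - {c} - {b} = R - {b} - {c}"
        by blast
      ultimately show "h (z c) * (?l b * (\<Prod>d\<in>R - {b} - {c}. ?l d)) =
          h ((z(b := 0)) c) * (\<Prod>d\<in>R - {c}. ?l d)"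
        using c by simp
    qed
    also have "\<dots> = (\<Sum>c\<in>R. h ((z(b := 0)) c) * (\<Prod>d\<in>R - {c}. ?l d))"
      using Suc.prems(1) b by (subst sum.remove[of R b]) (auto simp: hs)
    finally show ?thesis by blast
  qed
  obtain z0 where z0: "X ^ i' * Y ^ j' * ?l b0 = (\<Sum>c\<in>R. h (z0 c) * (\<Prod>d\<in>R - {c}. ?l d))"
    using times[OF b0] by blast
  obtain z1 where z1: "X ^ i' * Y ^ j' * ?l b1 = (\<Sum>c\<in>R. h (z1 c) * (\<Prod>d\<in>R - {c}. ?l d))"
    using times[OF b1(1)] by blast
  have "X ^ i * Y ^ j = h \<alpha> * (X ^ i' * Y ^ j' * ?l b0) + h \<beta> * (X ^ i' * Y ^ j' * ?l b1)"
    unfolding XY by (simp add: algebra_simps)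
  also have "\<dots> = (\<Sum>c\<in>R. h (\<alpha> * z0 c + \<beta> * z1 c) * (\<Prod>d\<in>R - {c}. ?l d))"
    unfolding z0 z1 sum_distrib_left sum.distrib[symmetric]
    by (intro sum.cong) (auto simp: hs algebra_simps)
  finally show ?case by (intro exI[of _ "\<lambda>c. \<alpha> * z0 c + \<beta> * z1 c"])
qed

section \<open>Restriction to a line\<close>

definition dot3 :: "complex^3 \<Rightarrow> complex^3 \<Rightarrow> complex" where
  "dot3 a v = a$1 * v$1 + a$2 * v$2 + a$3 * v$3"

lemma dot3_linear:
  "dot3 a (v + w) = dot3 a v + dot3 a w" "dot3 a (c *s v) = c * dot3 a v" "dot3 a 0 = 0"
  "dot3 (a + b) v = dot3 a v + dot3 b v" "dot3 (c *s a) v = c * dot3 a v" "dot3 (a - b) v = dot3 a v - dot3 b v"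
  by (simp_all add: dot3_def algebra_simps)

text \<open>The line with coefficient vector \<open>a\<close> is parametrised by \<open>u + t w\<close>, with \<open>w\<close> at infinity; the
  linear forms \<open>\<alpha>\<close> and \<open>\<beta>\<close> restrict to the homogeneous coordinates of this parametrisation.\<close>

definition line_frame :: "complex^3 \<Rightarrow> complex^3 \<Rightarrow> complex^3 \<Rightarrow> complex^3 \<Rightarrow> complex^3 \<Rightarrow> bool" where
  "line_frame a u w \<alpha> \<beta> \<longleftrightarrow> dot3 a u = 0 \<and> dot3 a w = 0 \<and>
     dot3 \<alpha> u = 1 \<and> dot3 \<alpha> w = 0 \<and> dot3 \<beta> u = 0 \<and> dot3 \<beta> w = 1"

lemma vec3_eqI: "(x :: 'a^3) $ 1 = y $ 1 \<Longrightarrow> x $ 2 = y $ 2 \<Longrightarrow> x $ 3 = y $ 3 \<Longrightarrow> x = y"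
  by (simp add: vec_eq_iff forall_3)

text \<open>Solve the equation of the line for a coordinate whose coefficient is nonzero; the other two
  coordinates are then free parameters.\<close>

lemma line_frame_exists:
  assumes "a \<noteq> 0"
  shows "\<exists>u w \<alpha> \<beta>. line_frame a u w \<alpha> \<beta> \<and>
    (\<forall>b. dot3 b u = 0 \<and> dot3 b w = 0 \<longrightarrow> (\<exists>c. b = c *s a))"
proof -
  consider "a$1 \<noteq> 0" | "a$2 \<noteq> 0" | "a$3 \<noteq> 0"
    using assms vec3_eqI[of a 0] by auto
  then show ?thesis
  proof cases
    case 1
    then have "line_frame a (vector [- a$2 / a$1, 1, 0]) (vector [- a$3 / a$1, 0, 1]) (vector [0, 1, 0]) (vector [0, 0, 1])"
      by (simp add: line_frame_def dot3_def)
    moreover have "b = (b$1 / a$1) *s a" if "dot3 b (vector [- a$2 / a$1, 1, 0]) = 0 \<and> dot3 b (vector [- a$3 / a$1, 0, 1]) = 0" for b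
      using that 1 by (intro vec3_eqI) (auto simp: dot3_def field_simps eq_neg_iff_add_eq_0)
    ultimately show ?thesis by blast
  next
    case 2
    then have "line_frame a (vector [1, - a$1 / a$2, 0]) (vector [0, - a$3 / a$2, 1]) (vector [1, 0, 0]) (vector [0, 0, 1])"
      by (simp add: line_frame_def dot3_def)
    moreover have "b = (b$2 / a$2) *s a" if "dot3 b (vector [1, - a$1 / a$2, 0]) = 0 \<and> dot3 b (vector [0, - a$3 / a$2, 1]) = 0" for b
      using that 2 by (intro vec3_eqI) (auto simp: dot3_def field_simps eq_neg_iff_add_eq_0)
    ultimately show ?thesis by blast
  next
    case 3
    then have "line_frame a (vector [1, 0, - a$1 / a$3]) (vector [0, 1, - a$2 / a$3]) (vector [1, 0, 0]) (vector [0, 1, 0])"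
      by (simp add: line_frame_def dot3_def)
    moreover have "b = (b$3 / a$3) *s a" if "dot3 b (vector [1, 0, - a$1 / a$3]) = 0 \<and> dot3 b (vector [0, 1, - a$2 / a$3]) = 0" for b
      using that 3 by (intro vec3_eqI) (auto simp: dot3_def field_simps eq_neg_iff_add_eq_0)
    ultimately show ?thesis by blast
  qed
qed

lemma vector_on_line_off_other:
  assumes "b \<noteq> 0" "\<And>c. a \<noteq> c *s b"
  shows "\<exists>v. dot3 b v = 0 \<and> dot3 a v = 1"
proof -
  obtain u w \<alpha> \<beta> where f: "line_frame b u w \<alpha> \<beta>"
    and "\<And>a. dot3 a u = 0 \<Longrightarrow> dot3 a w = 0 \<Longrightarrow> \<exists>c. a = c *s b"
    using line_frame_exists[OF assms(1)] by blast
  then have "dot3 a u \<noteq> 0 \<or> dot3 a w \<noteq> 0"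
    using assms(2) by blast
  then show ?thesis
  proof
    assume "dot3 a u \<noteq> 0"
    then show ?thesis
      using f by (intro exI[of _ "inverse (dot3 a u) *s u"]) (simp add: dot3_linear line_frame_def)
  next
    assume "dot3 a w \<noteq> 0"
    then show ?thesis
      using f by (intro exI[of _ "inverse (dot3 a w) *s w"]) (simp add: dot3_linear line_frame_def)
  qed
qed

text \<open>Replacing \<open>w\<close> by \<open>w + s u\<close> moves the point at infinity off any finite set of other lines, since each
  of them excludes at most one value of \<open>s\<close>.\<close>

lemma line_frame_generic:
  assumes "a \<noteq> 0" "finite A" "\<And>b c. b \<in> A \<Longrightarrow> b \<noteq> c *s a"
  shows "\<exists>u w \<alpha> \<beta>. line_frame a u w \<alpha> \<beta> \<and> (\<forall>b\<in>A. dot3 b w \<noteq> 0)"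
proof -
  obtain u w \<alpha> \<beta> where f: "line_frame a u w \<alpha> \<beta>"
    and pr: "\<And>b. dot3 b u = 0 \<Longrightarrow> dot3 b w = 0 \<Longrightarrow> \<exists>c. b = c *s a"
    using line_frame_exists[OF assms(1)] by blast
  have "finite ((\<lambda>b. - dot3 b w / dot3 b u) ` A)"
    using assms(2) by simp
  then obtain s where s: "s \<notin> (\<lambda>b. - dot3 b w / dot3 b u) ` A"
    using ex_new_if_finite[OF infinite_UNIV_char_0] by blast
  have "dot3 b (w + s *s u) \<noteq> 0" if b: "b \<in> A" for b
  proof (cases "dot3 b u = 0")
    case True
    then show ?thesis
      using pr[of b] assms(3)[OF b] by (auto simp: dot3_linear)
  next
    case False
    have "s \<noteq> - dot3 b w / dot3 b u"
      using s b by blast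
    then show ?thesis
      using False by (auto simp: dot3_linear field_simps eq_neg_iff_add_eq_0)
  qed
  moreover have "line_frame a u (w + s *s u) (\<alpha> - s *s \<beta>) \<beta>"
    using f by (simp add: line_frame_def dot3_linear)
  ultimately show ?thesis by blast
qed

text \<open>Restriction to the affine line \<open>u + t w\<close>. On forms of degree \<open>n\<close> this loses nothing compared with
  the restriction to the projective line, since a binary form of degree \<open>n\<close> is recovered from the
  univariate polynomial, of degree at most \<open>n\<close>, by homogenising.\<close>

definition restr :: "complex^3 \<Rightarrow> complex^3 \<Rightarrow> poly3 \<Rightarrow> complex poly" where
  "restr u w g = eval3 (\<lambda>c. [:c:]) g [:u$1, w$1:] [:u$2, w$2:] [:u$3, w$3:]"

lemma hom_ring_pCons: "hom_ring (\<lambda>c. [:c:])"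
  by (simp add: hom_ring_def one_pCons)

lemma hom_ring_restr: "hom_ring (restr u w)"
  using hom_ring_eval3[OF hom_ring_pCons] unfolding restr_def .

lemmas restr_simps = hom_ringD[OF hom_ring_restr]

lemma restr_const3: "restr u w (const3 c) = [:c:]"
  by (simp add: restr_def eval3_const3[OF hom_ring_pCons])

lemma restr_lin_form: "restr u w (lin_form a) = [:dot3 a u, dot3 a w:]"
  by (simp add: restr_def eval3_lin_form[OF hom_ring_pCons] dot3_def)

lemma restr_linear: "Vector_Spaces.linear (\<lambda>c p. const3 c * p) smult (restr u w)"
  by unfold_locales (simp_all add: restr_simps restr_const3)

definition upoly :: "nat \<Rightarrow> complex poly set" where
  "upoly n = {p. degree p \<le> n}"

lemma upoly_subspace: "U.subspace (upoly n)"
  by (auto simp: U.subspace_def upoly_def degree_add_le order_trans[OF degree_smult_le])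

lemma upoly_basis:
  "U.independent (monom (1::complex) ` {..n})" "U.span (monom 1 ` {..n}) = upoly n" "card (monom (1::complex) ` {..n}) = Suc n"
proof -
  have inj: "inj_on (monom (1::complex)) {..n}"
    by (rule inj_onI) (metis degree_monom_eq zero_neq_one)
  then show "card (monom (1::complex) ` {..n}) = Suc n"
    by (simp add: card_image)
  show "U.independent (monom (1::complex) ` {..n})"
  proof (rule U.independent_if_scalars_zero)
    fix g :: "complex poly \<Rightarrow> complex" and x
    assume s: "(\<Sum>x\<in>monom 1 ` {..n}. smult (g x) x) = 0" and "x \<in> monom (1::complex) ` {..n}"
    then obtain i where i: "i \<le> n" "x = monom 1 i" by auto
    have "0 = coeff (\<Sum>x\<in>monom 1 ` {..n}. smult (g x) x) i"
      using s by simp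
    also have "\<dots> = (\<Sum>j\<le>n. if j = i then g x else 0)"
      unfolding sum.reindex[OF inj] coeff_sum by (rule sum.cong) (auto simp: i)
    finally show "g x = 0"
      using i by simp
  qed simp
  show "U.span (monom 1 ` {..n}) = upoly n"
  proof
    show "U.span (monom 1 ` {..n}) \<subseteq> upoly n"
      by (rule U.span_minimal[OF _ upoly_subspace]) (auto simp: upoly_def degree_monom_eq)
    show "upoly n \<subseteq> U.span (monom 1 ` {..n})"
    proof
      fix p assume p: "p \<in> upoly n"
      have "p = (\<Sum>i\<le>n. smult (coeff p i) (monom 1 i))"
        using p poly_as_sum_of_monoms'[of p n] by (simp add: upoly_def smult_monom)
      also have "\<dots> \<in> U.span (monom 1 ` {..n})"
        by (intro U.span_sum U.span_scale[OF U.span_base]) auto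
      finally show "p \<in> U.span (monom 1 ` {..n})" .
    qed
  qed
qed

lemma upoly_fin_dim: "U.fin_dim (upoly n)"
  using upoly_basis(2)[of n] by (intro U.fin_dimI[of "monom 1 ` {..n}"]) auto

lemma upoly_dim: "U.dim (upoly n) = Suc n"
  using upoly_basis[of n] U.dim_span_eq_card_independent by metis

lemma restr_hpoly:
  assumes "g \<in> hpoly n"
  shows "restr u w g \<in> upoly n"
proof -
  have "restr u w g = restr u w (homogeneous_component n g)"
    using homogeneous_component_of_hpoly[OF assms, of n] by simp
  also have "\<dots> = (\<Sum>(i, j, k)\<in>exps n. restr u w (const3 (coeff3 g i j k) * mono3 i j k))"
    unfolding homogeneous_component_def hom_ring_sum[OF hom_ring_restr] by (simp add: case_prod_unfold)
  also have "\<dots> \<in> upoly n"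
  proof (rule U.subspace_sum[OF upoly_subspace])
    fix e assume "e \<in> exps n"
    then obtain i j k where e: "e = (i, j, k)" "i + j + k = n"
      by (auto simp: exps_def)
    have deg: "degree ([:x, y:] ^ m) \<le> m" for x y :: complex and m
      using degree_power_le[of "[:x, y:]" m] by (cases "y = 0") auto
    have "degree (restr u w (mono3 i j k)) \<le> i + j + k"
      unfolding restr_def eval3_mono3[OF hom_ring_pCons]
      by (intro order_trans[OF degree_mult_le] add_mono deg)
    then show "(case e of (i, j, k) \<Rightarrow> restr u w (const3 (coeff3 g i j k) * mono3 i j k)) \<in> upoly n"
      using e by (auto simp: restr_simps restr_const3 upoly_def intro: order_trans[OF degree_smult_le])
  qed
  finally show ?thesis .
qed

lemma restr_surj:
  assumes "line_frame a u w \<alpha> \<beta>"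
  shows "restr u w ` hpoly n = upoly n"
proof
  show "restr u w ` hpoly n \<subseteq> upoly n"
    using restr_hpoly by blast
  have "U.span (monom 1 ` {..n}) \<subseteq> restr u w ` hpoly n"
  proof (rule U.span_minimal)
    show "U.subspace (restr u w ` hpoly n)"
      by (rule PU.linear_subspace_image[OF restr_linear hpoly_subspace])
    show "monom 1 ` {..n} \<subseteq> restr u w ` hpoly n"
    proof
      fix x assume "x \<in> monom (1::complex) ` {..n}"
      then obtain i where i: "i \<le> n" "x = monom 1 i" by auto
      have "restr u w (lin_form \<alpha>) = 1" "restr u w (lin_form \<beta>) = [:0, 1:]"
        using assms by (simp_all add: restr_lin_form line_frame_def one_pCons)
      then have "restr u w (lin_form \<alpha> ^ (n - i) * lin_form \<beta> ^ i) = x"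
        by (simp add: restr_simps hom_ring_power[OF hom_ring_restr] i monom_altdef)
      moreover have "lin_form \<alpha> ^ (n - i) * lin_form \<beta> ^ i \<in> hpoly n"
        using hpoly_mult[OF hpoly_power[OF hpoly_lin_form, of \<alpha> "n - i"] hpoly_power[OF hpoly_lin_form, of \<beta> i]] i
        by simp
      ultimately show "x \<in> restr u w ` hpoly n" by blast
    qed
  qed
  then show "upoly n \<subseteq> restr u w ` hpoly n"
    using upoly_basis(2) by simp
qed

lemma lin_form_nonzero: "a \<noteq> 0 \<Longrightarrow> lin_form a \<noteq> 0"
  using vec3_eqI[of a 0] by (auto simp: lin_form_def)

lemma mult_linear: "Vector_Spaces.linear (\<lambda>c p. const3 c * p) (\<lambda>c p. const3 c * p) (\<lambda>q. r * q)"
  by unfold_locales (simp_all add: algebra_simps)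

lemma restr_kernel:
  "P.subspace {p \<in> hpoly n. restr u w p = 0}" "P.fin_dim {p \<in> hpoly n. restr u w p = 0}"
proof -
  show "P.subspace {p \<in> hpoly n. restr u w p = 0}"
    using hpoly_subspace[of n] by (simp add: P.subspace_def restr_simps)
  show "P.fin_dim {p \<in> hpoly n. restr u w p = 0}"
    by (rule P.fin_dim_subset[OF hpoly_fin_dim]) blast
qed

text \<open>The multiples of \<open>lin_form a\<close> lie in the kernel of the restriction, and for \<open>n \<ge> 1\<close> both spaces have
  the same dimension since \<open>sdim n = sdim (n - 1) + (n + 1)\<close>.\<close>

lemma restr_eq_zero_imp:
  assumes f: "line_frame a u w \<alpha> \<beta>" and a: "a \<noteq> 0" and g: "g \<in> hpoly n" and r: "restr u w g = 0"
  shows "\<exists>q\<in>hpoly (n - 1). g = lin_form a * q"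
proof (cases n)
  case 0
  have "P.dim (hpoly 0) = P.dim {p \<in> hpoly 0. restr u w p = 0} + U.dim (restr u w ` hpoly 0)"
    by (rule PU.rank_nullity[OF restr_linear hpoly_fin_dim hpoly_subspace])
  then have "P.dim {p \<in> hpoly 0. restr u w p = 0} = 0"
    using sdim_double[of 0] by (simp add: hpoly_dim restr_surj[OF f] upoly_dim)
  then have "{0} = {p \<in> hpoly 0. restr u w p = 0}"
    by (intro P.subspace_eq_if_dim_eq[OF restr_kernel(2,1) P.subspace_single_0])
       (simp_all add: hpoly_zero restr_simps)
  then have "g = 0"
    using g r 0 by auto
  then show ?thesis
    using hpoly_zero by (intro bexI[of _ 0]) auto
next
  case (Suc m)
  let ?K = "{p \<in> hpoly n. restr u w p = 0}" and ?M = "(\<lambda>q. lin_form a * q) ` hpoly m"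
  have "P.dim (hpoly n) = P.dim ?K + U.dim (restr u w ` hpoly n)"
    by (rule PU.rank_nullity[OF restr_linear hpoly_fin_dim hpoly_subspace])
  then have "sdim n = P.dim ?K + Suc n"
    by (simp add: hpoly_dim restr_surj[OF f] upoly_dim)
  moreover have "P.dim ?M = sdim m"
    using PP.dim_injective_image[OF mult_linear hpoly_fin_dim hpoly_subspace, of m "lin_form a"]
      lin_form_nonzero[OF a] by (simp add: hpoly_dim)
  moreover have "sdim n = sdim m + Suc n"
    using sdim_double[of n] sdim_double[of m] Suc by simp
  ultimately have "P.dim ?K \<le> P.dim ?M" by simp
  moreover have "?M \<subseteq> ?K"
    using hpoly_mult[OF hpoly_lin_form, of _ m a] f Suc
    by (auto simp: restr_simps restr_lin_form line_frame_def)
  moreover have "P.subspace ?M"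
    by (rule PP.linear_subspace_image[OF mult_linear hpoly_subspace])
  ultimately have "?M = ?K"
    using P.subspace_eq_if_dim_eq[OF restr_kernel(2,1)] by blast
  then show ?thesis
    using g r Suc by auto
qed

section \<open>Logarithmic vector fields\<close>

text \<open>A vector \<open>\<theta>\<close> of polynomials is regarded as the vector field \<open>\<theta>\<^sub>1 \<partial>\<^sub>x + \<theta>\<^sub>2 \<partial>\<^sub>y + \<theta>\<^sub>3 \<partial>\<^sub>z\<close>; this is its
  value on the linear form \<open>a\<close>.\<close>

definition on_form :: "poly3^3 \<Rightarrow> complex^3 \<Rightarrow> poly3" where
  "on_form \<theta> a = const3 (a$1) * \<theta>$1 + const3 (a$2) * \<theta>$2 + const3 (a$3) * \<theta>$3"

definition der :: "poly3^3 \<Rightarrow> poly3 \<Rightarrow> poly3" where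
  "der \<theta> f = \<theta>$1 * dx f + \<theta>$2 * dy f + \<theta>$3 * dz f"

definition euler_field :: "poly3^3" where
  "euler_field = vector [mono3 1 0 0, mono3 0 1 0, mono3 0 0 1]"

definition hvec :: "nat \<Rightarrow> (poly3^3) set" where
  "hvec n = {\<theta>. \<forall>i. \<theta>$i \<in> hpoly n}"

text \<open>The homogeneous vector fields tangent to all lines of \<open>A\<close>: the degree \<open>k\<close> part of Saito's module of
  logarithmic derivations.\<close>

definition logder :: "(complex^3) set \<Rightarrow> nat \<Rightarrow> (poly3^3) set" where
  "logder A k = {\<theta> \<in> hvec k. \<forall>a\<in>A. lin_form a dvd on_form \<theta> a}"

subsection \<open>Partial derivatives\<close>

lemma derivation_prod:
  fixes D :: "'a::comm_ring_1 \<Rightarrow> 'a"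
  assumes D: "\<And>F G. D (F * G) = D F * G + F * D G" and A: "finite A"
  shows "D (\<Prod>a\<in>A. f a) = (\<Sum>a\<in>A. D (f a) * (\<Prod>b\<in>A - {a}. f b))"
  using A
proof (induction A rule: finite_induct)
  case empty
  show ?case using D[of 1 1] by simp
next
  case (insert x A)
  have "(\<Sum>a\<in>A. D (f a) * (\<Prod>b\<in>insert x A - {a}. f b)) = f x * (\<Sum>a\<in>A. D (f a) * (\<Prod>b\<in>A - {a}. f b))"
    unfolding sum_distrib_left
  proof (rule sum.cong)
    fix a assume "a \<in> A"
    then have "insert x A - {a} = insert x (A - {a})"
      using insert by auto
    then show "D (f a) * (\<Prod>b\<in>insert x A - {a}. f b) = f x * (D (f a) * (\<Prod>b\<in>A - {a}. f b))"
      using insert by (simp add: mult_ac)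
  qed simp
  then show ?case
    using insert by (simp add: D)
qed

lemma map_poly_derivation:
  fixes D :: "'a::comm_ring_1 \<Rightarrow> 'a"
  assumes "\<And>x y. D (x + y) = D x + D y" "\<And>x y. D (x * y) = D x * y + x * D y"
  shows "map_poly D (p + q) = map_poly D p + map_poly D q"
    and "map_poly D (p * q) = map_poly D p * q + p * map_poly D q"
proof -
  have [simp]: "D 0 = 0"
    using assms(1)[of 0 0] by simp
  have D_sum: "D (sum f I) = (\<Sum>i\<in>I. D (f i))" for f :: "nat \<Rightarrow> 'a" and I
    by (induction I rule: infinite_finite_induct) (auto simp: assms)
  show "map_poly D (p + q) = map_poly D p + map_poly D q"
    by (rule poly_eqI) (simp add: coeff_map_poly assms)
  show "map_poly D (p * q) = map_poly D p * q + p * map_poly D q"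
    by (rule poly_eqI) (simp add: coeff_map_poly coeff_mult D_sum assms sum.distrib)
qed

lemma partial_derivations:
  "dx (p + q) = dx p + dx q" "dx (p * q) = dx p * q + p * dx q"
  "dy (p + q) = dy p + dy q" "dy (p * q) = dy p * q + p * dy q"
  "dz (p + q) = dz p + dz q" "dz (p * q) = dz p * q + p * dz q"
proof -
  have 0: "pderiv (r * s) = pderiv r * s + r * pderiv s" for r s :: "'b::idom poly"
    by (simp add: pderiv_mult algebra_simps)
  note 1 = map_poly_derivation[where D = pderiv, OF pderiv_add 0]
  show "dy (p + q) = dy p + dy q" "dy (p * q) = dy p * q + p * dy q"
    unfolding dy_def by (fact 1)+
  show "dx (p + q) = dx p + dx q" "dx (p * q) = dx p * q + p * dx q"
    unfolding dx_def by (rule map_poly_derivation; fact 1)+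
  show "dz (p + q) = dz p + dz q" "dz (p * q) = dz p * q + p * dz q"
    unfolding dz_def by (simp_all add: pderiv_add 0)
qed

lemma partials_lin_form:
  "dx (lin_form a) = const3 (a$1)" "dy (lin_form a) = const3 (a$2)" "dz (lin_form a) = const3 (a$3)"
  by (simp_all add: dx_def dy_def dz_def lin_form_def const3_def map_poly_pCons0 pderiv_pCons)

lemma der_derivation:
  "der \<theta> (p + q) = der \<theta> p + der \<theta> q" "der \<theta> (p * q) = der \<theta> p * q + p * der \<theta> q"
  by (simp_all add: der_def partial_derivations algebra_simps)

lemma der_lin_form: "der \<theta> (lin_form a) = on_form \<theta> a"
  by (simp add: der_def partials_lin_form on_form_def mult.commute)

lemma der_prod:
  assumes "finite A"
  shows "der \<theta> (\<Prod>a\<in>A. lin_form a) = (\<Sum>a\<in>A. on_form \<theta> a * (\<Prod>b\<in>A - {a}. lin_form b))"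
  by (simp add: derivation_prod[where D = "der \<theta>", OF der_derivation(2) assms] der_lin_form)

lemma AR_iff: "\<theta> \<in> AR f \<longleftrightarrow> der \<theta> f = 0"
  by (simp add: AR_def der_def)

lemma on_form_simps:
  "on_form (\<theta> + \<eta>) a = on_form \<theta> a + on_form \<eta> a" "on_form (\<theta> - \<eta>) a = on_form \<theta> a - on_form \<eta> a" "on_form (p *s \<theta>) a = p * on_form \<theta> a" "on_form 0 a = 0"
  by (simp_all add: on_form_def algebra_simps)

lemma der_simps:
  "der (\<theta> + \<eta>) f = der \<theta> f + der \<eta> f" "der (\<theta> - \<eta>) f = der \<theta> f - der \<eta> f" "der (p *s \<theta>) f = p * der \<theta> f"
  by (simp_all add: der_def algebra_simps)

lemma on_form_euler: "on_form euler_field a = lin_form a"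
  by (simp add: on_form_def euler_field_def lin_form_mono3)

lemma der_euler:
  assumes "finite A"
  shows "der euler_field (\<Prod>a\<in>A. lin_form a) = const3 (of_nat (card A)) * (\<Prod>a\<in>A. lin_form a)"
proof -
  have "der euler_field (\<Prod>a\<in>A. lin_form a) = (\<Sum>a\<in>A. (\<Prod>b\<in>A. lin_form b))"
    unfolding der_prod[OF assms] on_form_euler
    by (rule sum.cong) (auto simp: prod.remove[OF assms])
  moreover have "const3 (of_nat n) = of_nat n" for n
    by (induction n) (simp_all add: const3_simps)
  ultimately show ?thesis by simp
qed

lemma hvecI: "\<theta>$1 \<in> hpoly n \<Longrightarrow> \<theta>$2 \<in> hpoly n \<Longrightarrow> \<theta>$3 \<in> hpoly n \<Longrightarrow> \<theta> \<in> hvec n"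
  by (simp add: hvec_def forall_3)

lemma euler_field_hvec: "euler_field \<in> hvec 1"
  by (intro hvecI) (simp_all add: euler_field_def hpoly_mono3)

lemma hvec_scale: "p \<in> hpoly m \<Longrightarrow> \<theta> \<in> hvec n \<Longrightarrow> p *s \<theta> \<in> hvec (m + n)"
  by (simp add: hvec_def hpoly_mult)

lemma hvec_add: "\<theta> \<in> hvec n \<Longrightarrow> \<eta> \<in> hvec n \<Longrightarrow> \<theta> + \<eta> \<in> hvec n"
  and hvec_diff: "\<theta> \<in> hvec n \<Longrightarrow> \<eta> \<in> hvec n \<Longrightarrow> \<theta> - \<eta> \<in> hvec n"
  by (simp_all add: hvec_def hpoly_add hpoly_diff)

lemma hvec_subspace: "V.subspace (hvec n)"
  by (auto simp: V.subspace_def hvec_def hpoly_zero hpoly_add hpoly_scale)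

lemma on_form_hpoly: "\<theta> \<in> hvec n \<Longrightarrow> on_form \<theta> a \<in> hpoly n"
  unfolding on_form_def hvec_def by (intro hpoly_add hpoly_scale) auto

lemma logder_subspace: "V.subspace (logder A k)"
  using hvec_subspace[of k] by (auto simp: V.subspace_def logder_def on_form_simps intro: dvd_add dvd_mult)

subsection \<open>Spaces of multiples of fixed vectors\<close>

lemma scale_linear: "Vector_Spaces.linear (\<lambda>c p. const3 c * p) (\<lambda>c (v :: poly3^3). const3 c *s v) (\<lambda>p. p *s v)"
  by unfold_locales (simp_all add: vec_eq_iff algebra_simps)

lemma multiples:
  fixes v :: "poly3^3"
  shows "V.subspace ((\<lambda>p. p *s v) ` hpoly n)" "V.fin_dim ((\<lambda>p. p *s v) ` hpoly n)"
    and "v \<noteq> 0 \<Longrightarrow> V.dim ((\<lambda>p. p *s v) ` hpoly n) = sdim n"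
proof -
  show "V.subspace ((\<lambda>p. p *s v) ` hpoly n)"
    by (rule PV.linear_subspace_image[OF scale_linear hpoly_subspace])
  show "V.fin_dim ((\<lambda>p. p *s v) ` hpoly n)"
    by (rule PV.fin_dim_image[OF scale_linear hpoly_fin_dim])
  assume "v \<noteq> 0"
  then show "V.dim ((\<lambda>p. p *s v) ` hpoly n) = sdim n"
    using PV.dim_injective_image[OF scale_linear[of v] hpoly_fin_dim[of n] hpoly_subspace]
    by (auto simp: vec_eq_iff hpoly_dim)
qed

lemma dim_two_multiples:
  fixes v w :: "poly3^3"
  assumes "\<And>p q. p *s v + q *s w = 0 \<Longrightarrow> p = 0 \<and> q = 0"
  shows "V.dim {x + y | x y. x \<in> (\<lambda>p. p *s v) ` hpoly m \<and> y \<in> (\<lambda>p. p *s w) ` hpoly n} = sdim m + sdim n"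
proof -
  have "v \<noteq> 0" "w \<noteq> 0"
    using assms[of 1 0] assms[of 0 1] by auto
  moreover have "(\<lambda>p. p *s v) ` hpoly m \<inter> (\<lambda>p. p *s w) ` hpoly n \<subseteq> {0}"
  proof
    fix x assume "x \<in> (\<lambda>p. p *s v) ` hpoly m \<inter> (\<lambda>p. p *s w) ` hpoly n"
    then obtain p q where pq: "x = p *s v" "x = q *s w" by blast
    then have "p *s v + (- q) *s w = 0"
      by (metis add.right_inverse vector_sneg_minus1 vector_smult_assoc mult_minus1)
    then show "x \<in> {0}"
      using assms[of p "- q"] pq by auto
  qed
  ultimately show ?thesis
    using V.dim_direct_sum[OF multiples(2,1)[of v m] multiples(2,1)[of w n]] by (simp add: multiples(3))
qed

lemma hvec_fin_dim: "V.fin_dim (hvec n)" and hvec_dim: "V.dim (hvec n) = 3 * sdim n"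
proof -
  let ?M = "\<lambda>i. (\<lambda>p. p *s axis i (1 :: poly3)) ` hpoly n"
  let ?S = "{x + y | x y. x \<in> ?M 1 \<and> y \<in> ?M (2 :: 3)}"
  have S: "V.subspace ?S" "V.fin_dim ?S"
    by (intro V.subspace_sums V.fin_dim_sums multiples)+
  have dimS: "V.dim ?S = sdim n + sdim n"
    by (rule dim_two_multiples) (simp add: vec_eq_iff forall_3 axis_def)
  have eq: "hvec n = {x + y | x y. x \<in> ?S \<and> y \<in> ?M 3}"
  proof
    show "{x + y | x y. x \<in> ?S \<and> y \<in> ?M 3} \<subseteq> hvec n"
      by (auto intro!: hvecI simp: axis_def)
    show "hvec n \<subseteq> {x + y | x y. x \<in> ?S \<and> y \<in> ?M 3}"
    proof
      fix \<theta> assume \<theta>: "\<theta> \<in> hvec n"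
      have "\<theta> = (\<theta>$1 *s axis 1 1 + \<theta>$2 *s axis 2 1) + \<theta>$3 *s axis 3 1"
        by (rule vec3_eqI) (simp_all add: axis_def)
      then show "\<theta> \<in> {x + y | x y. x \<in> ?S \<and> y \<in> ?M 3}"
        using \<theta> unfolding hvec_def by blast
    qed
  qed
  have "?S \<inter> ?M 3 \<subseteq> {0}"
    by (auto simp: vec_eq_iff forall_3 axis_def)
  then show "V.dim (hvec n) = 3 * sdim n"
    unfolding eq using V.dim_direct_sum[OF S(2,1) multiples(2,1)[of "axis 3 1" n]] dimS multiples(3)[of "axis 3 1" n]
    by (simp add: axis_eq_0_iff)
  show "V.fin_dim (hvec n)"
    unfolding eq by (intro V.fin_dim_sums S multiples)
qed

lemma logder_fin_dim: "V.fin_dim (logder A k)"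
  by (rule V.fin_dim_subset[OF hvec_fin_dim[of k]]) (auto simp: logder_def)

section \<open>Adding a line\<close>

text \<open>Nonzero coefficient vectors that define pairwise distinct lines.\<close>

definition distinct_lines :: "(complex^3) set \<Rightarrow> bool" where
  "distinct_lines A \<longleftrightarrow> finite A \<and> 0 \<notin> A \<and> (\<forall>a\<in>A. \<forall>b\<in>A. a \<noteq> b \<longrightarrow> (\<forall>c. a \<noteq> c *s b))"

lemma distinct_lines_subset: "distinct_lines A \<Longrightarrow> B \<subseteq> A \<Longrightarrow> distinct_lines B"
  unfolding distinct_lines_def using finite_subset by blast

lemma lin_form_dvd_iff:
  assumes f: "line_frame a u w \<alpha> \<beta>" and "a \<noteq> 0" and "\<theta> \<in> hvec n"
  shows "lin_form a dvd on_form \<theta> a \<longleftrightarrow> restr u w (on_form \<theta> a) = 0"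
proof
  assume "lin_form a dvd on_form \<theta> a"
  then show "restr u w (on_form \<theta> a) = 0"
    using f by (auto simp: dvd_def restr_simps restr_lin_form line_frame_def)
next
  assume "restr u w (on_form \<theta> a) = 0"
  then show "lin_form a dvd on_form \<theta> a"
    using restr_eq_zero_imp[OF f assms(2) on_form_hpoly[OF assms(3)]] by (auto simp: dvd_def)
qed

lemma restr_on_form_linear: "Vector_Spaces.linear (\<lambda>c (v :: poly3^3). const3 c *s v) smult (\<lambda>\<theta>. restr u w (on_form \<theta> a))"
  by unfold_locales (simp_all add: on_form_simps restr_simps restr_const3)

text \<open>The condition for \<open>\<theta>\<close> to be tangent to the new line \<open>a\<close> as well is the vanishing of the
  restriction of \<open>\<theta> a\<close> to this line. For \<open>b \<in> A\<close>, the product of the other forms of \<open>A\<close> times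
  a constant vector along \<open>b\<close> is tangent to \<open>A\<close>. Choose a subset \<open>R\<close> of \<open>A\<close> that contains one
  line through each point in which \<open>A\<close> meets the line \<open>a\<close>. For \<open>b \<in> R\<close> the restrictions of these
  products share the factor \<open>Q\<close> given by the lines outside \<open>R\<close>, and by Lagrange interpolation the
  cofactors span all polynomials of degree less than the number of these points. So the restrictions contain \<open>Q\<close>
  times all polynomials up to the complementary degree.\<close>

lemma restriction_rank:
  assumes red: "distinct_lines (insert a A)" and a: "a \<notin> A"
    and f: "line_frame a u w \<alpha> \<beta>" and gen: "\<forall>b\<in>A. dot3 b w \<noteq> 0"
    and k: "card A \<le> k"
  shows "Suc k \<le> U.dim ((\<lambda>\<theta>. restr u w (on_form \<theta> a)) ` logder A k) +
      (card A - card ((\<lambda>b. - dot3 b u / dot3 b w) ` A))" (is "_ \<le> U.dim ?W + (_ - card (?\<tau> ` A))")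
proof -
  have finA: "finite A" and a0: "a \<noteq> 0"
    using red by (auto simp: distinct_lines_def)
  have W: "U.subspace ?W"
    by (rule VU.linear_subspace_image[OF restr_on_form_linear logder_subspace])
  have finW: "U.fin_dim ?W"
    by (rule VU.fin_dim_image[OF restr_on_form_linear logder_fin_dim])
  define l where "l c = [:dot3 c u, dot3 c w:]" for c
  \<comment> \<open>The fields \<open>g p v\<close> with a constant vector \<open>v\<close>: tangent to \<open>c\<close> if \<open>c\<close> divides \<open>p\<close> or contains \<open>v\<close>.\<close>
  have field: "restr u w g * restr u w p \<in> ?W"
    if "g \<in> hpoly m" "p \<in> hpoly (k - m)" "m \<le> k" and v: "dot3 a v = 1"
      and dv: "\<forall>c\<in>A. lin_form c dvd p \<or> dot3 c v = 0" for g p m v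
  proof -
    define \<theta> :: "poly3^3" where "\<theta> = (g * p) *s vector [const3 (v$1), const3 (v$2), const3 (v$3)]"
    have gp: "g * p \<in> hpoly k"
      using hpoly_mult[OF that(1,2)] that(3) by simp
    have on_form: "on_form \<theta> c = g * p * const3 (dot3 c v)" for c
      by (simp add: \<theta>_def on_form_def dot3_def const3_simps algebra_simps)
    have "\<theta> \<in> hvec k"
      unfolding \<theta>_def using hpoly_scale[OF gp] by (intro hvecI) (simp_all add: mult.commute[of "g * p"])
    moreover have "lin_form c dvd on_form \<theta> c" if "c \<in> A" for c
      using dv that unfolding on_form by (auto simp: const3_simps)
    ultimately have "\<theta> \<in> logder A k"
      by (auto simp: logder_def)
    moreover have "restr u w (on_form \<theta> a) = restr u w g * restr u w p"
      unfolding on_form by (simp add: v restr_simps const3_simps)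
    ultimately show ?thesis by (metis imageI)
  qed
  show ?thesis
  proof (cases "A = {}")
    case True
    obtain v where v: "dot3 a v = 1"
    proof -
      obtain i where i: "a$i \<noteq> 0"
        using a0 by (auto simp: vec_eq_iff)
      then have "dot3 a (axis i (inverse (a$i))) = 1"
        using exhaust_3[of i] by (auto simp: dot3_def axis_def)
      then show ?thesis using that by blast
    qed
    have "upoly k \<subseteq> ?W"
    proof
      fix p assume "p \<in> upoly k"
      then obtain g where "g \<in> hpoly k" "p = restr u w g"
        using restr_surj[OF f] by blast
      then show "p \<in> ?W"
        using field[of g k 1 v] v True hpoly_one by (simp add: restr_simps)
    qed
    then have "U.dim (upoly k) \<le> U.dim ?W"
      by (rule U.dim_subset_fin[OF finW W upoly_subspace])
    then show ?thesis
      unfolding upoly_dim by (rule trans_le_add1)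
  next
    case False
    have "\<exists>R\<subseteq>A. inj_on ?\<tau> R \<and> ?\<tau> ` A = ?\<tau> ` R"
      using subset_image_inj[of "?\<tau> ` A" ?\<tau> A] by blast
    then obtain R where R: "R \<subseteq> A" "inj_on ?\<tau> R" "?\<tau> ` A = ?\<tau> ` R"
      by blast
    have finR: "finite R"
      using R(1) finA finite_subset by blast
    have "R \<noteq> {}"
      using False R by auto
    define r where "r = card R - 1"
    define N where "N = card A - 1"
    have r: "card R = Suc r" and N: "card A = Suc N"
      unfolding r_def N_def using \<open>R \<noteq> {}\<close> False finR finA by (auto simp: card_gt_0_iff)
    have rN: "r \<le> N"
      using card_mono[OF finA R(1)] r N by simp
    have cardT: "card (?\<tau> ` A) = card R"
      using R by (simp add: card_image)
    define Q where "Q = (\<Prod>c\<in>A - R. l c)"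
    have Q0: "Q \<noteq> 0"
      using finA gen by (auto simp: Q_def l_def)
    define e where "e = k - (card A - card R)"
    have e: "e = r + (k - N)" "Suc k = Suc e + (card A - card R)"
      unfolding e_def using k r N rN by auto
    have minus_one: "(\<Prod>c\<in>A - {b}. l c) * monom 1 m \<in> ?W" if b: "b \<in> A" and m: "m \<le> k - N" for b m
    proof -
      have "monom 1 m \<in> upoly (k - N)"
        using m by (simp add: upoly_def degree_monom_eq)
      then obtain g where g: "g \<in> hpoly (k - N)" "monom 1 m = restr u w g"
        using restr_surj[OF f] by blast
      have "b \<noteq> 0" "\<And>c. a \<noteq> c *s b"
        using red b a by (auto simp: distinct_lines_def)
      then obtain v where v: "dot3 b v = 0" "dot3 a v = 1"
        using vector_on_line_off_other by blast
      have p: "(\<Prod>c\<in>A - {b}. lin_form c) \<in> hpoly N"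
        using hpoly_prod[of "A - {b}" lin_form] hpoly_lin_form b finA N by simp
      have "restr u w g * restr u w (\<Prod>c\<in>A - {b}. lin_form c) \<in> ?W"
        using g p v finA k N by (intro field[of g "k - N" _ v]) (auto intro!: dvd_prodI)
      then show ?thesis
        using g by (simp add: hom_ring_prod[OF hom_ring_restr] restr_lin_form l_def mult.commute)
    qed
    have "(\<lambda>p. Q * p) ` upoly e \<subseteq> ?W"
    proof -
      have "U.span (monom 1 ` {..e}) \<subseteq> {p. Q * p \<in> ?W}"
      proof (rule U.span_minimal)
        show "U.subspace {p. Q * p \<in> ?W}"
          using W by (auto simp: U.subspace_def distrib_left)
        show "monom 1 ` {..e} \<subseteq> {p. Q * p \<in> ?W}"
        proof
          fix x assume "x \<in> monom (1::complex) ` {..e}"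
          then obtain m where m: "m \<le> e" "x = monom 1 m" by auto
          define m1 where "m1 = min m r"
          define m2 where "m2 = m - m1"
          have m12: "m = m1 + m2" "m1 \<le> r" "m2 \<le> k - N"
            unfolding m1_def m2_def using m e by auto
          have indep: "dot3 b u * dot3 c w \<noteq> dot3 c u * dot3 b w" if "b \<in> R" "c \<in> R" "b \<noteq> c" for b c
          proof -
            have "?\<tau> b \<noteq> ?\<tau> c"
              using that inj_on_contraD[OF R(2)] by blast
            moreover have "dot3 b w \<noteq> 0" "dot3 c w \<noteq> 0"
              using that gen R(1) by auto
            ultimately show ?thesis
              by (auto simp: field_simps)
          qed
          have "card R = Suc ((r - m1) + m1)"
            using r m12 by simp
          from power_product_in_span_of_coproducts[OF hom_ring_pCons finR _ this,
              of "\<lambda>c. dot3 c u" "\<lambda>c. dot3 c w" 1 "[:0, 1:]"] indep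
          obtain z where "[:0, 1:] ^ m1 = (\<Sum>b\<in>R. [:z b:] * (\<Prod>c\<in>R - {b}. l c))"
            by (auto simp: l_def)
          then have "monom 1 m1 = (\<Sum>b\<in>R. [:z b:] * (\<Prod>c\<in>R - {b}. l c))"
            by (simp add: monom_altdef)
          then have "Q * x = (\<Sum>b\<in>R. [:z b:] * (Q * (\<Prod>c\<in>R - {b}. l c) * monom 1 m2))"
            using mult_monom[of "1::complex" m1 1 m2, symmetric] m m12
            by (simp add: sum_distrib_left sum_distrib_right mult_ac)
          also have "\<dots> = (\<Sum>b\<in>R. smult (z b) ((\<Prod>c\<in>A - {b}. l c) * monom 1 m2))"
          proof (rule sum.cong)
            fix b assume b: "b \<in> R"
            have "A - {b} = (A - R) \<union> (R - {b})"
              using b R(1) by blast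
            then have "(\<Prod>c\<in>A - {b}. l c) = Q * (\<Prod>c\<in>R - {b}. l c)"
              unfolding Q_def using finA finR by (simp only:) (rule prod.union_disjoint; auto)
            then show "[:z b:] * (Q * (\<Prod>c\<in>R - {b}. l c) * monom 1 m2) =
                smult (z b) ((\<Prod>c\<in>A - {b}. l c) * monom 1 m2)" by simp
          qed simp
          also have "\<dots> \<in> ?W"
            using R(1) m12 by (intro U.subspace_sum[OF W] U.subspace_scale[OF W] minus_one) auto
          finally show "x \<in> {p. Q * p \<in> ?W}" by simp
        qed
      qed
      then show ?thesis
        unfolding upoly_basis(2) by blast
    qed
    moreover have lin: "Vector_Spaces.linear smult smult (\<lambda>p. Q * p)"
      by unfold_locales (simp_all add: algebra_simps)
    moreover have "U.dim ((\<lambda>p. Q * p) ` upoly e) = Suc e"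
      using UU.dim_injective_image[OF lin upoly_fin_dim upoly_subspace, of e] Q0 upoly_dim by auto
    moreover have "U.subspace ((\<lambda>p. Q * p) ` upoly e)"
      by (rule UU.linear_subspace_image[OF lin upoly_subspace])
    ultimately have "Suc e \<le> U.dim ?W"
      using U.dim_subset_fin[OF finW W, of "(\<lambda>p. Q * p) ` upoly e"] by linarith
    then show ?thesis
      using e(2) cardT by simp
  qed
qed

definition mult_at :: "(complex^3) set \<Rightarrow> proj_point \<Rightarrow> nat" where
  "mult_at A p = card {a \<in> A. \<forall>v\<in>p. dot3 a v = 0}"

text \<open>\<open>P\<close> contains all points in which two lines of \<open>A\<close> meet. A fixed such \<open>P\<close> serves for all subsets
  of \<open>A\<close> as well, which allows for an induction over the lines.\<close>

definition covers :: "proj_point set \<Rightarrow> (complex^3) set \<Rightarrow> bool" where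
  "covers P A \<longleftrightarrow> finite P \<and>
     (\<forall>a\<in>A. \<forall>b\<in>A. \<forall>v. a \<noteq> b \<longrightarrow> v \<noteq> 0 \<longrightarrow> dot3 a v = 0 \<longrightarrow> dot3 b v = 0 \<longrightarrow> vec.span {v} \<in> P)"

text \<open>The truncated subtraction is harmless: points on no line contribute \<open>0 choose 2\<close>.\<close>

definition defect :: "proj_point set \<Rightarrow> (complex^3) set \<Rightarrow> nat" where
  "defect P A = (\<Sum>p\<in>P. (mult_at A p - 1) choose 2)"

lemma dot3_span: "(\<forall>v\<in>vec.span {v}. dot3 a v = 0) \<longleftrightarrow> dot3 a v = 0"
  by (auto simp: vec.span_singleton dot3_linear)

text \<open>Applied to the map from the lines of \<open>A\<close> to their points of intersection with a further line.\<close>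

lemma card_eq_sum_fibres:
  assumes "finite A"
  shows "card A - card (f ` A) = (\<Sum>t\<in>f ` A. card {a \<in> A. f a = t} - 1)"
proof -
  have "card A = (\<Sum>t\<in>f ` A. card {a \<in> A. f a = t})"
    using sum.group[OF assms, of "f ` A" f "\<lambda>_. 1::nat"] assms by simp
  also have "\<dots> = (\<Sum>t\<in>f ` A. (card {a \<in> A. f a = t} - 1) + 1)"
  proof (rule sum.cong)
    fix t assume "t \<in> f ` A"
    then have "card {a \<in> A. f a = t} > 0"
      using assms by (auto simp: card_gt_0_iff)
    then show "card {a \<in> A. f a = t} = (card {a \<in> A. f a = t} - 1) + 1" by simp
  qed simp
  finally show ?thesis
    by (simp add: sum_Suc)
qed

text \<open>If \<open>m \<ge> 1\<close> old lines pass through a point of the new line, its contribution grows from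
  \<open>(m - 1) choose 2\<close> to \<open>m choose 2\<close>, that is, by \<open>m - 1\<close>. Summing over the points of intersection
  on the new line gives the number of old lines minus the number of these points.\<close>

lemma defect_insert:
  assumes red: "distinct_lines (insert a A)" and a: "a \<notin> A" and P: "covers P (insert a A)"
    and f: "line_frame a u w \<alpha> \<beta>" and gen: "\<forall>b\<in>A. dot3 b w \<noteq> 0"
  shows "defect P A + (card A - card ((\<lambda>b. - dot3 b u / dot3 b w) ` A)) \<le> defect P (insert a A)"
proof -
  let ?\<tau> = "\<lambda>b. - dot3 b u / dot3 b w"
  have finA: "finite A" and finP: "finite P"
    using red P by (auto simp: distinct_lines_def covers_def)
  define on where "on p \<longleftrightarrow> (\<forall>v\<in>p. dot3 a v = 0)" for p
  define pt where "pt t = vec.span {u + t *s w}" for t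
  have mult_pt: "mult_at A (pt t) = card {b \<in> A. ?\<tau> b = t}" for t
  proof -
    have "dot3 b (u + t *s w) = 0 \<longleftrightarrow> ?\<tau> b = t" if "b \<in> A" for b
      using gen that by (auto simp: dot3_linear field_simps neg_eq_iff_add_eq_0)
    then show ?thesis
      unfolding mult_at_def pt_def dot3_span by (metis (mono_tags, lifting))
  qed
  have inj: "inj pt"
  proof (rule injI)
    fix s t assume "pt s = pt t"
    then have "u + s *s w \<in> vec.span {u + t *s w}"
      unfolding pt_def by (metis insertI1 vec.span_base)
    then obtain c where c: "u + s *s w = c *s (u + t *s w)"
      by (auto simp: vec.span_singleton)
    have "dot3 \<alpha> (u + s *s w) = c * dot3 \<alpha> (u + t *s w)" "dot3 \<beta> (u + s *s w) = c * dot3 \<beta> (u + t *s w)"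
      unfolding c by (simp_all add: dot3_linear algebra_simps)
    then show "s = t"
      using f by (simp add: dot3_linear line_frame_def)
  qed
  have ptP: "pt ` ?\<tau> ` A \<subseteq> {p \<in> P. on p}"
  proof
    fix p assume "p \<in> pt ` ?\<tau> ` A"
    then obtain b t where b: "b \<in> A" "p = pt t" and t: "t = ?\<tau> b" by blast
    let ?v = "u + t *s w"
    have "dot3 \<alpha> ?v = 1"
      using f by (simp add: dot3_linear line_frame_def)
    then have v0: "?v \<noteq> 0"
      using dot3_linear(3)[of \<alpha>] by (metis zero_neq_one)
    have va: "dot3 a ?v = 0"
      using f by (simp add: dot3_linear line_frame_def)
    have "dot3 b ?v = dot3 b u + t * dot3 b w"
      by (simp add: dot3_linear)
    also have "\<dots> = 0"
      using gen b(1) by (simp add: t)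
    finally have "vec.span {?v} \<in> P"
      using P b(1) a v0 va unfolding covers_def by (metis insertCI)
    then show "p \<in> {p \<in> P. on p}"
      using b va dot3_span[of ?v a] by (simp add: pt_def on_def)
  qed
  have "card A - card (?\<tau> ` A) = (\<Sum>t\<in>?\<tau> ` A. mult_at A (pt t) - 1)"
    using card_eq_sum_fibres[OF finA, of ?\<tau>] by (simp add: mult_pt)
  also have "\<dots> = (\<Sum>p\<in>pt ` ?\<tau> ` A. mult_at A p - 1)"
    by (subst sum.reindex) (use inj in \<open>auto simp: inj_on_def inj_def\<close>)
  also have "\<dots> \<le> (\<Sum>p\<in>{p \<in> P. on p}. mult_at A p - 1)"
    using ptP finP by (intro sum_mono2) auto
  also have "\<dots> = (\<Sum>p\<in>P. if on p then mult_at A p - 1 else 0)"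
    by (rule sum.inter_filter[OF finP])
  finally have "defect P A + (card A - card (?\<tau> ` A)) \<le>
      (\<Sum>p\<in>P. (mult_at A p - 1 choose 2) + (if on p then mult_at A p - 1 else 0))"
    unfolding defect_def by (simp add: sum.distrib)
  also have "\<dots> = defect P (insert a A)"
    unfolding defect_def
  proof (rule sum.cong)
    fix p
    have "mult_at (insert a A) p = mult_at A p + (if on p then 1 else 0)"
    proof -
      have "{b \<in> insert a A. \<forall>v\<in>p. dot3 b v = 0} =
          (if on p then insert a {b \<in> A. \<forall>v\<in>p. dot3 b v = 0} else {b \<in> A. \<forall>v\<in>p. dot3 b v = 0})"
        by (auto simp: on_def)
      then show ?thesis
        unfolding mult_at_def using finA a by simp
    qed
    then show "(mult_at A p - 1 choose 2) + (if on p then mult_at A p - 1 else 0) =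
        (mult_at (insert a A) p - 1 choose 2)"
      by (cases "mult_at A p") (auto simp: numeral_2_eq_2)
  qed simp
  finally show ?thesis .
qed

text \<open>Induction over the lines by rank-nullity; the restriction to the added line has rank at most
  \<open>k + 1\<close> since it takes values in the polynomials of degree at most \<open>k\<close>.\<close>

lemma logder_dim_bounds:
  assumes "distinct_lines A" "covers P A" "card A \<le> k"
  shows "3 * sdim k \<le> V.dim (logder A k) + card A * Suc k"
    and "V.dim (logder A k) + card A * Suc k \<le> 3 * sdim k + defect P A"
proof -
  have "finite A"
    using assms(1) by (simp add: distinct_lines_def)
  then have "3 * sdim k \<le> V.dim (logder A k) + card A * Suc k \<and>
      V.dim (logder A k) + card A * Suc k \<le> 3 * sdim k + defect P A"
    using assms
  proof (induction A rule: finite_induct)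
    case empty
    have "logder {} k = hvec k"
      by (simp add: logder_def)
    then show ?case
      by (simp add: hvec_dim)
  next
    case (insert a A)
    have redA: "distinct_lines A" and covA: "covers P A" and cardA: "card A \<le> k"
      using insert.prems insert.hyps distinct_lines_subset[of "insert a A" A] by (auto simp: covers_def)
    have a0: "a \<noteq> 0"
      using insert.prems(1) by (auto simp: distinct_lines_def)
    have "b \<noteq> c *s a" if "b \<in> A" for b c
      using insert.prems(1) insert.hyps(2) that unfolding distinct_lines_def by (metis insertCI)
    then obtain u w \<alpha> \<beta> where f: "line_frame a u w \<alpha> \<beta>" and gen: "\<forall>b\<in>A. dot3 b w \<noteq> 0"
      using line_frame_generic[OF a0 insert.hyps(1)] by blast
    let ?W = "(\<lambda>\<theta>. restr u w (on_form \<theta> a)) ` logder A k"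
    have "logder (insert a A) k = {\<theta> \<in> logder A k. restr u w (on_form \<theta> a) = 0}"
      using lin_form_dvd_iff[OF f a0] by (auto simp: logder_def)
    then have dim: "V.dim (logder A k) = V.dim (logder (insert a A) k) + U.dim ?W"
      using VU.rank_nullity[OF restr_on_form_linear logder_fin_dim logder_subspace] by simp
    have "?W \<subseteq> upoly k"
      using restr_hpoly on_form_hpoly by (auto simp: logder_def)
    then have "U.dim ?W \<le> Suc k"
      using U.dim_subset_fin[OF upoly_fin_dim upoly_subspace
          VU.linear_subspace_image[OF restr_on_form_linear logder_subspace]] upoly_dim by metis
    moreover have "Suc k + defect P A \<le> U.dim ?W + defect P (insert a A)"
      using restriction_rank[OF insert.prems(1) insert.hyps(2) f gen cardA]
        defect_insert[OF insert.prems(1) insert.hyps(2) insert.prems(2) f gen] by linarith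
    ultimately show ?case
      using insert.IH[OF redA covA cardA] dim insert.hyps by simp
  qed
  then show "3 * sdim k \<le> V.dim (logder A k) + card A * Suc k"
    and "V.dim (logder A k) + card A * Suc k \<le> 3 * sdim k + defect P A"
    by auto
qed

section \<open>Syzygies of the partial derivatives\<close>

text \<open>If \<open>\<theta> a = a q\<^sub>a\<close> for every line \<open>a\<close>, then \<open>\<theta> f = (\<Sum>a\<in>A. q\<^sub>a) f\<close>, and subtracting the multiple
  of the Euler field with the same effect on \<open>f\<close> leaves a syzygy. Conversely, for a syzygy \<open>v\<close> all but one of the summands
  of \<open>0 = v f\<close> vanish on the line \<open>a\<close>, and the remaining one is \<open>v a\<close> times forms that do not vanish
  identically there.\<close>

lemma logder_eq_sum:
  assumes red: "distinct_lines A" and d: "A \<noteq> {}" and k: "1 \<le> k" and f: "f = (\<Prod>a\<in>A. lin_form a)"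
  shows "logder A k = {v + w | v w. v \<in> AR f \<inter> hvec k \<and> w \<in> (\<lambda>p. p *s euler_field) ` hpoly (k - 1)}"
    (is "_ = ?S")
proof
  have finA: "finite A"
    using red by (simp add: distinct_lines_def)
  show "?S \<subseteq> logder A k"
  proof
    fix \<theta> assume "\<theta> \<in> ?S"
    then obtain v p where v: "v \<in> AR f" "v \<in> hvec k" and p: "p \<in> hpoly (k - 1)" and \<theta>: "\<theta> = v + p *s euler_field"
      by blast
    have "p *s euler_field \<in> hvec k"
      using hvec_scale[OF p euler_field_hvec] k by simp
    then have "\<theta> \<in> hvec k"
      unfolding \<theta> using v(2) hvec_add by blast
    moreover have "lin_form a dvd on_form \<theta> a" if a: "a \<in> A" for a
    proof -
      have a0: "a \<noteq> 0"
        using a red by (auto simp: distinct_lines_def)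
      have "b \<noteq> c *s a" if "b \<in> A - {a}" for b c
        using red a that unfolding distinct_lines_def by blast
      then obtain u w \<alpha> \<beta> where fr: "line_frame a u w \<alpha> \<beta>" and gen: "\<forall>b\<in>A - {a}. dot3 b w \<noteq> 0"
        using line_frame_generic[OF a0, of "A - {a}"] finA by blast
      have "0 = restr u w (\<Sum>b\<in>A. on_form v b * (\<Prod>c\<in>A - {b}. lin_form c))"
        using v(1) by (simp add: AR_iff f der_prod[OF finA] restr_simps)
      also have "\<dots> = (\<Sum>b\<in>A. restr u w (on_form v b) * (\<Prod>c\<in>A - {b}. restr u w (lin_form c)))"
        by (simp add: hom_ring_sum[OF hom_ring_restr] hom_ring_prod[OF hom_ring_restr] restr_simps)
      also have "\<dots> = restr u w (on_form v a) * (\<Prod>c\<in>A - {a}. restr u w (lin_form c)) +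
          (\<Sum>b\<in>A - {a}. restr u w (on_form v b) * (\<Prod>c\<in>A - {b}. restr u w (lin_form c)))"
        by (rule sum.remove[OF finA a])
      also have "(\<Sum>b\<in>A - {a}. restr u w (on_form v b) * (\<Prod>c\<in>A - {b}. restr u w (lin_form c))) = 0"
        using a finA fr by (intro sum.neutral) (auto simp: restr_lin_form line_frame_def prod_zero_iff intro!: bexI[of _ a])
      finally have "restr u w (on_form v a) = 0"
        using finA gen by (auto simp: restr_lin_form)
      then have "lin_form a dvd on_form v a"
        using lin_form_dvd_iff[OF fr a0 v(2)] by blast
      then show ?thesis
        by (simp add: \<theta> on_form_simps on_form_euler)
    qed
    ultimately show "\<theta> \<in> logder A k"
      by (simp add: logder_def)
  qed
  show "logder A k \<subseteq> ?S"
  proof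
    fix \<theta> assume \<theta>: "\<theta> \<in> logder A k"
    have "\<exists>q\<in>hpoly (k - 1). on_form \<theta> a = lin_form a * q" if a: "a \<in> A" for a
    proof -
      have a0: "a \<noteq> 0"
        using a red by (auto simp: distinct_lines_def)
      obtain u w \<alpha> \<beta> where fr: "line_frame a u w \<alpha> \<beta>"
        using line_frame_exists[OF a0] by blast
      have h: "\<theta> \<in> hvec k" and "lin_form a dvd on_form \<theta> a"
        using \<theta> a by (auto simp: logder_def)
      then show ?thesis
        using lin_form_dvd_iff[OF fr a0 h] restr_eq_zero_imp[OF fr a0 on_form_hpoly[OF h]] by blast
    qed
    then obtain q where q: "\<And>a. a \<in> A \<Longrightarrow> q a \<in> hpoly (k - 1)" "\<And>a. a \<in> A \<Longrightarrow> on_form \<theta> a = lin_form a * q a"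
      by metis
    let ?d = "of_nat (card A) :: complex"
    have d0: "?d \<noteq> 0"
      using d finA by simp
    define p where "p = const3 (inverse ?d) * (\<Sum>a\<in>A. q a)"
    have p: "p \<in> hpoly (k - 1)"
      unfolding p_def using q(1) by (intro hpoly_scale P.subspace_sum[OF hpoly_subspace])
    have "der \<theta> f = (\<Sum>a\<in>A. q a * f)"
      unfolding f der_prod[OF finA]
    proof (rule sum.cong)
      fix a assume a: "a \<in> A"
      then show "on_form \<theta> a * (\<Prod>b\<in>A - {a}. lin_form b) = q a * (\<Prod>b\<in>A. lin_form b)"
        using q(2)[OF a] by (simp add: prod.remove[OF finA a] mult_ac)
    qed simp
    moreover have "p * const3 ?d = (\<Sum>a\<in>A. q a)"
    proof -
      have "p * const3 ?d = const3 (inverse ?d * ?d) * (\<Sum>a\<in>A. q a)"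
        by (simp add: p_def const3_simps mult_ac)
      also have "inverse ?d * ?d = 1"
        using d0 by (rule left_inverse)
      finally show ?thesis
        by (simp add: const3_simps)
    qed
    ultimately have "der \<theta> f = p * const3 ?d * f"
      by (simp add: sum_distrib_right)
    then have "\<theta> - p *s euler_field \<in> AR f"
      by (simp add: AR_iff der_simps f der_euler[OF finA] mult_ac)
    moreover have "\<theta> - p *s euler_field \<in> hvec k"
      using hvec_diff[OF _ hvec_scale[OF p euler_field_hvec]] \<theta> k by (simp add: logder_def)
    moreover have "\<theta> = (\<theta> - p *s euler_field) + p *s euler_field" by simp
    ultimately show "\<theta> \<in> ?S"
      using p by blast
  qed
qed

lemma AR_hvec_subspace: "V.subspace (AR f \<inter> hvec k)"
  using hvec_subspace[of k] by (auto simp: V.subspace_def AR_iff der_simps) (simp add: der_def)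

lemma logder_dim_eq:
  assumes red: "distinct_lines A" and d: "A \<noteq> {}" and k: "1 \<le> k" and f: "f = (\<Prod>a\<in>A. lin_form a)"
  shows "V.dim (logder A k) = V.dim (AR f \<inter> hvec k) + sdim (k - 1)"
proof -
  have finA: "finite A"
    using red by (simp add: distinct_lines_def)
  have "lin_form a \<noteq> 0" if "a \<in> A" for a
    using red that lin_form_nonzero[of a] by (auto simp: distinct_lines_def)
  then have "f \<noteq> 0"
    using finA by (auto simp: f)
  have "(AR f \<inter> hvec k) \<inter> (\<lambda>p. p *s euler_field) ` hpoly (k - 1) \<subseteq> {0}"
  proof
    fix v assume "v \<in> (AR f \<inter> hvec k) \<inter> (\<lambda>p. p *s euler_field) ` hpoly (k - 1)"
    then obtain p where p: "v = p *s euler_field" "der v f = 0"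
      by (auto simp: AR_iff)
    then have "p * (const3 (of_nat (card A)) * f) = 0"
      by (simp add: der_simps f der_euler[OF finA])
    moreover have "const3 (of_nat (card A)) \<noteq> 0"
      using d finA by (simp add: const3_def)
    ultimately show "v \<in> {0}"
      using p(1) \<open>f \<noteq> 0\<close> by simp
  qed
  moreover have "V.fin_dim (AR f \<inter> hvec k)"
    by (rule V.fin_dim_subset[OF hvec_fin_dim]) blast
  moreover have "euler_field \<noteq> 0"
  proof
    assume "euler_field = 0"
    then have "coeff3 (euler_field $ 1) 1 0 0 = 0" by simp
    then show False by (simp add: euler_field_def coeff3_mono3)
  qed
  ultimately show ?thesis
    unfolding logder_eq_sum[OF assms]
    by (subst V.dim_direct_sum[OF _ AR_hvec_subspace multiples(2,1)]) (simp_all add: multiples(3))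
qed

lemma AR_free_dim:
  assumes "AR_free_rank2 f"
  shows "\<exists>e1 e2. \<forall>k\<ge>e1 + e2. V.dim (AR f \<inter> hvec k) = sdim (k - e1) + sdim (k - e2)"
proof -
  interpret M: Modules.module "(*s) :: poly3 \<Rightarrow> poly3^3 \<Rightarrow> poly3^3"
    by (rule module_poly3_vec)
  obtain B where B: "B \<subseteq> AR f" "card B = 2" "\<forall>b\<in>B. \<exists>e. \<forall>i. homogeneous3 e (b$i)"
    "\<not> M.dependent B" "M.span B = AR f"
    using assms unfolding AR_free_rank2_def by blast
  obtain b1 b2 where b: "B = {b1, b2}" "b1 \<noteq> b2"
    using B(2) by (auto simp: card_2_iff)
  obtain e1 e2 where e: "b1 \<in> hvec e1" "b2 \<in> hvec e2"
    using B(3) b by (auto simp: hvec_def hpoly_def)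
  have indep: "p = 0 \<and> q = 0" if "p *s b1 + q *s b2 = 0" for p q
  proof -
    define u where "u v = (if v = b1 then p else q)" for v
    have "(\<Sum>v\<in>B. u v *s v) = 0"
      using that b by (simp add: u_def)
    moreover have "finite B" "b1 \<in> B" "b2 \<in> B"
      using b by simp_all
    ultimately have "u b1 = 0" "u b2 = 0"
      using M.independentD[OF B(4) _ subset_refl] by blast+
    then show ?thesis
      using b(2) by (auto simp: u_def)
  qed
  have "V.dim (AR f \<inter> hvec k) = sdim (k - e1) + sdim (k - e2)" if k: "k \<ge> e1 + e2" for k
  proof -
    have "AR f \<inter> hvec k =
        {x + y | x y. x \<in> (\<lambda>p. p *s b1) ` hpoly (k - e1) \<and> y \<in> (\<lambda>p. p *s b2) ` hpoly (k - e2)}" (is "_ = ?S")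
    proof
      show "?S \<subseteq> AR f \<inter> hvec k"
      proof
        fix \<theta> assume "\<theta> \<in> ?S"
        then obtain p q where pq: "p \<in> hpoly (k - e1)" "q \<in> hpoly (k - e2)" "\<theta> = p *s b1 + q *s b2"
          by blast
        have "p *s b1 \<in> hvec k" "q *s b2 \<in> hvec k"
          using hvec_scale[OF pq(1) e(1)] hvec_scale[OF pq(2) e(2)] k by simp_all
        then show "\<theta> \<in> AR f \<inter> hvec k"
          using B(1) b unfolding pq(3) by (simp add: hvec_add AR_iff der_simps)
      qed
      show "AR f \<inter> hvec k \<subseteq> ?S"
      proof
        fix \<theta> assume \<theta>: "\<theta> \<in> AR f \<inter> hvec k"
        then have "\<theta> \<in> range (\<lambda>u. \<Sum>v\<in>B. u v *s v)"
          using B(5) M.span_finite[of B] b by auto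
        then obtain p q where pq: "\<theta> = p *s b1 + q *s b2"
          using b by auto
        \<comment> \<open>Only the components of the coefficients in the complementary degrees contribute.\<close>
        have "\<theta> = homogeneous_component (k - e1) p *s b1 + homogeneous_component (k - e2) q *s b2"
        proof (rule vec_eq_iff[THEN iffD2], rule allI)
          fix i
          have "\<theta>$i = homogeneous_component k (\<theta>$i)"
            using \<theta> homogeneous_component_of_hpoly[of "\<theta>$i" k k] by (simp add: hvec_def)
          also have "\<dots> = homogeneous_component k (p * b1$i) + homogeneous_component k (q * b2$i)"
            unfolding pq by (simp add: homogeneous_component_add)
          also have "\<dots> = homogeneous_component (k - e1) p * b1$i + homogeneous_component (k - e2) q * b2$i"
            using homogeneous_component_mult[of "b1$i" e1 k p] homogeneous_component_mult[of "b2$i" e2 k q] e k by (simp add: hvec_def)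
          finally show "\<theta>$i = (homogeneous_component (k - e1) p *s b1 + homogeneous_component (k - e2) q *s b2)$i"
            by simp
        qed
        then show "\<theta> \<in> ?S"
          using homogeneous_component_hpoly by blast
      qed
    qed
    then show ?thesis
      using dim_two_multiples[where m = "k - e1" and n = "k - e2", OF indep] by simp
  qed
  then show ?thesis by blast
qed

lemma affine_bounds:
  fixes s c \<Phi> :: int
  assumes "\<And>k. k \<ge> N \<Longrightarrow> 0 \<le> s * k + c \<and> s * k + c \<le> \<Phi>"
  shows "s = 0"
proof (rule ccontr)
  assume "s \<noteq> 0"
  define k where "k = max N (\<bar>c\<bar> + \<bar>\<Phi>\<bar> + 1)"
  have k: "k \<ge> N" "k > \<bar>c\<bar> + \<bar>\<Phi>\<bar>"
    by (auto simp: k_def)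
  have "\<bar>s * k\<bar> \<ge> 1 * k"
    unfolding abs_mult using \<open>s \<noteq> 0\<close> k by (intro mult_mono) auto
  then show False
    using assms[OF k(1)] k(2) by linarith
qed

text \<open>With \<open>n\<close> lines, twice the dimension of the space of tangent fields, minus twice the lower bound for it, is
  \<open>s k + c\<close> for large \<open>k\<close>. It lies between \<open>0\<close> and twice the defect, so \<open>s = 0\<close>, which means
  \<open>e1 + e2 = n - 1\<close>, and the estimate for \<open>c\<close> is the claim up to \<open>(e1 - e2)\<^sup>2 \<ge> 0\<close>.\<close>

lemma free_defect_bound:
  assumes red: "distinct_lines A" and d: "A \<noteq> {}" and P: "covers P A"
    and f: "f = (\<Prod>a\<in>A. lin_form a)" and free: "AR_free_rank2 f"
  shows "3 * (card A - 1)\<^sup>2 \<le> 4 * ((card A choose 2) + defect P A)"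
proof -
  obtain e1 e2 where dim: "\<And>k. k \<ge> e1 + e2 \<Longrightarrow> V.dim (AR f \<inter> hvec k) = sdim (k - e1) + sdim (k - e2)"
    using AR_free_dim[OF free] by blast
  define n where "n = card A"
  have n: "n \<ge> 1"
    using red d by (auto simp: n_def distinct_lines_def Suc_le_eq card_gt_0_iff)
  define s where "s = 2 * (int n - 1 - int e1 - int e2)"
  define c where "c = int e1 ^ 2 + int e2 ^ 2 - 3 * (int e1 + int e2) + 2 * int n - 2"
  have main: "0 \<le> s * int k + c \<and> s * int k + c \<le> 2 * int (defect P A)" if k: "k \<ge> e1 + e2 + n" for k
  proof -
    have D: "V.dim (logder A k) = sdim (k - e1) + sdim (k - e2) + sdim (k - 1)"
      using logder_dim_eq[OF red d _ f, of k] dim[of k] k n by simp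
    have "card A \<le> k"
      using k by (simp add: n_def)
    note bounds = logder_dim_bounds[OF red P this, unfolded D, folded n_def]
    have sd: "2 * int (sdim (k - e)) = (int k - int e + 1) * (int k - int e + 2)" if "e \<le> k" for e
    proof -
      define j where "j = k - e"
      then have j: "k = e + j"
        using that by simp
      have "int (sdim j * 2) = int ((j + 1) * (j + 2))"
        by (simp only: sdim_double)
      then show ?thesis
        by (simp add: j algebra_simps)
    qed
    let ?X = "\<lambda>e. (int k - int e + 1) * (int k - int e + 2)"
    have "?X e1 + ?X e2 + ?X 1 + 2 * (int n * (int k + 1)) - 3 * ?X 0 = s * int k + c"
      by (simp add: s_def c_def algebra_simps power2_eq_square)
    moreover have "int (3 * sdim k) \<le> int (sdim (k - e1) + sdim (k - e2) + sdim (k - 1) + n * Suc k)"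
      "int (sdim (k - e1) + sdim (k - e2) + sdim (k - 1) + n * Suc k) \<le> int (3 * sdim k + defect P A)"
      unfolding of_nat_le_iff by (fact bounds)+
    then have "3 * int (sdim k) \<le> int (sdim (k - e1)) + int (sdim (k - e2)) + int (sdim (k - 1)) + int n * (int k + 1)"
      "int (sdim (k - e1)) + int (sdim (k - e2)) + int (sdim (k - 1)) + int n * (int k + 1) \<le> 3 * int (sdim k) + int (defect P A)"
      by (simp_all only: of_nat_add of_nat_mult of_nat_Suc of_nat_numeral add.commute[of 1])
    moreover have "2 * int (sdim (k - e1)) = ?X e1" "2 * int (sdim (k - e2)) = ?X e2"
      "2 * int (sdim (k - 1)) = ?X 1" "2 * int (sdim k) = ?X 0"
      using sd[of e1] sd[of e2] sd[of 1] sd[of 0] k n by simp_all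
    ultimately show ?thesis
      by linarith
  qed
  have "s = 0"
  proof (rule affine_bounds)
    fix k :: int assume "k \<ge> int (e1 + e2 + n)"
    then show "0 \<le> s * k + c \<and> s * k + c \<le> 2 * int (defect P A)"
      using main[of "nat k"] by simp
  qed
  then have e: "int n = int e1 + int e2 + 1"
    by (simp add: s_def)
  have c: "c \<le> 2 * int (defect P A)"
    using main[of "e1 + e2 + n"] \<open>s = 0\<close> by simp
  have "2 * (n choose 2) = n * (n - 1)"
    unfolding choose_two by (intro dvd_mult_div_cancel) (cases n; simp)
  then have "2 * int (n choose 2) = int n * (int n - 1)"
    using n by (metis of_nat_mult of_nat_numeral of_nat_diff of_nat_1)
  then have id: "4 * c + 4 * (2 * int (n choose 2)) = 6 * (int n - 1)\<^sup>2 + 2 * (int e1 - int e2)\<^sup>2"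
    unfolding c_def e by (simp add: algebra_simps power2_eq_square)
  have "6 * x \<le> 8 * (b + \<phi>)" if "c \<le> 2 * \<phi>" "4 * c + 4 * (2 * b) = 6 * x + 2 * y" "0 \<le> y" for b \<phi> x y :: int
    using that by presburger
  from this[OF c id zero_le_power2]
  have "6 * (int n - 1)\<^sup>2 \<le> 8 * (int (n choose 2) + int (defect P A))" .
  then have "int (3 * (n - 1)\<^sup>2) \<le> int (4 * ((n choose 2) + defect P A))"
    using n by (simp add: of_nat_diff)
  then show ?thesis
    unfolding n_def by (simp only: of_nat_le_iff)
qed

section \<open>Convergent power series in two variables\<close>

text \<open>The coefficient of \<open>x\<^sup>i y\<^sup>j\<close>; the outer variable of the iterated power series ring is \<open>y\<close>.\<close>

definition coeff2 :: "complex fps fps \<Rightarrow> nat \<Rightarrow> nat \<Rightarrow> complex" where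
  "coeff2 F i j = fps_nth (fps_nth F j) i"

lemma fps2_eqI: "(\<And>i j. coeff2 F i j = coeff2 G i j) \<Longrightarrow> F = G"
  unfolding coeff2_def by (intro fps_ext) auto

lemma coeff2_simps [simp]:
  "coeff2 0 i j = 0" "coeff2 (F + G) i j = coeff2 F i j + coeff2 G i j" "coeff2 (F - G) i j = coeff2 F i j - coeff2 G i j"
  "coeff2 (- F) i j = - coeff2 F i j" "coeff2 (fps2_const c * F) i j = c * coeff2 F i j"
  "coeff2 (fps2_dx F) i j = of_nat (Suc i) * coeff2 F (Suc i) j"
  "coeff2 (fps2_dy F) i j = of_nat (Suc j) * coeff2 F i (Suc j)"
  by (simp_all add: coeff2_def fps2_const_def fps2_dx_def fps2_dy_def del: of_nat_Suc flip: fps_of_nat)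

lemma coeff2_xy_mult:
  "coeff2 (fps2_x * F) i j = (if i = 0 then 0 else coeff2 F (i - 1) j)"
  "coeff2 (fps2_y * F) i j = (if j = 0 then 0 else coeff2 F i (j - 1))"
  by (simp_all add: coeff2_def fps2_x_def fps2_y_def)

lemma coeff2_sum [simp]: "coeff2 (sum f A) i j = (\<Sum>x\<in>A. coeff2 (f x) i j)"
  by (simp add: coeff2_def fps_sum_nth)

lemma coeff2_mult: "coeff2 (F * G) i j = (\<Sum>b\<le>j. \<Sum>a\<le>i. coeff2 F a b * coeff2 G (i - a) (j - b))"
  by (simp add: coeff2_def fps_mult_nth fps_sum_nth atLeast0AtMost)

lemma hom_ring_fps2_const: "hom_ring fps2_const"
  by (simp add: hom_ring_def fps2_const_def)

lemmas fps2_const_simps = hom_ringD[OF hom_ring_fps2_const]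

lemma coeff2_const: "coeff2 (fps2_const c) i j = (if i = 0 \<and> j = 0 then c else 0)"
  by (auto simp: coeff2_def fps2_const_def)

lemma coeff2_one: "coeff2 1 i j = (if i = 0 \<and> j = 0 then 1 else 0)"
  using coeff2_const[of 1 i j] by (simp add: fps2_const_simps)

lemma summable_geometric2: "(\<lambda>(i, j). C * (1/2) ^ (i + j)) summable_on (UNIV :: (nat \<times> nat) set)"
  if "C \<ge> 0" for C :: real
proof (rule nonneg_bdd_above_summable_on)
  show "0 \<le> (case x of (i, j) \<Rightarrow> C * (1/2) ^ (i + j))" for x :: "nat \<times> nat"
    using that by (auto split: prod.splits)
  have geom: "(\<Sum>i\<le>n. (1/2::real) ^ i) \<le> 2" for n
    using geometric_sum[of "1/2::real" "Suc n"] by (simp add: lessThan_Suc_atMost)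
  show "bdd_above (sum (\<lambda>(i, j). C * (1/2) ^ (i + j)) ` {F :: (nat \<times> nat) set. F \<subseteq> UNIV \<and> finite F})"
  proof (rule bdd_aboveI2)
    fix F :: "(nat \<times> nat) set" assume "F \<in> {F. F \<subseteq> UNIV \<and> finite F}"
    then have F: "finite F" by simp
    define n where "n = Max (fst ` F \<union> snd ` F)"
    have "fst e \<le> n \<and> snd e \<le> n" if "e \<in> F" for e
      unfolding n_def using F that by (intro conjI Max_ge) auto
    then have "F \<subseteq> {..n} \<times> {..n}"
      by (auto simp: mem_Times_iff)
    then have "(\<Sum>(i, j)\<in>F. C * (1/2) ^ (i + j)) \<le> (\<Sum>(i, j)\<in>{..n} \<times> {..n}. C * (1/2) ^ (i + j))"
      using that by (intro sum_mono2) auto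
    also have "\<dots> = C * ((\<Sum>i\<le>n. (1/2) ^ i) * (\<Sum>j\<le>n. (1/2) ^ j))"
      by (simp add: sum.cartesian_product[symmetric] sum_product power_add sum_distrib_left mult_ac)
    also have "\<dots> \<le> C * (2 * 2)"
      using that geom[of n] by (intro mult_left_mono mult_mono) (auto intro: sum_nonneg)
    finally show "(\<Sum>(i, j)\<in>F. C * (1/2) ^ (i + j)) \<le> C * (2 * 2)" .
  qed
qed

text \<open>Cauchy's estimates. In this form convergence of products, derivatives and inverses is a matter of
  estimating single coefficients.\<close>

lemma fps2_convergent_iff:
  "fps2_convergent F \<longleftrightarrow> (\<exists>C R. C \<ge> 0 \<and> R \<ge> 1 \<and> (\<forall>i j. norm (coeff2 F i j) \<le> C * R ^ (i + j)))"
proof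
  assume "fps2_convergent F"
  then obtain r where r: "r > 0" "(\<lambda>(i, j). norm (coeff2 F i j) * r ^ (i + j)) summable_on UNIV"
    unfolding fps2_convergent_def coeff2_def by blast
  define C where "C = infsum (\<lambda>(i, j). norm (coeff2 F i j) * r ^ (i + j)) UNIV"
  have le: "norm (coeff2 F i j) * r ^ (i + j) \<le> C" for i j
    using finite_sum_le_infsum[OF r(2), of "{(i, j)}"] r(1) by (auto simp: C_def)
  have "C \<ge> 0"
    using order_trans[OF norm_ge_zero, of "coeff2 F 0 0" C] le[of 0 0] by simp
  moreover have "norm (coeff2 F i j) \<le> C * (max 1 (1 / r)) ^ (i + j)" for i j
  proof -
    have "norm (coeff2 F i j) \<le> C * (1 / r) ^ (i + j)"
      using le[of i j] r(1) by (simp add: power_divide field_simps)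
    also have "\<dots> \<le> C * (max 1 (1 / r)) ^ (i + j)"
      using \<open>C \<ge> 0\<close> r(1) by (intro mult_left_mono power_mono) auto
    finally show ?thesis .
  qed
  ultimately show "\<exists>C R. C \<ge> 0 \<and> R \<ge> 1 \<and> (\<forall>i j. norm (coeff2 F i j) \<le> C * R ^ (i + j))"
    by (intro exI[of _ C] exI[of _ "max 1 (1 / r)"]) auto
next
  assume "\<exists>C R. C \<ge> 0 \<and> R \<ge> 1 \<and> (\<forall>i j. norm (coeff2 F i j) \<le> C * R ^ (i + j))"
  then obtain C R :: real where CR: "C \<ge> 0" "R \<ge> 1" "\<And>i j. norm (coeff2 F i j) \<le> C * R ^ (i + j)"
    by blast
  have "(\<lambda>(i, j). norm (coeff2 F i j) * (1 / (2 * R)) ^ (i + j)) summable_on UNIV"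
  proof (rule summable_on_comparison_test[OF summable_geometric2[OF CR(1)]])
    fix x :: "nat \<times> nat"
    obtain i j where x: "x = (i, j)" by (cases x)
    have "norm (coeff2 F i j) * (1 / (2 * R)) ^ (i + j) \<le> C * R ^ (i + j) * (1 / (2 * R)) ^ (i + j)"
      using CR by (intro mult_right_mono) auto
    also have "\<dots> = C * (1/2) ^ (i + j)"
      using CR(2) by (simp add: power_divide power_mult_distrib field_simps)
    finally show "(case x of (i, j) \<Rightarrow> norm (coeff2 F i j) * (1 / (2 * R)) ^ (i + j)) \<le>
        (case x of (i, j) \<Rightarrow> C * (1/2) ^ (i + j))"
      by (simp add: x)
  qed (use CR in auto)
  then show "fps2_convergent F"
    unfolding fps2_convergent_def coeff2_def[symmetric] using CR(2) by (intro exI[of _ "1 / (2 * R)"]) auto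
qed

lemma convI: "0 \<le> C \<Longrightarrow> 1 \<le> R \<Longrightarrow> (\<And>i j. norm (coeff2 F i j) \<le> C * R ^ (i + j)) \<Longrightarrow> fps2_convergent F"
  unfolding fps2_convergent_iff by blast

lemma convE:
  assumes "fps2_convergent F"
  obtains C R where "0 \<le> C" "1 \<le> R" "\<And>i j. norm (coeff2 F i j) \<le> C * R ^ (i + j)"
  using assms unfolding fps2_convergent_iff by blast

lemma convE2:
  assumes "fps2_convergent F" "fps2_convergent G"
  obtains C D R where "0 \<le> C" "0 \<le> D" "1 \<le> R" "\<And>i j. norm (coeff2 F i j) \<le> C * R ^ (i + j)"
    "\<And>i j. norm (coeff2 G i j) \<le> D * R ^ (i + j)"
proof -
  obtain C R where F: "0 \<le> C" "1 \<le> R" "\<And>i j. norm (coeff2 F i j) \<le> C * R ^ (i + j)"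
    using convE[OF assms(1)] by blast
  obtain D S where G: "0 \<le> D" "1 \<le> S" "\<And>i j. norm (coeff2 G i j) \<le> D * S ^ (i + j)"
    using convE[OF assms(2)] by blast
  show ?thesis
  proof (rule that[of C D "max R S"])
    show "norm (coeff2 F i j) \<le> C * (max R S) ^ (i + j)" for i j
      using F by (intro order_trans[OF F(3)] mult_left_mono power_mono) auto
    show "norm (coeff2 G i j) \<le> D * (max R S) ^ (i + j)" for i j
      using G by (intro order_trans[OF G(3)] mult_left_mono power_mono) auto
  qed (use F G in auto)
qed

lemma Suc_le_power2: "real (Suc n) \<le> 2 ^ n"
  by (induction n) auto

lemma conv_add: "fps2_convergent F \<Longrightarrow> fps2_convergent G \<Longrightarrow> fps2_convergent (F + G)"
proof (erule (1) convE2)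
  fix C D R :: real
  assume *: "0 \<le> C" "0 \<le> D" "1 \<le> R" "\<And>i j. norm (coeff2 F i j) \<le> C * R ^ (i + j)"
    "\<And>i j. norm (coeff2 G i j) \<le> D * R ^ (i + j)"
  then show "fps2_convergent (F + G)"
    by (intro convI[of "C + D" R]) (auto simp: distrib_right intro!: norm_triangle_le add_mono)
qed

text \<open>A coefficient of the product has \<open>(i + 1) (j + 1) \<le> 2^(i + j)\<close> summands.\<close>

lemma conv_mult: "fps2_convergent F \<Longrightarrow> fps2_convergent G \<Longrightarrow> fps2_convergent (F * G)"
proof (erule (1) convE2)
  fix C D R :: real
  assume *: "0 \<le> C" "0 \<le> D" "1 \<le> R" "\<And>i j. norm (coeff2 F i j) \<le> C * R ^ (i + j)"
    "\<And>i j. norm (coeff2 G i j) \<le> D * R ^ (i + j)"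
  show "fps2_convergent (F * G)"
  proof (rule convI)
    fix i j
    have "norm (coeff2 F a b * coeff2 G (i - a) (j - b)) \<le> C * D * R ^ (i + j)" if "a \<le> i" "b \<le> j" for a b
    proof -
      have "norm (coeff2 F a b * coeff2 G (i - a) (j - b)) \<le> (C * R ^ (a + b)) * (D * R ^ ((i - a) + (j - b)))"
        unfolding norm_mult using * by (intro mult_mono) auto
      also have "\<dots> = C * D * R ^ ((a + b) + ((i - a) + (j - b)))"
        by (simp only: power_add mult_ac)
      also have "(a + b) + ((i - a) + (j - b)) = i + j"
        using that by simp
      finally show ?thesis .
    qed
    then have "norm (coeff2 (F * G) i j) \<le> (\<Sum>b\<le>j. \<Sum>a\<le>i. C * D * R ^ (i + j))"
      unfolding coeff2_mult by (intro sum_norm_le) auto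
    also have "\<dots> = (real (Suc j) * real (Suc i)) * (C * D * R ^ (i + j))"
      by (simp add: algebra_simps)
    also have "\<dots> \<le> (2 ^ j * 2 ^ i) * (C * D * R ^ (i + j))"
      using * Suc_le_power2 by (intro mult_right_mono mult_mono) auto
    also have "\<dots> = C * D * (2 * R) ^ (i + j)"
      by (simp add: power_add power_mult_distrib mult_ac)
    finally show "norm (coeff2 (F * G) i j) \<le> C * D * (2 * R) ^ (i + j)" .
  qed (use * in auto)
qed

lemma conv_const: "fps2_convergent (fps2_const c)"
  by (rule convI[of "norm c" 1]) (auto simp: coeff2_const)

lemma conv_x: "fps2_convergent fps2_x" and conv_y: "fps2_convergent fps2_y"
proof -
  have "coeff2 fps2_x i j = (if i = 1 \<and> j = 0 then 1 else 0)" "coeff2 fps2_y i j = (if i = 0 \<and> j = 1 then 1 else 0)" for i j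
    using coeff2_xy_mult[of "fps2_const 1" i j] by (auto simp: coeff2_one fps2_const_simps)
  then show "fps2_convergent fps2_x" "fps2_convergent fps2_y"
    by (auto intro!: convI[of 1 1])
qed

lemma conv_zero: "fps2_convergent 0" and conv_one: "fps2_convergent 1"
  using conv_const[of 0] conv_const[of 1] by (simp_all add: fps2_const_simps)

lemma conv_uminus: "fps2_convergent F \<Longrightarrow> fps2_convergent (- F)"
  using conv_mult[OF conv_const[of "-1"], of F] by (simp add: hom_ring_uminus[OF hom_ring_fps2_const] fps2_const_simps)

lemma conv_prod: "(\<And>x. x \<in> A \<Longrightarrow> fps2_convergent (f x)) \<Longrightarrow> fps2_convergent (prod f A)"
  by (induction A rule: infinite_finite_induct) (auto simp: conv_one conv_mult)

lemma conv_power: "fps2_convergent F \<Longrightarrow> fps2_convergent (F ^ n)"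
  by (induction n) (auto simp: conv_one conv_mult)

lemma conv_deriv:
  assumes "fps2_convergent F"
  shows "fps2_convergent (fps2_dx F)" "fps2_convergent (fps2_dy F)"
proof -
  obtain C R where F: "0 \<le> C" "1 \<le> R" "\<And>i j. norm (coeff2 F i j) \<le> C * R ^ (i + j)"
    using convE[OF assms] by blast
  have bound: "real (Suc a) * (C * R ^ Suc (i + j)) \<le> (C * R) * (2 * R) ^ (i + j)" if "a \<le> i + j" for a i j
  proof -
    have "real (Suc a) \<le> 2 ^ (i + j)"
      using Suc_le_power2[of a] power_increasing[OF that, of "2::real"] by linarith
    then have "real (Suc a) * (C * R ^ Suc (i + j)) \<le> 2 ^ (i + j) * (C * R ^ Suc (i + j))"
      using F by (intro mult_right_mono) auto
    then show ?thesis
      by (simp add: power_mult_distrib mult_ac)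
  qed
  show "fps2_convergent (fps2_dx F)"
  proof (rule convI[of "C * R" "2 * R"])
    fix i j
    have "norm (coeff2 (fps2_dx F) i j) \<le> real (Suc i) * (C * R ^ Suc (i + j))"
      using F(3)[of "Suc i" j] by (simp add: norm_mult del: of_nat_Suc power_Suc)
    then show "norm (coeff2 (fps2_dx F) i j) \<le> C * R * (2 * R) ^ (i + j)"
      using bound[of i i j] by simp
  qed (use F in auto)
  show "fps2_convergent (fps2_dy F)"
  proof (rule convI[of "C * R" "2 * R"])
    fix i j
    have "norm (coeff2 (fps2_dy F) i j) \<le> real (Suc j) * (C * R ^ Suc (i + j))"
      using F(3)[of i "Suc j"] by (simp add: norm_mult del: of_nat_Suc power_Suc)
    then show "norm (coeff2 (fps2_dy F) i j) \<le> C * R * (2 * R) ^ (i + j)"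
      using bound[of j i j] by simp
  qed (use F in auto)
qed

definition lin2 :: "complex \<Rightarrow> complex \<Rightarrow> complex \<Rightarrow> complex fps fps" where
  "lin2 c a b = fps2_const c + fps2_const a * fps2_x + fps2_const b * fps2_y"

lemma conv_lin2: "fps2_convergent (lin2 c a b)"
  unfolding lin2_def by (intro conv_add conv_mult conv_const conv_x conv_y)

text \<open>The inverse is the explicit geometric series in \<open>(a x + b y) / c\<close>.\<close>

lemma lin2_invertible:
  assumes "c \<noteq> 0"
  shows "\<exists>V. fps2_convergent V \<and> lin2 c a b * V = 1"
proof -
  define V where "V = Abs_fps (\<lambda>j. Abs_fps (\<lambda>i. (of_nat ((i + j) choose i) * (- a / c) ^ i * (- b / c) ^ j) / c))"
  have cfV: "coeff2 V i j = (of_nat ((i + j) choose i) * (- a / c) ^ i * (- b / c) ^ j) / c" for i j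
    by (simp add: V_def coeff2_def)
  have "fps2_convergent V"
  proof (rule convI)
    fix i j
    define M where "M = max 1 (max (norm (a / c)) (norm (b / c)))"
    have M: "norm (a / c) \<le> M" "norm (b / c) \<le> M" "1 \<le> M"
      by (auto simp: M_def)
    have "real ((i + j) choose i) \<le> 2 ^ (i + j)"
      using binomial_le_pow2[of "i + j" i] by (metis of_nat_le_iff of_nat_numeral of_nat_power)
    then have "norm (coeff2 V i j) \<le> (2 ^ (i + j) * M ^ i * M ^ j) / norm c"
      unfolding cfV norm_divide norm_mult norm_power norm_of_nat using M
      by (intro divide_right_mono mult_mono power_mono) (auto simp: norm_divide)
    then show "norm (coeff2 V i j) \<le> (1 / norm c) * (2 * M) ^ (i + j)"
      by (simp add: power_add power_mult_distrib mult_ac)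
  qed auto
  moreover have "lin2 c a b * V = 1"
  proof (rule fps2_eqI)
    fix i j
    have "coeff2 (lin2 c a b * V) i j = c * coeff2 V i j + a * (if i = 0 then 0 else coeff2 V (i - 1) j) +
        b * (if j = 0 then 0 else coeff2 V i (j - 1))"
      by (simp add: lin2_def distrib_right coeff2_xy_mult mult.assoc)
    also have "\<dots> = (if i = 0 \<and> j = 0 then 1 else 0)"
    proof (cases i; cases j)
      fix i' j' assume ij: "i = Suc i'" "j = Suc j'"
      define n where "n = i' + j'"
      have ch: "(i + j) choose i = (Suc n choose i') + (Suc n choose Suc i')"
        by (simp add: ij n_def)
      define T where "T = (- a / c) ^ i * (- b / c) ^ j"
      have V: "c * coeff2 V i j = of_nat ((i + j) choose i) * T"
        "a * coeff2 V i' j = - of_nat (Suc n choose i') * T"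
        "b * coeff2 V i j' = - of_nat (Suc n choose Suc i') * T"
        using assms by (simp_all add: cfV ij n_def T_def del: binomial_Suc_Suc)
      have "c * coeff2 V i j + a * coeff2 V i' j + b * coeff2 V i j' = 0"
        by (simp add: V ch algebra_simps)
      then show ?thesis
        by (simp add: ij)
    qed (use assms in \<open>auto simp: cfV\<close>)
    also have "\<dots> = coeff2 1 i j"
      using coeff2_const[of 1 i j] by (simp add: fps2_const_simps)
    finally show "coeff2 (lin2 c a b * V) i j = coeff2 1 i j" .
  qed
  ultimately show ?thesis by blast
qed

lemma carrier_conv: "carrier conv_ring = Collect fps2_convergent"
  and ops_conv: "F \<otimes>\<^bsub>conv_ring\<^esub> G = F * G" "F \<oplus>\<^bsub>conv_ring\<^esub> G = F + G" "\<one>\<^bsub>conv_ring\<^esub> = 1" "\<zero>\<^bsub>conv_ring\<^esub> = 0"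
  by (simp_all add: conv_ring_def)

lemma cring_conv_ring: "cring conv_ring"
proof (intro cringI abelian_groupI comm_monoidI)
  fix F assume "F \<in> carrier conv_ring"
  then show "\<exists>y\<in>carrier conv_ring. y \<oplus>\<^bsub>conv_ring\<^esub> F = \<zero>\<^bsub>conv_ring\<^esub>"
    by (intro bexI[of _ "- F"]) (auto simp: carrier_conv ops_conv conv_uminus)
qed (auto simp: carrier_conv ops_conv conv_add conv_mult conv_zero conv_one algebra_simps)

lemma conv_ideal:
  assumes "ideal I conv_ring"
  shows "F \<in> I \<Longrightarrow> fps2_convergent F" "0 \<in> I" "F \<in> I \<Longrightarrow> G \<in> I \<Longrightarrow> F + G \<in> I"
    and "F \<in> I \<Longrightarrow> fps2_convergent G \<Longrightarrow> G * F \<in> I"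
proof -
  interpret ideal I conv_ring by fact
  show "F \<in> I \<Longrightarrow> fps2_convergent F" using a_Hcarr by (auto simp: carrier_conv)
  show "0 \<in> I" using additive_subgroup.zero_closed[OF additive_subgroup_axioms] by (simp add: ops_conv)
  show "F \<in> I \<Longrightarrow> G \<in> I \<Longrightarrow> F + G \<in> I" using additive_subgroup.a_closed[OF additive_subgroup_axioms] by (simp add: ops_conv)
  show "F \<in> I \<Longrightarrow> fps2_convergent G \<Longrightarrow> G * F \<in> I" using I_l_closed by (simp add: ops_conv carrier_conv)
qed

lemma conv_ideal_sum:
  "ideal I conv_ring \<Longrightarrow> (\<And>x. x \<in> A \<Longrightarrow> f x \<in> I) \<Longrightarrow> sum f A \<in> I"
  by (induction A rule: infinite_finite_induct) (auto simp: conv_ideal)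

lemma conv_ideal_diff:
  assumes "ideal I conv_ring" "F \<in> I" "G \<in> I"
  shows "F - G \<in> I"
  using conv_ideal(3)[OF assms(1,2) conv_ideal(4)[OF assms(1,3) conv_const[of "-1"]]]
  by (simp add: hom_ring_uminus[OF hom_ring_fps2_const] fps2_const_simps)

lemma conv_idealI:
  assumes "I \<subseteq> Collect fps2_convergent" "0 \<in> I" "\<And>F G. F \<in> I \<Longrightarrow> G \<in> I \<Longrightarrow> F + G \<in> I"
    and "\<And>F G. F \<in> I \<Longrightarrow> fps2_convergent G \<Longrightarrow> G * F \<in> I"
  shows "ideal I conv_ring"
proof -
  interpret cring conv_ring by (rule cring_conv_ring)
  show ?thesis
  proof (rule idealI)
    show "subgroup I (add_monoid conv_ring)"
    proof (rule add.subgroupI)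
      fix F assume F: "F \<in> I"
      then have "\<ominus>\<^bsub>conv_ring\<^esub> F = - F"
        using assms(1) conv_uminus[of F] by (intro minus_equality) (auto simp: carrier_conv ops_conv)
      also have "- F = fps2_const (-1) * F"
        by (simp add: hom_ring_uminus[OF hom_ring_fps2_const] fps2_const_simps)
      also have "\<dots> \<in> I"
        using F conv_const by (rule assms(4))
      finally show "\<ominus>\<^bsub>conv_ring\<^esub> F \<in> I" .
    qed (use assms in \<open>auto simp: carrier_conv ops_conv\<close>)
  qed (use assms(4) in \<open>auto simp: carrier_conv ops_conv mult.commute intro: ring_axioms\<close>)
qed

subsection \<open>Order of vanishing and truncation\<close>

definition ord_ge :: "nat \<Rightarrow> complex fps fps \<Rightarrow> bool" where
  "ord_ge n F \<longleftrightarrow> (\<forall>i j. i + j < n \<longrightarrow> coeff2 F i j = 0)"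

lemma ord_ge_mult:
  assumes "ord_ge m F" "ord_ge n G"
  shows "ord_ge (m + n) (F * G)"
  unfolding ord_ge_def
proof (intro allI impI)
  fix i j assume ij: "i + j < m + n"
  have "coeff2 F a b * coeff2 G (i - a) (j - b) = 0" if "a \<le> i" "b \<le> j" for a b
  proof (cases "a + b < m")
    case True
    then show ?thesis using assms(1) by (simp add: ord_ge_def)
  next
    case False
    then have "(i - a) + (j - b) < n" using that ij by linarith
    then show ?thesis using assms(2) by (simp add: ord_ge_def)
  qed
  then show "coeff2 (F * G) i j = 0"
    unfolding coeff2_mult by (intro sum.neutral ballI) simp
qed

lemma ord_ge_sum: "(\<And>x. x \<in> A \<Longrightarrow> ord_ge n (f x)) \<Longrightarrow> ord_ge n (sum f A)"
  by (simp add: ord_ge_def)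

lemma ord_ge_prod: "(\<And>x. x \<in> A \<Longrightarrow> ord_ge 1 (f x)) \<Longrightarrow> ord_ge (card A) (prod f A)"
proof (induction A rule: infinite_finite_induct)
  case (insert x A)
  then show ?case
    using ord_ge_mult[of 1 "f x" "card A" "prod f A"] by simp
qed (auto simp: ord_ge_def)

lemma ord_ge_lin2: "ord_ge 1 (lin2 0 a b)"
  by (auto simp: ord_ge_def lin2_def coeff2_const coeff2_xy_mult fps2_const_simps mult.commute[of _ fps2_x] mult.commute[of _ fps2_y])

definition trunc :: "nat \<Rightarrow> complex fps fps \<Rightarrow> complex fps fps" where
  "trunc n F = Abs_fps (\<lambda>j. Abs_fps (\<lambda>i. if i + j < n then coeff2 F i j else 0))"

lemma coeff2_trunc [simp]: "coeff2 (trunc n F) i j = (if i + j < n then coeff2 F i j else 0)"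
  by (simp add: trunc_def coeff2_def)

text \<open>A factor of order \<open>m\<close> shifts degrees by \<open>m\<close>, so only the terms of degree less than \<open>n\<close> of the other
  factor are seen.\<close>

lemma trunc_mult_ord:
  assumes "ord_ge m H"
  shows "trunc (m + n) (F * H) = trunc (m + n) (trunc n F * H)"
proof -
  have "ord_ge n (F - trunc n F)"
    by (simp add: ord_ge_def)
  then have "ord_ge (m + n) ((F - trunc n F) * H)"
    using ord_ge_mult[OF _ assms, of n "F - trunc n F"] by (simp add: add.commute)
  then show ?thesis
    by (intro fps2_eqI) (simp add: ord_ge_def left_diff_distrib)
qed

definition mono2 :: "nat \<times> nat \<Rightarrow> complex fps fps" where
  "mono2 = (\<lambda>(i, j). fps2_x ^ i * fps2_y ^ j)"

lemma coeff2_mono2: "coeff2 (mono2 (i', j')) i j = (if i = i' \<and> j = j' then 1 else 0)"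
proof (induction i' arbitrary: i)
  case 0
  have "coeff2 (fps2_y ^ j') i j = (if i = 0 \<and> j = j' then 1 else 0)"
  proof (induction j' arbitrary: j)
    case 0
    then show ?case using coeff2_const[of 1 i j] by (simp add: fps2_const_simps)
  next
    case (Suc j')
    then show ?case by (auto simp: coeff2_xy_mult)
  qed
  then show ?case by (simp add: mono2_def)
next
  case (Suc i')
  have "mono2 (Suc i', j') = fps2_x * mono2 (i', j')"
    by (simp add: mono2_def mult.assoc)
  then show ?case
    using Suc by (auto simp: coeff2_xy_mult)
qed

lemma conv_mono2: "fps2_convergent (mono2 e)"
  by (auto simp: mono2_def intro!: conv_mult conv_power conv_x conv_y split: prod.splits)

definition exps2 :: "nat \<Rightarrow> (nat \<times> nat) set" where
  "exps2 n = {(i, j). i + j < n}"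

lemma exps2_eq: "exps2 n = (SIGMA i:{..<n}. {..<n - i})"
  by (auto simp: exps2_def)

lemma finite_exps2: "finite (exps2 n)"
  unfolding exps2_eq by simp

lemma card_exps2: "card (exps2 n) * 2 = n * (n + 1)"
proof (cases n)
  case (Suc m)
  have "card (exps2 n) = (\<Sum>i<n. n - i)"
    unfolding exps2_eq by simp
  also have "\<dots> = (\<Sum>i\<le>m. Suc (m - i))"
    unfolding Suc lessThan_Suc_atMost by (rule sum.cong) auto
  finally show ?thesis
    using sum_atMost_diff[of m] Suc by simp
qed (simp add: exps2_def)

lemma trunc_eq_sum: "trunc n F = (\<Sum>e\<in>exps2 n. fps2_const (case e of (i, j) \<Rightarrow> coeff2 F i j) * mono2 e)"
proof (rule fps2_eqI)
  fix i j
  have "coeff2 (\<Sum>e\<in>exps2 n. fps2_const (case e of (i, j) \<Rightarrow> coeff2 F i j) * mono2 e) i j =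
      (\<Sum>e\<in>exps2 n. if e = (i, j) then coeff2 F i j else 0)"
    unfolding coeff2_sum by (rule sum.cong) (auto simp: coeff2_mono2 split: if_splits)
  then show "coeff2 (trunc n F) i j = coeff2 (\<Sum>e\<in>exps2 n. fps2_const (case e of (i, j) \<Rightarrow> coeff2 F i j) * mono2 e) i j"
    using finite_exps2[of n] by (simp add: exps2_def)
qed

interpretation F: vector_space "\<lambda>c F. fps2_const c * F"
  by unfold_locales (simp_all add: fps2_const_simps algebra_simps)

interpretation FF: vector_space_pair "\<lambda>c F. fps2_const c * F" "\<lambda>c F. fps2_const c * F" ..

lemma trunc_linear: "Vector_Spaces.linear (\<lambda>c F. fps2_const c * F) (\<lambda>c F. fps2_const c * F) (trunc n)"
  by unfold_locales (auto intro: fps2_eqI)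

lemma mono2_independent: "F.independent (mono2 ` A)" and mono2_inj: "inj_on mono2 A" if "finite A"
proof -
  show inj: "inj_on mono2 A"
  proof (rule inj_onI)
    fix e e' assume "mono2 e = mono2 e'"
    then show "e = e'"
      using coeff2_mono2[of "fst e" "snd e" "fst e" "snd e"] coeff2_mono2[of "fst e'" "snd e'" "fst e" "snd e"]
      by (auto simp: prod_eq_iff split: if_splits)
  qed
  show "F.independent (mono2 ` A)"
  proof (rule F.independent_if_scalars_zero)
    fix g x assume s: "(\<Sum>x\<in>mono2 ` A. fps2_const (g x) * x) = 0" and "x \<in> mono2 ` A"
    then obtain i j where x: "x = mono2 (i, j)" "(i, j) \<in> A" by auto
    have "0 = coeff2 (\<Sum>x\<in>mono2 ` A. fps2_const (g x) * x) i j"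
      using s by simp
    also have "\<dots> = (\<Sum>e\<in>A. if e = (i, j) then g x else 0)"
      unfolding sum.reindex[OF inj] coeff2_sum by (rule sum.cong) (auto simp: coeff2_mono2 x split: if_splits)
    finally show "g x = 0"
      using x that by simp
  qed (use that in simp)
qed

section \<open>Dimension of a quotient of the ring of convergent power series\<close>

abbreviation coset :: "complex fps fps set \<Rightarrow> complex fps fps \<Rightarrow> complex fps fps set" where
  "coset I F \<equiv> I +>\<^bsub>conv_ring\<^esub> F"

lemma coset_ops:
  assumes I: "ideal I conv_ring"
  shows "carrier (conv_ring Quot I) = coset I ` Collect fps2_convergent"
    and "fps2_convergent F \<Longrightarrow> fps2_convergent G \<Longrightarrow> coset I F \<oplus>\<^bsub>conv_ring Quot I\<^esub> coset I G = coset I (F + G)"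
    and "fps2_convergent F \<Longrightarrow> fps2_convergent G \<Longrightarrow> coset I F \<otimes>\<^bsub>conv_ring Quot I\<^esub> coset I G = coset I (F * G)"
    and "\<zero>\<^bsub>conv_ring Quot I\<^esub> = coset I 0"
    and "\<one>\<^bsub>conv_ring Quot I\<^esub> = coset I 1"
    and "fps2_convergent F \<Longrightarrow> fps2_convergent G \<Longrightarrow> coset I F = coset I G \<longleftrightarrow> F - G \<in> I"
proof -
  interpret C: cring conv_ring by (rule cring_conv_ring)
  interpret h: ring_hom_ring conv_ring "conv_ring Quot I" "coset I"
    using ideal.rcos_ring_hom_ring[OF I] .
  show "carrier (conv_ring Quot I) = coset I ` Collect fps2_convergent"
    unfolding FactRing_def A_RCOSETS_def' carrier_conv partial_object.select_convs by blast
  show "\<zero>\<^bsub>conv_ring Quot I\<^esub> = coset I 0" "\<one>\<^bsub>conv_ring Quot I\<^esub> = coset I 1"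
    using h.hom_zero h.hom_one by (simp_all only: ops_conv)
  assume F: "fps2_convergent F" "fps2_convergent G"
  show "coset I F \<oplus>\<^bsub>conv_ring Quot I\<^esub> coset I G = coset I (F + G)"
    "coset I F \<otimes>\<^bsub>conv_ring Quot I\<^esub> coset I G = coset I (F * G)"
    using h.hom_add[of F G] h.hom_mult[of F G] F by (simp_all only: ops_conv carrier_conv mem_Collect_eq)
  have "\<ominus>\<^bsub>conv_ring\<^esub> G = - G"
    using F conv_uminus[of G] by (intro C.minus_equality) (auto simp: carrier_conv ops_conv)
  then have "F \<ominus>\<^bsub>conv_ring\<^esub> G = F - G"
    by (simp add: a_minus_def ops_conv)
  then show "coset I F = coset I G \<longleftrightarrow> F - G \<in> I"
    using C.quotient_eq_iff_same_a_r_cos[OF I, of F G] F by (simp only: carrier_conv mem_Collect_eq)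
qed

lemma subfield_constants: "subfield (range fps2_const) conv_ring"
proof -
  interpret C: cring conv_ring by (rule cring_conv_ring)
  note hs = fps2_const_simps
  have inv: "fps2_const (inverse c) * fps2_const c = 1" if "c \<noteq> 0" for c
    using that by (simp add: hs(4)[symmetric] hs(2))
  have "subring (range fps2_const) conv_ring"
  proof (rule C.subringI)
    fix F assume "F \<in> range fps2_const"
    then obtain c where c: "F = fps2_const c" by blast
    have "\<ominus>\<^bsub>conv_ring\<^esub> F = fps2_const (- c)"
      using conv_const by (intro C.minus_equality) (auto simp: c carrier_conv ops_conv hs(3)[symmetric] hs(1))
    then show "\<ominus>\<^bsub>conv_ring\<^esub> F \<in> range fps2_const" by simp
  next
    show "\<one>\<^bsub>conv_ring\<^esub> \<in> range fps2_const"
      using hs(2) by (auto simp: ops_conv image_iff intro: exI[of _ 1])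
  qed (auto simp: carrier_conv ops_conv conv_const simp flip: hs)
  then have "subcring (range fps2_const) conv_ring"
    by (rule C.subcringI')
  moreover have "Units (conv_ring\<lparr>carrier := range fps2_const\<rparr>) = range fps2_const - {\<zero>\<^bsub>conv_ring\<^esub>}"
  proof -
    have "fps2_const c \<in> Units (conv_ring\<lparr>carrier := range fps2_const\<rparr>) \<longleftrightarrow> fps2_const c \<noteq> 0" for c
    proof (cases "c = 0")
      case True
      then show ?thesis by (auto simp: Units_def ops_conv hs)
    next
      case False
      have "fps2_const c \<noteq> 0"
        using inv[OF False] by auto
      moreover have "fps2_const c \<in> Units (conv_ring\<lparr>carrier := range fps2_const\<rparr>)"
        using inv[OF False] by (auto simp: Units_def ops_conv mult.commute)
      ultimately show ?thesis by simp
    qed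
    moreover have "Units (conv_ring\<lparr>carrier := range fps2_const\<rparr>) \<subseteq> range fps2_const"
      by (auto simp: Units_def)
    moreover have "0 \<notin> Units (conv_ring\<lparr>carrier := range fps2_const\<rparr>)"
      using calculation(1)[of 0] by (simp add: hs)
    ultimately show ?thesis
      by (auto simp: ops_conv)
  qed
  ultimately show ?thesis
    by (rule C.subfieldI)
qed

text \<open>Since \<open>ring.dim\<close> is meaningful only for spaces of finite dimension, a finite spanning set \<open>S\<close> must be
  known beforehand. Representatives of a basis of the quotient then form a spanning set \<open>T\<close> of the right size.
  The conclusion no longer mentions cosets, so that dimensions can be compared in the vector space of all power series.\<close>

lemma quotient_dim:
  assumes I: "ideal I conv_ring" "1 \<notin> I"
    and S: "finite S" "S \<subseteq> Collect fps2_convergent"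
    and gen: "\<And>F. fps2_convergent F \<Longrightarrow> \<exists>G\<in>F.span S. F - G \<in> I"
  obtains T where "finite T" "card T \<le> ring.dim (conv_ring Quot I) (range (\<lambda>c. coset I (fps2_const c))) (carrier (conv_ring Quot I))"
    "\<And>F. fps2_convergent F \<Longrightarrow> \<exists>G\<in>F.span T. F - G \<in> I"
proof -
  let ?Q = "conv_ring Quot I"
  let ?K = "range (\<lambda>c. coset I (fps2_const c))"
  interpret h: ring_hom_ring conv_ring ?Q "coset I"
    using ideal.rcos_ring_hom_ring[OF I(1)] .
  note ops = coset_ops[OF I(1)]
  have "\<one>\<^bsub>?Q\<^esub> \<noteq> \<zero>\<^bsub>?Q\<^esub>"
    using I(2) ops(6)[OF conv_one conv_zero] by (simp add: ops)
  then have "subfield (coset I ` range fps2_const) ?Q"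
    by (rule h.img_is_subfield(2)[OF subfield_constants])
  then have K: "subfield ?K ?Q"
    by (simp add: image_image)
  have spanS: "fps2_convergent G" if "G \<in> F.span S" for G
  proof -
    have "F.span S \<subseteq> Collect fps2_convergent"
      using S(2) by (intro F.span_minimal)
        (auto simp: F.subspace_def conv_zero conv_add conv_mult conv_const)
    then show ?thesis using that by blast
  qed
  obtain Us0 where Us0: "set Us0 = S"
    using S(1) finite_list by blast
  define Us where "Us = map (coset I) Us0"
  have Us: "set Us = coset I ` S"
    by (simp add: Us_def Us0)
  have Uscar: "set Us \<subseteq> carrier ?Q"
    unfolding Us ops(1) using S(2) by blast
  have "carrier ?Q \<subseteq> h.S.Span ?K Us"
  proof
    fix X assume "X \<in> carrier ?Q"
    then obtain F where F: "fps2_convergent F" "X = coset I F"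
      unfolding ops(1) by blast
    obtain G where G: "G \<in> F.span S" "F - G \<in> I"
      using gen[OF F(1)] by blast
    have "F.span S \<subseteq> {G. fps2_convergent G \<and> coset I G \<in> h.S.Span ?K Us}"
    proof (rule F.span_minimal)
      show "S \<subseteq> {G. fps2_convergent G \<and> coset I G \<in> h.S.Span ?K Us}"
        using S(2) h.S.Span_base_incl[OF K Uscar] Us by auto
      show "F.subspace {G. fps2_convergent G \<and> coset I G \<in> h.S.Span ?K Us}"
      proof (rule F.subspaceI)
        show "0 \<in> {G. fps2_convergent G \<and> coset I G \<in> h.S.Span ?K Us}"
          using h.S.Span_subgroup_props(2)[OF K Uscar] by (simp add: conv_zero ops)
      next
        fix G H assume "G \<in> {G. fps2_convergent G \<and> coset I G \<in> h.S.Span ?K Us}"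
          "H \<in> {G. fps2_convergent G \<and> coset I G \<in> h.S.Span ?K Us}"
        then show "G + H \<in> {G. fps2_convergent G \<and> coset I G \<in> h.S.Span ?K Us}"
          using h.S.Span_subgroup_props(3)[OF K Uscar, of "coset I G" "coset I H"] by (simp add: conv_add ops)
      next
        fix c G assume "G \<in> {G. fps2_convergent G \<and> coset I G \<in> h.S.Span ?K Us}"
        then show "fps2_const c * G \<in> {G. fps2_convergent G \<and> coset I G \<in> h.S.Span ?K Us}"
          using h.S.Span_smult_closed[OF K Uscar rangeI, of "coset I G" c]
          by (simp add: conv_mult conv_const ops)
      qed
    qed
    then have "coset I G \<in> h.S.Span ?K Us"
      using G(1) by blast
    then show "X \<in> h.S.Span ?K Us"
      using ops(6)[OF F(1) spanS[OF G(1)]] G(2) F(2) by simp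
  qed
  then have "h.S.Span ?K Us = carrier ?Q"
    using h.S.Span_in_carrier[OF _ Uscar, of ?K] subfieldE(3)[OF K] by blast
  then have "h.S.finite_dimension ?K (carrier ?Q)"
    using h.S.Span_finite_dimension[OF K Uscar] by simp
  then have "h.S.dimension (h.S.dim ?K (carrier ?Q)) ?K (carrier ?Q)"
    using h.S.finite_dimensionE[OF K] unfolding over_def by blast
  then obtain Vs where Vs: "set Vs \<subseteq> carrier ?Q" "length Vs = h.S.dim ?K (carrier ?Q)"
    "h.S.Span ?K Vs = carrier ?Q"
    using h.S.exists_base[OF K] by blast
  define rep where "rep V = (SOME F. fps2_convergent F \<and> V = coset I F)" for V
  have rep: "fps2_convergent (rep V) \<and> V = coset I (rep V)" if V: "V \<in> carrier ?Q" for V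
  proof -
    obtain F where "fps2_convergent F \<and> V = coset I F"
      using V unfolding ops(1) by blast
    then show ?thesis
      unfolding rep_def by (rule someI)
  qed
  have span: "\<exists>G. G \<in> F.span (rep ` set Ws) \<and> fps2_convergent G \<and> X = coset I G"
    if "set Ws \<subseteq> carrier ?Q" "X \<in> h.S.Span ?K Ws" for Ws X
    using that
  proof (induction Ws arbitrary: X)
    case Nil
    then show ?case
      by (intro exI[of _ 0]) (simp add: conv_zero ops)
  next
    case (Cons W Ws)
    then obtain c Y where Y: "Y \<in> h.S.Span ?K Ws" "X = coset I (fps2_const c) \<otimes>\<^bsub>?Q\<^esub> W \<oplus>\<^bsub>?Q\<^esub> Y"
      by (auto simp: h.S.line_extension_mem_iff)
    obtain G where G: "G \<in> F.span (rep ` set Ws)" "fps2_convergent G" "Y = coset I G"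
      using Cons.IH[OF _ Y(1)] Cons.prems(1) by auto
    have W: "fps2_convergent (rep W)" "W = coset I (rep W)"
      using rep[of W] Cons.prems(1) by auto
    have "X = coset I (fps2_const c * rep W + G)"
      unfolding Y(2) G(3) by (subst W(2)) (simp add: ops conv_mult conv_const W(1) G(2))
    moreover have "fps2_const c * rep W + G \<in> F.span (rep ` set (W # Ws))"
      using G(1) F.span_mono[of "rep ` set Ws" "rep ` set (W # Ws)"]
      by (intro F.span_add F.span_scale) (auto intro: F.span_base)
    ultimately show ?case
      using conv_add[OF conv_mult[OF conv_const W(1)] G(2)] by blast
  qed
  show ?thesis
  proof (rule that[of "rep ` set Vs"])
    show "finite (rep ` set Vs)" by simp
    show "card (rep ` set Vs) \<le> ring.dim ?Q ?K (carrier ?Q)"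
      using card_image_le[of "set Vs" rep] card_length[of Vs] Vs(2) by simp
    fix F assume F: "fps2_convergent F"
    then have "coset I F \<in> h.S.Span ?K Vs"
      unfolding Vs(3) ops(1) by blast
    then obtain G where "G \<in> F.span (rep ` set Vs)" "fps2_convergent G" "coset I F = coset I G"
      using span[OF Vs(1)] by blast
    then show "\<exists>G\<in>F.span (rep ` set Vs). F - G \<in> I"
      using ops(6)[OF F] by blast
  qed
qed

text \<open>Collect the terms divisible by \<open>x^N\<close>, and among the others those divisible by \<open>y^N\<close>; both cofactors
  converge, and finitely many terms remain.\<close>

lemma reduce_mod_powers:
  assumes I: "ideal I conv_ring" and N: "fps2_x ^ N \<in> I" "fps2_y ^ N \<in> I"
    and F: "fps2_convergent F"
  shows "\<exists>G\<in>F.span (mono2 ` ({..<N} \<times> {..<N})). F - G \<in> I"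
proof -
  define F1 where "F1 = Abs_fps (\<lambda>j. Abs_fps (\<lambda>i. coeff2 F (i + N) j))"
  define F2 where "F2 = Abs_fps (\<lambda>j. Abs_fps (\<lambda>i. if i < N then coeff2 F i (j + N) else 0))"
  have cfs: "coeff2 F1 i j = coeff2 F (i + N) j" "coeff2 F2 i j = (if i < N then coeff2 F i (j + N) else 0)" for i j
    by (simp_all add: F1_def F2_def coeff2_def)
  obtain C R where CR: "0 \<le> C" "1 \<le> R" "\<And>i j. norm (coeff2 F i j) \<le> C * R ^ (i + j)"
    using convE[OF F] by blast
  have conv: "fps2_convergent F1" "fps2_convergent F2"
  proof -
    show "fps2_convergent F1"
    proof (rule convI[of "C * R ^ N" R])
      show "norm (coeff2 F1 i j) \<le> C * R ^ N * R ^ (i + j)" for i j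
        using CR(3)[of "i + N" j] by (simp add: cfs power_add mult_ac)
    qed (use CR in auto)
    show "fps2_convergent F2"
    proof (rule convI[of "C * R ^ N" R])
      show "norm (coeff2 F2 i j) \<le> C * R ^ N * R ^ (i + j)" for i j
        using CR(3)[of i "j + N"] CR(1,2) by (auto simp: cfs power_add mult_ac)
    qed (use CR in auto)
  qed
  define G where "G = (\<Sum>e\<in>{..<N} \<times> {..<N}. fps2_const (case e of (i, j) \<Rightarrow> coeff2 F i j) * mono2 e)"
  have cfx: "coeff2 (fps2_x ^ n * H) i j = (if i < n then 0 else coeff2 H (i - n) j)" for n H i j
    by (induction n arbitrary: i) (auto simp: coeff2_xy_mult mult.assoc)
  have cfy: "coeff2 (fps2_y ^ n * H) i j = (if j < n then 0 else coeff2 H i (j - n))" for n H i j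
    by (induction n arbitrary: j) (auto simp: coeff2_xy_mult mult.assoc)
  have cfG: "coeff2 G i j = (if i < N \<and> j < N then coeff2 F i j else 0)" for i j
  proof -
    have "coeff2 G i j = (\<Sum>e\<in>{..<N} \<times> {..<N}. if e = (i, j) then coeff2 F i j else 0)"
      unfolding G_def coeff2_sum by (rule sum.cong) (auto simp: coeff2_mono2 split: if_splits)
    then show ?thesis by simp
  qed
  have "F - G = F1 * fps2_x ^ N + F2 * fps2_y ^ N"
    unfolding mult.commute[of F1] mult.commute[of F2]
    by (rule fps2_eqI) (auto simp: cfx cfy cfG cfs)
  also have "\<dots> \<in> I"
    using conv by (intro conv_ideal(3,4)[OF I] N)
  finally have "F - G \<in> I" .
  moreover have "G \<in> F.span (mono2 ` ({..<N} \<times> {..<N}))"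
    unfolding G_def by (intro F.span_sum F.span_scale[OF F.span_base]) auto
  ultimately show ?thesis by blast
qed

section \<open>Tjurina number of a union of lines\<close>

lemma fps2_deriv_mult:
  "fps2_dx (F * G) = fps2_dx F * G + F * fps2_dx G" "fps2_dy (F * G) = fps2_dy F * G + F * fps2_dy G"
proof -
  have "fps_deriv (\<Sum>i\<in>A. f i) = (\<Sum>i\<in>A. fps_deriv (f i))" for f :: "nat \<Rightarrow> complex fps" and A
    by (induction A rule: infinite_finite_induct) auto
  then show "fps2_dx (F * G) = fps2_dx F * G + F * fps2_dx G"
    unfolding fps2_dx_def
    by (intro fps_ext) (simp add: fps_mult_nth sum.distrib add.commute)
  show "fps2_dy (F * G) = fps2_dy F * G + F * fps2_dy G"
    by (simp add: fps2_dy_def add.commute)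
qed

lemma fps2_deriv_lin2: "fps2_dx (lin2 c a b) = fps2_const a" "fps2_dy (lin2 c a b) = fps2_const b"
proof -
  have cfl: "coeff2 (lin2 c a b) i j = (if i = 0 \<and> j = 0 then c else 0) + a * (if i = 1 \<and> j = 0 then 1 else 0) + b * (if i = 0 \<and> j = 1 then 1 else 0)" for i j
    using coeff2_mono2[of 1 0 i j] coeff2_mono2[of 0 1 i j] by (simp add: lin2_def coeff2_const mono2_def)
  show "fps2_dx (lin2 c a b) = fps2_const a" "fps2_dy (lin2 c a b) = fps2_const b"
    by (auto intro!: fps2_eqI simp: cfl coeff2_const)
qed

text \<open>Only the forms with \<open>c b = 0\<close> vanish at the origin; their product is \<open>h\<close>, and the other factors form
  a unit \<open>u\<close>. The products \<open>H b\<close> of all forms in \<open>h\<close> except one satisfy \<open>h\<^sub>x = (\<Sum>b\<in>B. p b * H b)\<close>, and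
  \<open>H b * H b'\<close> is divisible by \<open>h\<close> for \<open>b \<noteq> b'\<close>. Multiplying \<open>h\<^sub>x\<close> and \<open>h\<^sub>y\<close> by \<open>H b\<close> therefore puts
  \<open>(H b)\<^sup>2\<close> into the Tjurina ideal. Since the \<open>H b\<close> span the forms of degree \<open>k = m - 1\<close>, the ideal contains
  \<open>x\<^sup>2\<^sup>k\<close> and \<open>y\<^sup>2\<^sup>k\<close>, and the quotient has finite dimension. For the lower bound, there are
  \<open>k (2 k + 1)\<close> monomials of degree less than \<open>2 k\<close>, while modulo higher degrees the ideal is spanned by
  the multiples of \<open>h\<^sub>x\<close> and \<open>h\<^sub>y\<close> by the \<open>k (k + 1) / 2\<close> monomials of degree less than \<open>k\<close>.\<close>

lemma tjurina_germ_lines: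
  fixes c p q :: "'b \<Rightarrow> complex"
  assumes A: "finite A" and B: "B = {b \<in> A. c b = 0}" and m: "card B = m" "m \<ge> 2"
    and indep: "\<And>b b'. b \<in> B \<Longrightarrow> b' \<in> B \<Longrightarrow> b \<noteq> b' \<Longrightarrow> p b * q b' \<noteq> p b' * q b"
  shows "(m - 1)\<^sup>2 \<le> tjurina_germ (\<Prod>b\<in>A. lin2 (c b) (p b) (q b))"
proof -
  let ?l = "\<lambda>b. lin2 (c b) (p b) (q b)"
  define h u g where "h = (\<Prod>b\<in>B. ?l b)" and "u = (\<Prod>b\<in>A - B. ?l b)" and "g = (\<Prod>b\<in>A. ?l b)"
  define H where "H b = (\<Prod>b'\<in>B - {b}. ?l b')" for b
  define hx hy where "hx = fps2_dx h" and "hy = fps2_dy h"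
  have BA: "B \<subseteq> A" and finB: "finite B"
    using A B by auto
  have g: "g = u * h"
    unfolding g_def u_def h_def using prod.subset_diff[OF BA A] by (simp add: mult.commute)
  have hxy: "hx = (\<Sum>b\<in>B. fps2_const (p b) * H b)" "hy = (\<Sum>b\<in>B. fps2_const (q b) * H b)"
    unfolding hx_def hy_def h_def H_def
    by (simp_all add: derivation_prod[OF fps2_deriv_mult(1) finB] derivation_prod[OF fps2_deriv_mult(2) finB] fps2_deriv_lin2)
  have gxy: "fps2_dx g = fps2_dx u * h + u * hx" "fps2_dy g = fps2_dy u * h + u * hy"
    unfolding g hx_def hy_def by (rule fps2_deriv_mult)+
  have lB: "?l b = fps2_const (p b) * fps2_x + fps2_const (q b) * fps2_y" if "b \<in> B" for b
    using that B by (simp add: lin2_def fps2_const_simps)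
  have hH: "h = ?l b * H b" if "b \<in> B" for b
    unfolding h_def H_def by (rule prod.remove[OF finB that])
  have conv: "fps2_convergent h" "fps2_convergent u" "fps2_convergent g" "fps2_convergent (H b)" for b
    unfolding h_def u_def g_def H_def by (intro conv_prod conv_lin2)+
  have convd: "fps2_convergent hx" "fps2_convergent hy" "fps2_convergent (fps2_dx g)" "fps2_convergent (fps2_dy g)"
    "fps2_convergent (fps2_dx u)" "fps2_convergent (fps2_dy u)"
    by (simp_all add: hx_def hy_def conv_deriv conv)
  \<comment> \<open>Euler's identity\<close>
  have euler: "fps2_const (of_nat m) * h = fps2_x * hx + fps2_y * hy"
  proof -
    have of_nat: "fps2_const (of_nat n) = of_nat n" for n
      by (induction n) (simp_all add: fps2_const_simps)
    have "fps2_x * hx + fps2_y * hy = (\<Sum>b\<in>B. ?l b * H b)"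
      unfolding hxy sum_distrib_left sum.distrib[symmetric]
      by (rule sum.cong) (simp_all add: lB algebra_simps)
    also have "\<dots> = (\<Sum>b\<in>B. h)"
      using hH by (intro sum.cong) auto
    finally show ?thesis
      using m by (simp add: of_nat)
  qed
  have "h = fps2_const (inverse (of_nat m)) * (fps2_const (of_nat m) * h)"
    using m by (simp add: mult.assoc[symmetric] fps2_const_simps(4)[symmetric] fps2_const_simps(2))
  then have heq: "h = fps2_const (inverse (of_nat m)) * fps2_x * hx + fps2_const (inverse (of_nat m)) * fps2_y * hy"
    unfolding euler by (simp add: algebra_simps)
  define I where "I = tjurina_ideal g"
  interpret C: cring conv_ring by (rule cring_conv_ring)
  have gens: "{g, fps2_dx g, fps2_dy g} \<subseteq> carrier conv_ring"
    using conv convd by (simp add: carrier_conv)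
  have I: "ideal I conv_ring"
    unfolding I_def tjurina_ideal_def by (rule C.genideal_ideal[OF gens])
  have gI: "g \<in> I" "fps2_dx g \<in> I" "fps2_dy g \<in> I"
    using C.genideal_self[OF gens] by (auto simp: I_def tjurina_ideal_def)
  note Icl = conv_ideal(3,4)[OF I] conv_ideal_diff[OF I] conv_ideal_sum[OF I]
  have IJ: "\<exists>P Q. F = P * hx + Q * hy" if "F \<in> I" for F
  proof -
    define J where "J = {F. fps2_convergent F \<and> (\<exists>P Q. F = P * hx + Q * hy)}"
    have "ideal J conv_ring"
    proof (rule conv_idealI)
      show "J \<subseteq> Collect fps2_convergent" "0 \<in> J"
        by (auto simp: J_def conv_zero intro: exI[of _ 0])
    next
      fix F G assume "F \<in> J" "G \<in> J"
      then obtain P Q P' Q' where "F = P * hx + Q * hy" "G = P' * hx + Q' * hy"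
        and c: "fps2_convergent F" "fps2_convergent G"
        unfolding J_def by blast
      then have "F + G = (P + P') * hx + (Q + Q') * hy"
        by (simp add: algebra_simps)
      moreover have "fps2_convergent (F + G)"
        using c by (rule conv_add)
      ultimately show "F + G \<in> J"
        unfolding J_def by blast
    next
      fix F G assume "F \<in> J" "fps2_convergent G"
      then obtain P Q where "F = P * hx + Q * hy" and c: "fps2_convergent F" "fps2_convergent G"
        unfolding J_def by blast
      then have "G * F = (G * P) * hx + (G * Q) * hy"
        by (simp add: algebra_simps)
      moreover have "fps2_convergent (G * F)"
        using c(2,1) by (rule conv_mult)
      ultimately show "G * F \<in> J"
        unfolding J_def by blast
    qed
    moreover have "{g, fps2_dx g, fps2_dy g} \<subseteq> J"
    proof -
      let ?i = "fps2_const (inverse (of_nat m))"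
      have "g = (u * ?i * fps2_x) * hx + (u * ?i * fps2_y) * hy"
        unfolding g by (subst heq) (simp add: algebra_simps)
      moreover have "fps2_dx g = (fps2_dx u * ?i * fps2_x + u) * hx + (fps2_dx u * ?i * fps2_y) * hy"
        unfolding gxy by (subst heq) (simp add: algebra_simps)
      moreover have "fps2_dy g = (fps2_dy u * ?i * fps2_x) * hx + (fps2_dy u * ?i * fps2_y + u) * hy"
        unfolding gxy by (subst heq) (simp add: algebra_simps)
      ultimately show ?thesis
        unfolding J_def using conv convd by blast
    qed
    ultimately have "I \<subseteq> J"
      unfolding I_def tjurina_ideal_def by (rule C.genideal_minimal)
    then show ?thesis
      using that by (auto simp: J_def)
  qed
  define k where "k = m - 1"
  have k: "k \<ge> 1" "card B = Suc k"
    using m by (auto simp: k_def)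
  have ordH: "ord_ge k (H b)" if "b \<in> B" for b
  proof -
    have "card (B - {b}) = k"
      using that k finB by simp
    then show ?thesis
      using ord_ge_prod[of "B - {b}" ?l] ord_ge_lin2 B by (auto simp: H_def)
  qed
  have ordh: "ord_ge k hx" "ord_ge k hy"
    unfolding hxy using ordH by (auto intro!: ord_ge_sum simp: ord_ge_def)
  have one: "1 \<notin> I"
  proof
    assume "1 \<in> I"
    then obtain P Q where "1 = P * hx + Q * hy"
      using IJ by blast
    then have "coeff2 1 0 0 = coeff2 (P * hx + Q * hy) 0 0"
      by simp
    then show False
      using ordh k by (simp add: coeff2_one coeff2_mult ord_ge_def)
  qed
  \<comment> \<open>The ideal contains high powers of the coordinates.\<close>
  have "\<exists>v. fps2_convergent v \<and> u * v = 1"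
  proof -
    have "\<forall>b\<in>A - B. \<exists>v. fps2_convergent v \<and> ?l b * v = 1"
      using lin2_invertible B by blast
    then obtain v where v: "\<And>b. b \<in> A - B \<Longrightarrow> fps2_convergent (v b)" "\<And>b. b \<in> A - B \<Longrightarrow> ?l b * v b = 1"
      by metis
    have "u * (\<Prod>b\<in>A - B. v b) = 1"
      unfolding u_def prod.distrib[symmetric] using v(2) by simp
    then show ?thesis
      using conv_prod[of "A - B" v] v(1) by blast
  qed
  then obtain v where v: "fps2_convergent v" "u * v = 1" by blast
  have vu: "v * (u * w) = w" for w
  proof -
    have "v * (u * w) = (u * v) * w"
      by (simp only: mult_ac)
    then show ?thesis
      by (simp add: v(2))
  qed
  have hI: "h \<in> I"
  proof -
    have "h = v * g"
      by (simp add: g vu)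
    then show ?thesis using Icl(2)[OF gI(1) v(1)] by simp
  qed
  have hxI: "hx \<in> I"
  proof -
    have "hx = v * (fps2_dx g - fps2_dx u * h)"
      by (simp add: gxy vu)
    then show ?thesis using Icl(2)[OF Icl(3)[OF gI(2) Icl(2)[OF hI convd(5)]] v(1)] by simp
  qed
  have hyI: "hy \<in> I"
  proof -
    have "hy = v * (fps2_dy g - fps2_dy u * h)"
      by (simp add: gxy vu)
    then show ?thesis using Icl(2)[OF Icl(3)[OF gI(3) Icl(2)[OF hI convd(6)]] v(1)] by simp
  qed
  have HH: "H b * H b' \<in> I" if b: "b \<in> B" "b' \<in> B" and ne: "b \<noteq> b'" for b b'
  proof -
    have "H b = ?l b' * (\<Prod>d\<in>B - {b} - {b'}. ?l d)"
      unfolding H_def using b ne finB by (intro prod.remove) auto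
    then have "H b * H b' = (\<Prod>d\<in>B - {b} - {b'}. ?l d) * h"
      unfolding hH[OF b(2)] by (simp add: mult_ac)
    then show ?thesis
      using Icl(2)[OF hI, of "\<Prod>d\<in>B - {b} - {b'}. ?l d"] conv_prod[of "B - {b} - {b'}" ?l] conv_lin2 by simp
  qed
  have H2: "H b * H b \<in> I" if b: "b \<in> B" for b
  proof -
    have cH: "fps2_const (r b) * (H b * H b) \<in> I"
      if w: "w = (\<Sum>d\<in>B. fps2_const (r d) * H d)" "w \<in> I" for r w
    proof -
      have "H b * w = (\<Sum>d\<in>B. fps2_const (r d) * (H b * H d))"
        unfolding w(1) sum_distrib_left by (simp add: mult_ac)
      also have "\<dots> = fps2_const (r b) * (H b * H b) + (\<Sum>d\<in>B - {b}. fps2_const (r d) * (H b * H d))"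
        by (rule sum.remove[OF finB b])
      finally have "fps2_const (r b) * (H b * H b) = H b * w - (\<Sum>d\<in>B - {b}. fps2_const (r d) * (H b * H d))"
        by simp
      also have "\<dots> \<in> I"
        by (rule Icl(3)[OF Icl(2)[OF w(2) conv(4)] Icl(4)[OF Icl(2)[OF HH[OF b] conv_const]]]) auto
      finally show ?thesis .
    qed
    have div: "H b * H b \<in> I" if "fps2_const s * (H b * H b) \<in> I" "s \<noteq> 0" for s
    proof -
      have "fps2_const (inverse s) * fps2_const s = 1"
        by (simp only: fps2_const_simps(4)[symmetric] left_inverse[OF that(2)] fps2_const_simps(2))
      then show ?thesis
        using Icl(2)[OF that(1) conv_const[of "inverse s"]] by (simp only: mult.assoc[symmetric] mult_1_left)
    qed
    obtain b' where b': "b' \<in> B" "b' \<noteq> b"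
    proof -
      have "B \<noteq> {b}" using k by auto
      then show ?thesis using that b by blast
    qed
    then have "p b \<noteq> 0 \<or> q b \<noteq> 0"
      using indep[OF b b'(1)] by auto
    then show ?thesis
      using div[of "p b"] div[of "q b"] cH[OF hxy(1) hxI] cH[OF hxy(2) hyI] by blast
  qed
  have pow: "w * w \<in> I" if w: "w = (\<Sum>b\<in>B. fps2_const (z b) * H b)" for z w
  proof -
    have "w * w = (\<Sum>b\<in>B. \<Sum>b'\<in>B. fps2_const (z b) * (fps2_const (z b') * (H b * H b')))"
      unfolding w sum_product by (simp add: mult_ac)
    also have "\<dots> \<in> I"
    proof (rule Icl(4)[OF Icl(4)[OF Icl(2)[OF Icl(2)[OF _ conv_const] conv_const]]])
      show "H b * H b' \<in> I" if "b \<in> B" "b' \<in> B" for b b'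
        using that HH H2 by (cases "b = b'") auto
    qed
    finally show ?thesis .
  qed
  have coprod: "\<exists>z. fps2_x ^ i * fps2_y ^ j = (\<Sum>b\<in>B. fps2_const (z b) * H b)" if "i + j = k" for i j
  proof -
    have "\<exists>z. fps2_x ^ i * fps2_y ^ j = (\<Sum>b\<in>B. fps2_const (z b) *
        (\<Prod>d\<in>B - {b}. fps2_const (p d) * fps2_x + fps2_const (q d) * fps2_y))"
      using k that indep by (intro power_product_in_span_of_coproducts[OF hom_ring_fps2_const finB]) auto
    moreover have "(\<Prod>d\<in>B - {b}. fps2_const (p d) * fps2_x + fps2_const (q d) * fps2_y) = H b" for b
      unfolding H_def by (rule prod.cong) (auto simp: lB)
    ultimately show ?thesis by simp
  qed
  define N where "N = k + k"
  have xN: "fps2_x ^ N \<in> I" and yN: "fps2_y ^ N \<in> I"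
    using coprod[of k 0] coprod[of 0 k] pow by (auto simp: N_def power_add)
  \<comment> \<open>Hence the quotient is finite-dimensional, and its dimension can be bounded by truncation.\<close>
  have germ: "ring.dim (conv_ring Quot I) (range (\<lambda>c. coset I (fps2_const c))) (carrier (conv_ring Quot I)) = tjurina_germ g"
    by (simp only: tjurina_germ_def tjurina_algebra_def I_def)
  have "mono2 ` ({..<N} \<times> {..<N}) \<subseteq> Collect fps2_convergent"
    using conv_mono2 by blast
  from quotient_dim[OF I one _ this reduce_mod_powers[OF I xN yN], unfolded germ]
  obtain T where T: "finite T" "card T \<le> tjurina_germ g"
    "\<And>F. fps2_convergent F \<Longrightarrow> \<exists>G\<in>F.span T. F - G \<in> I"
    by blast
  let ?X = "\<lambda>w. (\<lambda>e. trunc N (mono2 e * w)) ` exps2 k"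
  have mult: "trunc N (P * w) \<in> F.span (?X w)" if "ord_ge k w" for P w
  proof -
    have "trunc N (P * w) = trunc N (trunc k P * w)"
      unfolding N_def by (rule trunc_mult_ord[OF that])
    also have "\<dots> = trunc N (\<Sum>e\<in>exps2 k. fps2_const (case e of (i, j) \<Rightarrow> coeff2 P i j) * (mono2 e * w))"
      by (simp add: trunc_eq_sum[of k P] sum_distrib_right mult.assoc)
    also have "\<dots> = (\<Sum>e\<in>exps2 k. fps2_const (case e of (i, j) \<Rightarrow> coeff2 P i j) * trunc N (mono2 e * w))"
      by (simp add: FF.linear_sum[OF trunc_linear] FF.linear_scale[OF trunc_linear])
    also have "\<dots> \<in> F.span (?X w)"
      by (intro F.span_sum F.span_scale[OF F.span_base]) auto
    finally show ?thesis .
  qed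
  define E where "E = trunc N ` T \<union> (?X hx \<union> ?X hy)"
  have "mono2 ` exps2 N \<subseteq> F.span E"
  proof
    fix w assume "w \<in> mono2 ` exps2 N"
    then obtain i j where ij: "i + j < N" "w = mono2 (i, j)"
      by (auto simp: exps2_def)
    have w: "w = trunc N w"
      by (rule fps2_eqI) (auto simp: ij coeff2_mono2)
    obtain G where G: "G \<in> F.span T" "w - G \<in> I"
      using T(3)[of w] conv_mono2 ij by blast
    obtain P Q where PQ: "w - G = P * hx + Q * hy"
      using IJ[OF G(2)] by blast
    have "w = trunc N G + (trunc N (P * hx) + trunc N (Q * hy))"
    proof -
      have "w = trunc N (G + (P * hx + Q * hy))"
        using w PQ by (metis add.commute diff_add_cancel)
      then show ?thesis
        by (simp add: FF.linear_add[OF trunc_linear])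
    qed
    moreover have "trunc N G \<in> F.span E"
    proof -
      have "trunc N G \<in> F.span (trunc N ` T)"
        using G(1) FF.linear_span_image[OF trunc_linear, of N T] by blast
      then show ?thesis
        using F.span_mono[of "trunc N ` T" E] by (auto simp: E_def)
    qed
    moreover have "trunc N (P * hx) \<in> F.span E" "trunc N (Q * hy) \<in> F.span E"
      using mult[OF ordh(1), of P] mult[OF ordh(2), of Q] F.span_mono[of "?X hx" E] F.span_mono[of "?X hy" E]
      by (auto simp: E_def)
    ultimately show "w \<in> F.span E"
      by (metis F.span_add)
  qed
  moreover have finE: "finite E"
    using T(1) finite_exps2 by (simp add: E_def)
  ultimately have "card (mono2 ` exps2 N) \<le> card E"
    using F.independent_span_bound[OF finE mono2_independent[OF finite_exps2]] by blast
  then have "card (exps2 N) \<le> card E"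
    using mono2_inj[OF finite_exps2] by (simp add: card_image)
  also have "card E \<le> card (trunc N ` T) + (card (?X hx) + card (?X hy))"
    unfolding E_def by (intro order_trans[OF card_Un_le] add_mono card_Un_le order_refl)
  also have "\<dots> \<le> card T + (card (exps2 k) + card (exps2 k))"
    using T(1) finite_exps2 by (intro add_mono card_image_le)
  finally have "card (exps2 N) * 2 \<le> 2 * tjurina_germ g + 2 * (card (exps2 k) * 2)"
    using T(2) by simp
  then have "N * (N + 1) \<le> 2 * tjurina_germ g + 2 * (k * (k + 1))"
    by (simp only: card_exps2)
  then have "k\<^sup>2 \<le> tjurina_germ g"
    by (simp add: N_def power2_eq_square algebra_simps)
  then show ?thesis
    unfolding k_def g_def .
qed

section \<open>Singular points of a line arrangement\<close>

definition cross :: "complex^3 \<Rightarrow> complex^3 \<Rightarrow> complex^3" where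
  "cross a b = vector [a$2 * b$3 - a$3 * b$2, a$3 * b$1 - a$1 * b$3, a$1 * b$2 - a$2 * b$1]"

lemma cross_zero_imp_multiple:
  assumes "cross a b = 0" "b \<noteq> 0"
  shows "\<exists>c. a = c *s b"
proof -
  have e: "a$2 * b$3 = a$3 * b$2" "a$3 * b$1 = a$1 * b$3" "a$1 * b$2 = a$2 * b$1"
    using assms(1) by (simp_all add: cross_def vec_eq_iff forall_3)
  consider "b$1 \<noteq> 0" | "b$2 \<noteq> 0" | "b$3 \<noteq> 0"
    using assms(2) vec3_eqI[of b 0] by auto
  then show ?thesis
  proof cases
    case 1
    then show ?thesis using e by (intro exI[of _ "a$1 / b$1"] vec3_eqI) (auto simp: field_simps)
  next
    case 2
    then show ?thesis using e by (intro exI[of _ "a$2 / b$2"] vec3_eqI) (auto simp: field_simps)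
  next
    case 3
    then show ?thesis using e by (intro exI[of _ "a$3 / b$3"] vec3_eqI) (auto simp: field_simps)
  qed
qed

lemma cross_orthogonal: "dot3 a (cross a b) = 0" "dot3 b (cross a b) = 0"
  by (simp_all add: dot3_def cross_def algebra_simps)

text \<open>By the triple product expansion: a common zero of two linear forms is proportional to
  their cross product.\<close>

lemma cross_cross:
  assumes "dot3 a v = 0" "dot3 b v = 0"
  shows "cross v (cross a b) = 0"
proof -
  have "cross v (cross a b) = dot3 b v *s a - dot3 a v *s b"
    by (rule vec3_eqI) (simp_all add: cross_def dot3_def algebra_simps)
  then show ?thesis
    using assms by simp
qed

lemma span_singleton_eq:
  assumes "w \<in> vec.span {v}" "w \<noteq> 0"
  shows "vec.span {w} = vec.span {v}"
proof -
  obtain k where k: "w = k *s v" "k \<noteq> 0"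
    using assms by (auto simp: vec.span_singleton)
  then have "v = inverse k *s w"
    by simp
  then have "v \<in> vec.span {w}"
    by (auto simp: vec.span_singleton)
  then show ?thesis
    using assms(1) vec.span_minimal[of "{v}" "vec.span {w}"] vec.span_minimal[of "{w}" "vec.span {v}"] by simp
qed

lemma dot3_span_iff: "p \<in> proj_plane \<Longrightarrow> v \<in> p \<Longrightarrow> v \<noteq> 0 \<Longrightarrow> (\<forall>w\<in>p. dot3 a w = 0) \<longleftrightarrow> dot3 a v = 0"
  using span_singleton_eq[of v] dot3_span[of v a] unfolding proj_plane_def by auto

definition eval_at :: "complex^3 \<Rightarrow> poly3 \<Rightarrow> complex" where
  "eval_at v f = eval3 id f (v$1) (v$2) (v$3)"

lemma hom_ring_eval_at: "hom_ring (eval_at v)"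
  unfolding eval_at_def by (rule hom_ring_eval3) (simp add: hom_ring_def)

lemma eval_at_simps: "eval_at v (lin_form a) = dot3 a v" "eval_at v (const3 c) = c"
  unfolding eval_at_def by (subst eval3_lin_form eval3_const3; simp add: hom_ring_def dot3_def)+

lemma vanishes_at_iff: "vanishes_at f v \<longleftrightarrow> eval_at v f = 0"
  by (simp add: vanishes_at_def eval_at_def)

lemma partials_prod:
  assumes "finite A" and f: "f = (\<Prod>a\<in>A. lin_form a)"
  shows "eval_at v (dx f) = (\<Sum>a\<in>A. a$1 * (\<Prod>b\<in>A - {a}. dot3 b v))"
    and "eval_at v (dy f) = (\<Sum>a\<in>A. a$2 * (\<Prod>b\<in>A - {a}. dot3 b v))"
    and "eval_at v (dz f) = (\<Sum>a\<in>A. a$3 * (\<Prod>b\<in>A - {a}. dot3 b v))"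
  unfolding f
  by (simp_all add: derivation_prod[OF partial_derivations(2) assms(1)] derivation_prod[OF partial_derivations(4) assms(1)]
      derivation_prod[OF partial_derivations(6) assms(1)] partials_lin_form hom_ring_sum[OF hom_ring_eval_at]
      hom_ring_prod[OF hom_ring_eval_at] hom_ringD[OF hom_ring_eval_at] eval_at_simps)

text \<open>On a single line the gradient of \<open>f\<close> is the coefficient vector of this line times a nonzero factor;
  where two lines meet, every summand of the gradient contains a vanishing factor.\<close>

lemma sing_points_eq:
  assumes A: "distinct_lines A" and f: "f = (\<Prod>a\<in>A. lin_form a)"
  shows "sing_points f = {p \<in> proj_plane. \<exists>a\<in>A. \<exists>b\<in>A. a \<noteq> b \<and> (\<forall>v\<in>p. dot3 a v = 0 \<and> dot3 b v = 0)}"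
proof -
  have finA: "finite A" and nz: "0 \<notin> A"
    using A by (auto simp: distinct_lines_def)
  have evf: "eval_at v f = (\<Prod>a\<in>A. dot3 a v)" for v
    by (simp add: f hom_ring_prod[OF hom_ring_eval_at] eval_at_simps)
  note evals = evf partials_prod[OF finA f]
  have "\<exists>a\<in>A. \<exists>b\<in>A. a \<noteq> b \<and> dot3 a v = 0 \<and> dot3 b v = 0"
    if v: "eval_at v f = 0" "eval_at v (dx f) = 0" "eval_at v (dy f) = 0" "eval_at v (dz f) = 0" for v
  proof (rule ccontr)
    assume neg: "\<not> ?thesis"
    obtain a where a: "a \<in> A" "dot3 a v = 0"
      using v(1) finA by (auto simp: evals)
    have b: "dot3 b v \<noteq> 0" if "b \<in> A - {a}" for b
      using neg a that by blast
    \<comment> \<open>On a single line, the gradient is a multiple of the coefficient vector.\<close>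
    have "(\<Sum>b\<in>A. r b * (\<Prod>c\<in>A - {b}. dot3 c v)) = r a * (\<Prod>c\<in>A - {a}. dot3 c v)" for r :: "complex^3 \<Rightarrow> complex"
    proof -
      have "(\<Sum>b\<in>A - {a}. r b * (\<Prod>c\<in>A - {b}. dot3 c v)) = 0"
        using a finA by (intro sum.neutral) (auto simp: prod_zero_iff)
      then show ?thesis
        by (simp add: sum.remove[OF finA a(1)])
    qed
    note sums = this
    have "(\<Prod>c\<in>A - {a}. dot3 c v) \<noteq> 0"
      using b finA by simp
    then have "a$1 = 0" "a$2 = 0" "a$3 = 0"
      using v(2-4) sums[of "\<lambda>b. b$1"] sums[of "\<lambda>b. b$2"] sums[of "\<lambda>b. b$3"] by (simp_all add: evals)
    then have "a = 0"
      by (intro vec3_eqI) simp_all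
    then show False
      using a nz by blast
  qed
  moreover have "eval_at v f = 0 \<and> eval_at v (dx f) = 0 \<and> eval_at v (dy f) = 0 \<and> eval_at v (dz f) = 0"
    if ab: "a \<in> A" "b \<in> A" "a \<noteq> b" "dot3 a v = 0" "dot3 b v = 0" for a b v
  proof -
    have "(\<Prod>d\<in>A - {c}. dot3 d v) = 0" for c
      using ab finA by (cases "c = a") (auto simp: prod_zero_iff)
    moreover have "(\<Prod>d\<in>A. dot3 d v) = 0"
      using ab finA by auto
    ultimately show ?thesis
      by (simp add: evals)
  qed
  ultimately have iff: "eval_at v f = 0 \<and> eval_at v (dx f) = 0 \<and> eval_at v (dy f) = 0 \<and> eval_at v (dz f) = 0 \<longleftrightarrow>
      (\<exists>a\<in>A. \<exists>b\<in>A. a \<noteq> b \<and> dot3 a v = 0 \<and> dot3 b v = 0)" for v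
    by blast
  have "p \<in> sing_points f \<longleftrightarrow> (\<exists>a\<in>A. \<exists>b\<in>A. a \<noteq> b \<and> (\<forall>v\<in>p. dot3 a v = 0 \<and> dot3 b v = 0))" if p: "p \<in> proj_plane" for p
  proof -
    obtain v where v: "v \<noteq> 0" "p = vec.span {v}"
      using p by (auto simp: proj_plane_def)
    have vp: "v \<in> p"
      using v(2) vec.span_base by blast
    have two: "(\<forall>w\<in>p. dot3 a w = 0 \<and> dot3 b w = 0) \<longleftrightarrow> dot3 a v = 0 \<and> dot3 b v = 0" for a b
      using dot3_span_iff[OF p vp v(1)] by blast
    have "p \<in> sing_points f \<longleftrightarrow> (\<forall>w\<in>p. \<exists>a\<in>A. \<exists>b\<in>A. a \<noteq> b \<and> dot3 a w = 0 \<and> dot3 b w = 0)"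
      using p by (simp add: sing_points_def vanishes_at_iff iff)
    also have "\<dots> \<longleftrightarrow> (\<exists>a\<in>A. \<exists>b\<in>A. a \<noteq> b \<and> dot3 a v = 0 \<and> dot3 b v = 0)"
      using vp two by blast
    finally show ?thesis
      by (simp only: two)
  qed
  then show ?thesis
    by (auto simp: sing_points_def)
qed

lemma mult_at_sing_point:
  assumes A: "distinct_lines A" and f: "f = (\<Prod>a\<in>A. lin_form a)" and p: "p \<in> sing_points f"
  shows "2 \<le> mult_at A p"
proof -
  obtain a b where ab: "a \<in> A" "b \<in> A" "a \<noteq> b" "\<forall>v\<in>p. dot3 a v = 0 \<and> dot3 b v = 0"
    using p unfolding sing_points_eq[OF A f] by blast
  have "card {a, b} \<le> mult_at A p"
    unfolding mult_at_def using A ab by (intro card_mono) (auto simp: distinct_lines_def)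
  then show ?thesis
    using ab(3) by simp
qed

lemma common_point:
  assumes A: "distinct_lines A" and ab: "a \<in> A" "b \<in> A" "a \<noteq> b"
  shows "cross a b \<noteq> 0"
  using cross_zero_imp_multiple[of a b] A ab unfolding distinct_lines_def by metis

lemma sing_points_cover:
  assumes A: "distinct_lines A" and f: "f = (\<Prod>a\<in>A. lin_form a)"
  shows "covers (sing_points f) A"
proof -
  have "sing_points f \<subseteq> (\<lambda>(a, b). vec.span {cross a b}) ` (A \<times> A)"
  proof
    fix p assume "p \<in> sing_points f"
    then obtain a b where p: "p \<in> proj_plane"
      and ab: "a \<in> A" "b \<in> A" "a \<noteq> b" "\<forall>v\<in>p. dot3 a v = 0 \<and> dot3 b v = 0"
      unfolding sing_points_eq[OF A f] by blast
    obtain v where v: "v \<noteq> 0" "p = vec.span {v}"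
      using p by (auto simp: proj_plane_def)
    have "v \<in> p"
      using v(2) vec.span_base by blast
    then have "cross v (cross a b) = 0"
      using ab(4) by (intro cross_cross) auto
    then have "v \<in> vec.span {cross a b}"
      using cross_zero_imp_multiple[OF _ common_point[OF A ab(1-3)], of v] by (auto simp: vec.span_singleton)
    then have "p = vec.span {cross a b}"
      using span_singleton_eq[OF _ v(1)] v(2) by simp
    then show "p \<in> (\<lambda>(a, b). vec.span {cross a b}) ` (A \<times> A)"
      using ab by auto
  qed
  moreover have "finite A"
    using A by (simp add: distinct_lines_def)
  ultimately have "finite (sing_points f)"
    using finite_subset by blast
  moreover have "vec.span {v} \<in> sing_points f"
    if "a \<in> A" "b \<in> A" "a \<noteq> b" "v \<noteq> 0" "dot3 a v = 0" "dot3 b v = 0" for a b v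
    unfolding sing_points_eq[OF A f] using that dot3_span[of v a] dot3_span[of v b] by (auto simp: proj_plane_def)
  ultimately show ?thesis
    unfolding covers_def by blast
qed

text \<open>In each of the three charts, the lines through \<open>p\<close> stay pairwise distinct after one of the three
  coefficients is dropped: the dropped coefficient is determined by the other two and \<open>p\<close>.\<close>

lemma tjurina_at_bound:
  assumes A: "distinct_lines A" and f: "f = (\<Prod>a\<in>A. lin_form a)" and p: "p \<in> sing_points f"
  shows "(mult_at A p - 1)\<^sup>2 \<le> tjurina_at f p"
proof -
  have finA: "finite A"
    using A by (simp add: distinct_lines_def)
  have pp: "p \<in> proj_plane"
    using p by (simp add: sing_points_def)
  define v where "v = (SOME v. v \<in> p \<and> v \<noteq> 0)"
  have "\<exists>v. v \<in> p \<and> v \<noteq> 0"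
    using pp vec.span_base unfolding proj_plane_def by blast
  then have v: "v \<in> p" "v \<noteq> 0"
    unfolding v_def by (metis (mono_tags, lifting) someI_ex)+
  define B where "B = {a \<in> A. dot3 a v = 0}"
  have m: "card B = mult_at A p"
    unfolding mult_at_def B_def by (simp only: dot3_span_iff[OF pp v])
  have m2: "2 \<le> mult_at A p"
    by (rule mult_at_sing_point[OF assms])
  have cr: "cross a b \<noteq> 0" if "a \<in> B" "b \<in> B" "a \<noteq> b" for a b
    using that common_point[OF A] by (simp add: B_def)
  have germ: "(mult_at A p - 1)\<^sup>2 \<le> tjurina_at f p"
    if loc: "local_equation f v = (\<Prod>a\<in>A. lin2 (dot3 a v / s) (p' a) (q' a))" and s: "s \<noteq> 0"
      and ind: "\<And>a b. dot3 a v = 0 \<Longrightarrow> dot3 b v = 0 \<Longrightarrow> p' a * q' b = p' b * q' a \<Longrightarrow> cross a b = 0" for s p' q'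
  proof -
    have "B = {a \<in> A. dot3 a v / s = 0}"
      using s by (simp add: B_def)
    moreover have "p' a * q' b \<noteq> p' b * q' a" if "a \<in> B" "b \<in> B" "a \<noteq> b" for a b
      using ind[of a b] cr[OF that] that by (auto simp: B_def)
    ultimately have "(mult_at A p - 1)\<^sup>2 \<le> tjurina_germ (\<Prod>a\<in>A. lin2 (dot3 a v / s) (p' a) (q' a))"
      using m m2 by (intro tjurina_germ_lines[OF finA]) auto
    then show ?thesis
      by (simp add: tjurina_at_def v_def[symmetric] loc)
  qed
  have eval: "eval3 fps2_const f x y z = (\<Prod>a\<in>A. fps2_const (a$1) * x + fps2_const (a$2) * y + fps2_const (a$3) * z)" for x y z
    by (simp add: f hom_ring_prod[OF hom_ring_eval3[OF hom_ring_fps2_const]] eval3_lin_form[OF hom_ring_fps2_const])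
  note hs = fps2_const_simps
  consider "v$3 \<noteq> 0" | "v$3 = 0" "v$2 \<noteq> 0" | "v$3 = 0" "v$2 = 0" "v$1 \<noteq> 0"
    using v(2) vec3_eqI[of v 0] by auto
  then show ?thesis
  proof cases
    case 1
    show ?thesis
    proof (rule germ)
      have "dot3 a v / v$3 = a$1 * (v$1 / v$3) + a$2 * (v$2 / v$3) + a$3" for a
        using 1 by (simp add: dot3_def add_divide_distrib)
      then have "fps2_const (dot3 a v / v$3) = fps2_const (a$1) * fps2_const (v$1 / v$3) + fps2_const (a$2) * fps2_const (v$2 / v$3) + fps2_const (a$3)" for a
        by (simp only: hs)
      then show "local_equation f v = (\<Prod>a\<in>A. lin2 (dot3 a v / v$3) (a$1) (a$2))"
        using 1 by (simp add: local_equation_def eval lin2_def hs(2) algebra_simps)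
      show "cross a b = 0" if "dot3 a v = 0" "dot3 b v = 0" "a$1 * b$2 = b$1 * a$2" for a b
      proof -
        have "cross v (cross a b) = 0" "cross a b $ 3 = 0"
          using cross_cross[OF that(1,2)] that(3) by (simp_all add: cross_def)
        then show ?thesis
          using 1 by (intro vec3_eqI) (simp_all add: cross_def[of v] vec_eq_iff forall_3)
      qed
    qed (use 1 in simp)
  next
    case 2
    show ?thesis
    proof (rule germ)
      have "dot3 a v / v$2 = a$1 * (v$1 / v$2) + a$2 + a$3 * (v$3 / v$2)" for a
        using 2 by (simp add: dot3_def add_divide_distrib)
      then have "fps2_const (dot3 a v / v$2) = fps2_const (a$1) * fps2_const (v$1 / v$2) + fps2_const (a$2) + fps2_const (a$3) * fps2_const (v$3 / v$2)" for a
        by (simp only: hs)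
      then show "local_equation f v = (\<Prod>a\<in>A. lin2 (dot3 a v / v$2) (a$1) (a$3))"
        using 2 by (simp add: local_equation_def eval lin2_def hs(2) algebra_simps)
      show "cross a b = 0" if "dot3 a v = 0" "dot3 b v = 0" "a$1 * b$3 = b$1 * a$3" for a b
      proof -
        have "cross v (cross a b) = 0" "cross a b $ 2 = 0"
          using cross_cross[OF that(1,2)] that(3) by (simp_all add: cross_def mult.commute)
        then show ?thesis
          using 2 by (intro vec3_eqI) (simp_all add: cross_def[of v] vec_eq_iff forall_3)
      qed
    qed (use 2 in simp)
  next
    case 3
    show ?thesis
    proof (rule germ)
      have "dot3 a v / v$1 = a$1 + a$2 * (v$2 / v$1) + a$3 * (v$3 / v$1)" for a
        using 3 by (simp add: dot3_def add_divide_distrib)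
      then have "fps2_const (dot3 a v / v$1) = fps2_const (a$1) + fps2_const (a$2) * fps2_const (v$2 / v$1) + fps2_const (a$3) * fps2_const (v$3 / v$1)" for a
        by (simp only: hs)
      then show "local_equation f v = (\<Prod>a\<in>A. lin2 (dot3 a v / v$1) (a$2) (a$3))"
        using 3 by (simp add: local_equation_def eval lin2_def hs(2) algebra_simps)
      show "cross a b = 0" if "dot3 a v = 0" "dot3 b v = 0" "a$2 * b$3 = b$2 * a$3" for a b
      proof -
        have "cross v (cross a b) = 0" "cross a b $ 1 = 0"
          using cross_cross[OF that(1,2)] that(3) by (simp_all add: cross_def mult.commute)
        then show ?thesis
          using 3 by (intro vec3_eqI) (simp_all add: cross_def[of v] vec_eq_iff forall_3)
      qed
    qed (use 3 in simp)
  qed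
qed

lemma card_off_diagonal:
  assumes "finite S"
  shows "card {(a, b). a \<in> S \<and> b \<in> S \<and> a \<noteq> b} = card S * (card S - 1)"
proof -
  have "{(a, b). a \<in> S \<and> b \<in> S \<and> a \<noteq> b} = (SIGMA a:S. S - {a})"
    by auto
  then show ?thesis
    using assms by simp
qed

text \<open>Every pair of distinct lines has a common point, which is counted on the right.\<close>

lemma pairs_le_sum_multiplicities:
  assumes A: "distinct_lines A" and P: "covers P A"
  shows "card A * (card A - 1) \<le> (\<Sum>p\<in>P. mult_at A p * (mult_at A p - 1))"
proof -
  have finA: "finite A" and finP: "finite P"
    using A P by (auto simp: distinct_lines_def covers_def)
  let ?S = "\<lambda>p. {a \<in> A. \<forall>v\<in>p. dot3 a v = 0}"
  let ?O = "\<lambda>S. {(a, b). a \<in> S \<and> b \<in> S \<and> a \<noteq> b}"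
  have "?O A \<subseteq> (\<Union>p\<in>P. ?O (?S p))"
  proof clarify
    fix a b assume ab: "a \<in> A" "b \<in> A" "a \<noteq> b"
    let ?p = "vec.span {cross a b}"
    have "?p \<in> P"
      using P ab common_point[OF A ab] cross_orthogonal unfolding covers_def by blast
    moreover have "a \<in> ?S ?p" "b \<in> ?S ?p"
      using ab cross_orthogonal dot3_span by auto
    ultimately show "(a, b) \<in> (\<Union>p\<in>P. ?O (?S p))"
      using ab(3) by blast
  qed
  moreover have "finite (?O (?S p))" for p
    by (rule finite_subset[of _ "A \<times> A"]) (use finA in auto)
  ultimately have "card (?O A) \<le> card (\<Union>p\<in>P. ?O (?S p))"
    using finP by (intro card_mono) auto
  also have "\<dots> \<le> (\<Sum>p\<in>P. card (?O (?S p)))"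
    by (rule card_UN_le[OF finP])
  also have "\<dots> = (\<Sum>p\<in>P. mult_at A p * (mult_at A p - 1))"
    unfolding mult_at_def by (intro sum.cong refl card_off_diagonal) (use finA in simp)
  finally show ?thesis
    using card_off_diagonal[OF finA] by simp
qed

section \<open>The bound for free arrangements\<close>

lemma proj_line_dot3: "proj_line a = {p \<in> proj_plane. \<forall>v\<in>p. dot3 a v = 0}"
  by (simp add: proj_line_def dot3_def)

lemma arrangement_vectors:
  assumes "line_arrangement L" "arrangement_equation L f"
  obtains A where "distinct_lines A" "card A = card L" "f = (\<Prod>a\<in>A. lin_form a)"
proof -
  obtain a where a: "\<And>l. l \<in> L \<Longrightarrow> a l \<noteq> 0" "\<And>l. l \<in> L \<Longrightarrow> l = proj_line (a l)"
    and f: "f = (\<Prod>l\<in>L. lin_form (a l))"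
    using assms(2) unfolding arrangement_equation_def by metis
  have inj: "inj_on a L"
    using a(2) by (metis inj_onI)
  have fin: "finite L"
    using assms(1) by (simp add: line_arrangement_def)
  have nm: "a l \<noteq> c *s a l'" if l: "l \<in> L" "l' \<in> L" "a l \<noteq> a l'" for l l' c
  proof
    assume e: "a l = c *s a l'"
    then have "c \<noteq> 0"
      using a(1)[OF l(1)] by auto
    then have "proj_line (a l) = proj_line (a l')"
      unfolding e proj_line_dot3 by (simp add: dot3_linear)
    then show False
      using a(2)[OF l(1)] a(2)[OF l(2)] l(3) by simp
  qed
  have "0 \<notin> a ` L"
    using a(1) by force
  then have "distinct_lines (a ` L)"
    using fin unfolding distinct_lines_def by (simp add: nm)
  then show ?thesis
    using that[of "a ` L"] inj f by (simp add: card_image prod.reindex)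
qed

theorem corollary4p2:
  fixes L :: "proj_point set set" and f :: poly3 and d :: nat
  assumes "line_arrangement L"
    and "card L = d"
    and "d \<ge> 2"
    and "arrangement_equation L f"
    and "AR_free_rank2 f"
  shows "real (total_tjurina f) \<ge> 3 * (real d - 1)^2 / 4"
proof -
  obtain A where A: "distinct_lines A" "card A = d" and f: "f = (\<Prod>a\<in>A. lin_form a)"
    using arrangement_vectors[OF assms(1,4)] assms(2) by metis
  let ?P = "sing_points f" and ?m = "mult_at A"
  have P: "covers ?P A"
    by (rule sing_points_cover[OF A(1) f])
  have "A \<noteq> {}"
    using A(2) assms(3) by auto
  then have free: "3 * (d - 1)\<^sup>2 \<le> 4 * ((d choose 2) + defect ?P A)"
    using free_defect_bound[OF A(1) _ P f assms(5)] A(2) by simp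
  have two: "2 * (n choose 2) = n * (n - 1)" for n :: nat
    unfolding choose_two by (intro dvd_mult_div_cancel) (cases n; simp)
  have "2 * ((d choose 2) + defect ?P A) = d * (d - 1) + (\<Sum>p\<in>?P. (?m p - 1) * (?m p - 1 - 1))"
    unfolding defect_def distrib_left two sum_distrib_left ..
  also have "\<dots> \<le> (\<Sum>p\<in>?P. ?m p * (?m p - 1)) + (\<Sum>p\<in>?P. (?m p - 1) * (?m p - 1 - 1))"
    using pairs_le_sum_multiplicities[OF A(1) P] A(2) by simp
  also have "\<dots> = (\<Sum>p\<in>?P. 2 * (?m p - 1)\<^sup>2)"
    unfolding sum.distrib[symmetric]
  proof (rule sum.cong)
    fix p assume "p \<in> ?P"
    then obtain k where "?m p = Suc (Suc k)"
      using mult_at_sing_point[OF A(1) f] by (metis Suc_le_D numeral_2_eq_2 Suc_le_mono)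
    then show "?m p * (?m p - 1) + (?m p - 1) * (?m p - 1 - 1) = 2 * (?m p - 1)\<^sup>2"
      by (simp add: power2_eq_square algebra_simps)
  qed simp
  also have "\<dots> \<le> (\<Sum>p\<in>?P. 2 * tjurina_at f p)"
    using tjurina_at_bound[OF A(1) f] by (intro sum_mono) simp
  also have "\<dots> = 2 * total_tjurina f"
    by (simp add: total_tjurina_def sum_distrib_left)
  finally have "3 * (d - 1)\<^sup>2 \<le> 4 * total_tjurina f"
    using free by linarith
  then have "real (3 * (d - 1)\<^sup>2) \<le> real (4 * total_tjurina f)"
    by (simp only: of_nat_le_iff)
  then show ?thesis
    using assms(3) by (simp add: of_nat_diff)
qed

end
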